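(* Let $M \subset \mathbb{R}^n$ be a connected submanifold which is a full, minimal, ruled helix with respect to a direction $d \in \mathbb{R}^n$, $d\neq 0$. Then $d$ is tangent to $M$ at every point. That is to say, the helix angle $\theta$ is zero and $M$ is (locally) a cylinder over a minimal submanifold contained in a hyperplane $H$ orthogonal to $d$.
   Context: For a submanifold $M\subset\mathbb{R}^n$ (any dimension and codimension) and a fixed nonzero vector $d\in\mathbb{R}^n$, write $d=d^{\top}+d^{\perp}$ for the decomposition of $d$ at $p\in M$ into components tangent and normal to $M$. $M$ is a helix with respect to $d$ if the angle $\theta(p)=\angle(T_pM,d)\in[0,\pi/2]$, given by $\|d^{\top}\|=\|d\|\cos\theta(p)$, is the same constant $\theta$ for all $p\in M$ (equivalently $\|d^\top\|$ is constant along $M$). The helix is ruled if the integral curves of $T:=d^{\top}/\|d^{\top}\|$ are geodesics of the Euclidean space, i.e. pieces of straight lines. $M$ is full if it is not contained in an affine hyperplane of $\mathbb{R}^n$. $M$ is minimal if its mean curvature vector vanishes. $M$ is (locally) a cylinder over a submanifold $N$ of a hyperplane $H\perp d$ if, near each of its points, $M$ coincides with an open part of $\{x+td: x\in N,\ t\in\mathbb{R}\}$ for such an $N$. All claims are of local nature. *)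

theory Defs
  imports "HOL-Analysis.Analysis"
begin

(* Only meaningful for open S: the derivatives are taken at x, not at x within S. *)
primrec times_differentiable_on ::
  "nat \<Rightarrow> 'a::real_normed_vector set \<Rightarrow> ('a \<Rightarrow> 'b::real_normed_vector) \<Rightarrow> bool" where
  "times_differentiable_on 0 S f \<longleftrightarrow> continuous_on S f"
| "times_differentiable_on (Suc k) S f \<longleftrightarrow>
     (\<forall>x\<in>S. f differentiable (at x)) \<and>
     (\<forall>v. times_differentiable_on k S (\<lambda>x. frechet_derivative f (at x) v))"

definition smooth_on ::
  "'a::real_normed_vector set \<Rightarrow> ('a \<Rightarrow> 'b::real_normed_vector) \<Rightarrow> bool" where
  "smooth_on S f \<longleftrightarrow> (\<forall>k. times_differentiable_on k S f)"

(* Embedded submanifolds, by slice charts. The model space R^m x 0 is replaced by an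
   arbitrary m-dimensional linear subspace S of the ambient space. *)
definition submanifold :: "nat \<Rightarrow> 'a::euclidean_space set \<Rightarrow> bool" where
  "submanifold m M \<longleftrightarrow>
     (\<forall>p\<in>M. \<exists>U (V :: 'a set) \<Phi> \<Psi> S.
        open U \<and> p \<in> U \<and> open V \<and> homeomorphism U V \<Phi> \<Psi> \<and>
        smooth_on U \<Phi> \<and> smooth_on V \<Psi> \<and>
        subspace S \<and> dim S = m \<and> \<Phi> ` (M \<inter> U) = V \<inter> S)"

definition tangent_space :: "'a::euclidean_space set \<Rightarrow> 'a \<Rightarrow> 'a set" where
  "tangent_space M p =
     {v. \<exists>\<epsilon>>0. \<exists>\<gamma> :: real \<Rightarrow> 'a.
           smooth_on {-\<epsilon><..<\<epsilon>} \<gamma> \<and> \<gamma> ` {-\<epsilon><..<\<epsilon>} \<subseteq> M \<and>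
           \<gamma> 0 = p \<and> (\<gamma> has_vector_derivative v) (at 0)}"

definition tangent_part :: "'a::euclidean_space set \<Rightarrow> 'a \<Rightarrow> 'a \<Rightarrow> 'a" where
  "tangent_part M p v =
     (THE u. u \<in> tangent_space M p \<and> (\<forall>w\<in>tangent_space M p. orthogonal (v - u) w))"

definition normal_part :: "'a::euclidean_space set \<Rightarrow> 'a \<Rightarrow> 'a \<Rightarrow> 'a" where
  "normal_part M p v = v - tangent_part M p v"

(* W is defined on a neighbourhood of p in the ambient space and is tangent to M along M. *)
definition tangent_field_near ::
  "'a::euclidean_space set \<Rightarrow> 'a \<Rightarrow> ('a \<Rightarrow> 'a) \<Rightarrow> bool" where
  "tangent_field_near M p W \<longleftrightarrow>
     (\<exists>U. open U \<and> p \<in> U \<and> smooth_on U W \<and> (\<forall>q\<in>M \<inter> U. W q \<in> tangent_space M q))"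

(* Gauss formula: the normal part of D_v W, where W is a tangent field with W(p) = w.
   For v, w tangent to M at p the value does not depend on the choice of W. *)
definition second_fundamental_form ::
  "'a::euclidean_space set \<Rightarrow> 'a \<Rightarrow> 'a \<Rightarrow> 'a \<Rightarrow> 'a" where
  "second_fundamental_form M p v w =
     normal_part M p
       (frechet_derivative (SOME W. tangent_field_near M p W \<and> W p = w) (at p) v)"

definition orthonormal_basis_of :: "'a::euclidean_space set \<Rightarrow> 'a set \<Rightarrow> bool" where
  "orthonormal_basis_of S B \<longleftrightarrow>
     pairwise orthogonal B \<and> (\<forall>e\<in>B. norm e = 1) \<and> span B = S"

(* The normalised trace of the second fundamental form, which does not depend on the
   choice of orthonormal basis; it is 0 for a 0-dimensional submanifold. *)
definition mean_curvature_vector :: "'a::euclidean_space set \<Rightarrow> 'a \<Rightarrow> 'a" where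
  "mean_curvature_vector M p =
     (1 / real (dim (tangent_space M p))) *\<^sub>R
       (\<Sum>e\<in>(SOME B. orthonormal_basis_of (tangent_space M p) B).
          second_fundamental_form M p e e)"

definition minimal :: "'a::euclidean_space set \<Rightarrow> bool" where
  "minimal M \<longleftrightarrow> (\<forall>p\<in>M. mean_curvature_vector M p = 0)"

definition full :: "'a::euclidean_space set \<Rightarrow> bool" where
  "full M \<longleftrightarrow> \<not> (\<exists>a b. a \<noteq> 0 \<and> M \<subseteq> {x. a \<bullet> x = b})"

definition helix :: "'a::euclidean_space set \<Rightarrow> 'a \<Rightarrow> real \<Rightarrow> bool" where
  "helix M d \<theta> \<longleftrightarrow>
     \<theta> \<in> {0..pi/2} \<and> (\<forall>p\<in>M. norm (tangent_part M p d) = norm d * cos \<theta>)"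

(* sgn x is x / norm x. Where the tangent part of d vanishes, sgn gives 0; a helix with
   this property has d normal everywhere, so if it is connected it is not full. *)
definition helix_field :: "'a::euclidean_space set \<Rightarrow> 'a \<Rightarrow> 'a \<Rightarrow> 'a" where
  "helix_field M d p = sgn (tangent_part M p d)"

(* The integral curves have constant speed, so being a geodesic of the Euclidean space
   is the same as being affine in the parameter. *)
definition ruled :: "'a::euclidean_space set \<Rightarrow> 'a \<Rightarrow> bool" where
  "ruled M d \<longleftrightarrow>
     (\<forall>I \<gamma>. open I \<and> is_interval I \<and> \<gamma> ` I \<subseteq> M \<and>
        (\<forall>t\<in>I. (\<gamma> has_vector_derivative helix_field M d (\<gamma> t)) (at t)) \<longrightarrow>
        (\<exists>a b. \<forall>t\<in>I. \<gamma> t = a + t *\<^sub>R b))"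

definition cylinder :: "'a::euclidean_space set \<Rightarrow> 'a \<Rightarrow> 'a set" where
  "cylinder N d = {x + t *\<^sub>R d | x t. x \<in> N}"

end

theory Submission
  imports Defs
begin

text \<open>
  Let \<open>X\<close> be the tangential part of \<open>d\<close>, a field of constant length, and \<open>E\<close> its derivative at a point
  \<open>p\<close>, as a map from \<open>T\<^sub>p M\<close> to the ambient space. As the integral curves of \<open>X\<close> are straight lines,
  \<open>q + t X q\<close> lies in \<open>M\<close> and \<open>X\<close> takes the same value there as at \<open>q\<close>, for \<open>q\<close> near \<open>p\<close> and small
  \<open>t\<close>; hence \<open>1 + t E\<close> maps \<open>T\<^sub>p M\<close> onto the tangent space at \<open>p + t X p\<close>. Minimality makes \<open>X\<close>
  divergence free, so the Gram determinant of \<open>1 + t E\<close> does not depend on \<open>t\<close>. It is a polynomial in \<open>t\<close>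
  of degree twice the rank of \<open>E\<close>, because the tangential part of \<open>E\<close> is symmetric (a second fundamental form).
  Therefore \<open>E = 0\<close>, \<open>X\<close> is constant, and \<open>d - X\<close> is a constant normal vector, which vanishes by fullness.

  The second fundamental form is handled through the orthogonal projections \<open>P q\<close> onto the tangent spaces:
  for tangent \<open>v\<close> and \<open>w\<close> it is the derivative of \<open>P q w\<close> in the direction \<open>v\<close>.
\<close>

subsection \<open>Calculus of smooth maps\<close>

text \<open>The map sending q to q + t X q is the flow of X, and the Gram determinant is the square
  of its Jacobian on M; a divergence-free flow preserves volume, so the determinant is constant.
  Minimality enters because the derivative of an orthogonal projection is symmetric: this turns the
  divergence of X into the inner product of d with the trace of the second fundamental form. Let B
  be the tangential part of E and C the product of the transpose of E with E. The Gram matrix of 1 +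
  t E has the linear term t times B plus its transpose. If B is symmetric, this is 2 t B, which
  vanishes on ker E together with C; so the matrix is the identity on ker E, while C is positive
  definite on the orthogonal complement. That is why the coefficient of t^(2 rank E) is not zero.
  For a nilpotent E with tangential values, constancy alone would prove nothing. Ruledness is a
  statement about integral curves that are already given. Their existence, for a common time around
  p, has to come from a differential equation solved in a chart.\<close>

lemma linear_sum_Basis:
  fixes f :: "'a::euclidean_space \<Rightarrow> 'b::real_vector"
  assumes "linear f"
  shows "f x = (\<Sum>b\<in>Basis. (x \<bullet> b) *\<^sub>R f b)"
proof -
  have "f (\<Sum>b\<in>Basis. (x \<bullet> b) *\<^sub>R b) = (\<Sum>b\<in>Basis. (x \<bullet> b) *\<^sub>R f b)"
    using assms by (simp add: linear_sum linear_scale)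
  then show ?thesis by (simp only: euclidean_representation)
qed

lemma times_differentiable_on_cong:
  assumes "open S" "\<And>x. x \<in> S \<Longrightarrow> f x = g x" "times_differentiable_on k S f"
  shows "times_differentiable_on k S g"
  using assms(2,3)
proof (induction k arbitrary: f g)
  case 0
  then show ?case by (simp cong: continuous_on_cong)
next
  case (Suc k)
  have d: "(g has_derivative frechet_derivative f (at x)) (at x)" if "x \<in> S" for x
  proof -
    have "(f has_derivative frechet_derivative f (at x)) (at x)"
      using Suc.prems(2) that frechet_derivative_works by auto
    then show ?thesis
      using has_derivative_transform_within_open[OF _ assms(1) that] Suc.prems(1) by metis
  qed
  then have e: "frechet_derivative g (at x) = frechet_derivative f (at x)" if "x \<in> S" for x
    using that frechet_derivative_at by metis
  have "times_differentiable_on k S (\<lambda>x. frechet_derivative g (at x) v)" for v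
    by (rule Suc.IH[of "\<lambda>x. frechet_derivative f (at x) v"]) (use Suc.prems e in auto)
  then show ?case using d by (auto simp: differentiable_def)
qed

lemma times_differentiable_on_subset:
  "times_differentiable_on k S f \<Longrightarrow> T \<subseteq> S \<Longrightarrow> times_differentiable_on k T f"
proof (induction k arbitrary: f)
  case (Suc k)
  then show ?case unfolding times_differentiable_on.simps by blast
qed (auto intro: continuous_on_subset)

lemma times_differentiable_on_frechet_derivative:
  "times_differentiable_on (Suc k) S f \<Longrightarrow>
    times_differentiable_on k S (\<lambda>x. frechet_derivative f (at x) v)"
  by simp

lemma times_differentiable_on_SucD:
  "times_differentiable_on (Suc k) S f \<Longrightarrow> times_differentiable_on k S f"
proof (induction k arbitrary: f)
  case 0
  then have "f differentiable (at x)" if "x \<in> S" for x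
    using that by simp
  then have "f differentiable_on S"
    unfolding differentiable_on_def using differentiable_at_withinI by blast
  then show ?case
    by (simp add: differentiable_imp_continuous_on)
next
  case (Suc k)
  have "times_differentiable_on k S (\<lambda>x. frechet_derivative f (at x) v)" for v
    by (rule Suc.IH, rule times_differentiable_on_frechet_derivative) (fact Suc.prems)
  moreover have "\<forall>x\<in>S. f differentiable (at x)"
    using Suc.prems unfolding times_differentiable_on.simps(2)[of "Suc k"] by (rule conjunct1)
  ultimately show ?case by simp
qed

text \<open>Allows induction on the order with an explicit formula for the derivative, built from
  functions to which the induction hypothesis applies.\<close>

lemma times_differentiable_on_SucI:
  assumes "open S" "\<And>x. x \<in> S \<Longrightarrow> (f has_derivative f' x) (at x)"
    "\<And>v. times_differentiable_on k S (\<lambda>x. f' x v)"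
  shows "times_differentiable_on (Suc k) S f"
proof -
  have "frechet_derivative f (at x) = f' x" if "x \<in> S" for x
    using assms(2)[OF that] frechet_derivative_at by metis
  then have "times_differentiable_on k S (\<lambda>x. frechet_derivative f (at x) v)" for v
    using times_differentiable_on_cong[OF assms(1) _ assms(3)[of v]] by simp
  then show ?thesis
    using assms(2) by (auto simp: differentiable_def)
qed

lemma times_differentiable_on_SucE:
  assumes "times_differentiable_on (Suc k) S f" "x \<in> S"
  shows "(f has_derivative frechet_derivative f (at x)) (at x)"
  using assms frechet_derivative_works by auto

lemma times_differentiable_on_const:
  "open S \<Longrightarrow> times_differentiable_on k S (\<lambda>x. c)"
proof (induction k arbitrary: c)
  case (Suc k)
  show ?case
    by (rule times_differentiable_on_SucI[where f' = "\<lambda>x v. 0"])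
      (simp_all only: Suc.prems has_derivative_const Suc.IH)
qed simp

lemma times_differentiable_on_linear:
  assumes "open S" "bounded_linear f"
  shows "times_differentiable_on k S f"
proof (cases k)
  case (Suc l)
  show ?thesis unfolding Suc
    by (rule times_differentiable_on_SucI[where f' = "\<lambda>x v. f v"])
      (simp_all only: assms bounded_linear_imp_has_derivative times_differentiable_on_const)
qed (use assms in \<open>simp add: linear_continuous_on\<close>)

lemma times_differentiable_on_add:
  assumes "open S" "times_differentiable_on k S f" "times_differentiable_on k S g"
  shows "times_differentiable_on k S (\<lambda>x. f x + g x)"
  using assms(2,3)
proof (induction k arbitrary: f g)
  case (Suc k)
  show ?case
  proof (rule times_differentiable_on_SucI[where
          f' = "\<lambda>x v. frechet_derivative f (at x) v + frechet_derivative g (at x) v"])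
    show "((\<lambda>x. f x + g x) has_derivative
      (\<lambda>v. frechet_derivative f (at x) v + frechet_derivative g (at x) v)) (at x)" if "x \<in> S" for x
      using Suc.prems that by (intro has_derivative_add times_differentiable_on_SucE)
    show "times_differentiable_on k S
      (\<lambda>x. frechet_derivative f (at x) v + frechet_derivative g (at x) v)" for v
      by (rule Suc.IH) (use Suc.prems in simp_all)
  qed (fact assms(1))
qed (auto intro: continuous_intros)

lemma (in bounded_bilinear) times_differentiable_on:
  assumes "open S" "times_differentiable_on k S f" "times_differentiable_on k S g"
  shows "times_differentiable_on k S (\<lambda>x. prod (f x) (g x))"
  using assms(2,3)
proof (induction k arbitrary: f g)
  case (Suc k)
  show ?case
  proof (rule times_differentiable_on_SucI[where f' = "\<lambda>x v. prod (f x) (frechet_derivative g (at x) v)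
      + prod (frechet_derivative f (at x) v) (g x)"])
    show "((\<lambda>x. prod (f x) (g x)) has_derivative
         (\<lambda>v. prod (f x) (frechet_derivative g (at x) v) + prod (frechet_derivative f (at x) v) (g x)))
          (at x)" if "x \<in> S" for x
      using Suc.prems that by (intro FDERIV times_differentiable_on_SucE)
    show "times_differentiable_on k S (\<lambda>x. prod (f x) (frechet_derivative g (at x) v)
      + prod (frechet_derivative f (at x) v) (g x))" for v
      using Suc.prems times_differentiable_on_SucD[OF Suc.prems(1)]
        times_differentiable_on_SucD[OF Suc.prems(2)]
      by (intro times_differentiable_on_add[OF assms(1)] Suc.IH) simp_all
  qed (use assms in auto)
qed (auto intro: continuous_on)

lemma times_differentiable_on_sum:
  assumes "open S" "\<And>i. i \<in> A \<Longrightarrow> times_differentiable_on k S (f i)"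
  shows "times_differentiable_on k S (\<lambda>x. \<Sum>i\<in>A. f i x)"
  using assms(2)
  by (induction A rule: infinite_finite_induct)
    (auto intro: times_differentiable_on_const times_differentiable_on_add assms(1))

lemma times_differentiable_on_compose:
  fixes f :: "'a::real_normed_vector \<Rightarrow> 'b::euclidean_space"
  assumes "open S" "f ` S \<subseteq> T" "times_differentiable_on k S f" "times_differentiable_on k T g"
  shows "times_differentiable_on k S (\<lambda>x. g (f x))"
  using assms(3,4)
proof (induction k arbitrary: g)
  case 0
  then show ?case using continuous_on_compose2[of T g S f] assms(2) by simp
next
  case (Suc k)
  \<comment> \<open>Differentiability of higher order is only known for derivatives in a fixed
    direction, whereas the chain rule applies the derivative of \<open>g\<close> to a direction that
    moves with \<open>x\<close>. Expanding that direction in the basis leaves fixed directions with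
    scalar coefficients.\<close>
  show ?case
  proof (rule times_differentiable_on_SucI[where f' = "\<lambda>x v. \<Sum>b\<in>Basis.
      (frechet_derivative f (at x) v \<bullet> b) *\<^sub>R frechet_derivative g (at (f x)) b"])
    show "((\<lambda>x. g (f x)) has_derivative (\<lambda>v. \<Sum>b\<in>Basis.
      (frechet_derivative f (at x) v \<bullet> b) *\<^sub>R frechet_derivative g (at (f x)) b)) (at x)"
      if x: "x \<in> S" for x
    proof -
      have g: "(g has_derivative frechet_derivative g (at (f x))) (at (f x))"
        using Suc.prems(2) assms(2) x by (intro times_differentiable_on_SucE) auto
      have comp: "((\<lambda>x. g (f x)) has_derivative
          (\<lambda>v. frechet_derivative g (at (f x)) (frechet_derivative f (at x) v))) (at x)"
        using has_derivative_compose[OF times_differentiable_on_SucE[OF Suc.prems(1) x] g] .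
      show ?thesis by (rule has_derivative_eq_rhs[OF comp]) (rule ext, rule linear_sum_Basis[OF has_derivative_linear[OF g]])
    qed
    show "times_differentiable_on k S (\<lambda>x. \<Sum>b\<in>Basis.
      (frechet_derivative f (at x) v \<bullet> b) *\<^sub>R frechet_derivative g (at (f x)) b)" for v
    proof (intro times_differentiable_on_sum[OF assms(1)]
        bounded_bilinear.times_differentiable_on[OF bounded_bilinear_scaleR assms(1)]
        bounded_bilinear.times_differentiable_on[OF bounded_bilinear_inner assms(1)]
        times_differentiable_on_const[OF assms(1)])
      show "times_differentiable_on k S (\<lambda>x. frechet_derivative f (at x) v)"
        using Suc.prems by simp
      show "times_differentiable_on k S (\<lambda>x. frechet_derivative g (at (f x)) b)" for b
        using Suc.IH[OF times_differentiable_on_SucD[OF Suc.prems(1)],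
            of "\<lambda>y. frechet_derivative g (at y) b"] Suc.prems(2) by simp
    qed
  qed (fact assms(1))
qed

lemma times_differentiable_on_inverse:
  fixes f :: "'a::real_normed_vector \<Rightarrow> real"
  assumes "open S" "times_differentiable_on k S f" "\<And>x. x \<in> S \<Longrightarrow> f x \<noteq> 0"
  shows "times_differentiable_on k S (\<lambda>x. inverse (f x))"
  using assms(2)
proof (induction k)
  case 0
  then show ?case using assms(3) by (auto intro: continuous_intros)
next
  case (Suc k)
  note bil = bounded_bilinear.times_differentiable_on[OF bounded_bilinear_mult assms(1)]
  have i: "times_differentiable_on k S (\<lambda>x. inverse (f x))"
    using Suc.IH times_differentiable_on_SucD[OF Suc.prems] by simp
  \<comment> \<open>The derivative is written as an iterated product, so that the bilinear rule and
    the case \<open>k\<close> for \<open>inverse (f x)\<close> cover it.\<close>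
  show ?case
  proof (rule times_differentiable_on_SucI[where f' = "\<lambda>x v.
      (inverse (f x) * inverse (f x)) * (- 1 * frechet_derivative f (at x) v)"])
    show "((\<lambda>x. inverse (f x)) has_derivative (\<lambda>v.
      (inverse (f x) * inverse (f x)) * (- 1 * frechet_derivative f (at x) v))) (at x)" if "x \<in> S" for x
      using times_differentiable_on_SucE[OF Suc.prems that] assms(3)[OF that]
      by (auto intro!: derivative_eq_intros)
    show "times_differentiable_on k S (\<lambda>x.
      (inverse (f x) * inverse (f x)) * (- 1 * frechet_derivative f (at x) v))" for v
      by (intro bil i times_differentiable_on_const assms(1)) (use Suc.prems in simp)
  qed (fact assms(1))
qed

lemma smooth_on_cong:
  "open S \<Longrightarrow> (\<And>x. x \<in> S \<Longrightarrow> f x = g x) \<Longrightarrow> smooth_on S f \<Longrightarrow> smooth_on S g"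
  unfolding smooth_on_def using times_differentiable_on_cong by blast

lemma smooth_on_subset: "smooth_on S f \<Longrightarrow> T \<subseteq> S \<Longrightarrow> smooth_on T f"
  unfolding smooth_on_def using times_differentiable_on_subset by blast

lemma smooth_on_const: "open S \<Longrightarrow> smooth_on S (\<lambda>x. c)"
  by (simp add: smooth_on_def times_differentiable_on_const)

lemma smooth_on_linear: "open S \<Longrightarrow> bounded_linear f \<Longrightarrow> smooth_on S f"
  by (simp add: smooth_on_def times_differentiable_on_linear)

lemma smooth_on_id: "open S \<Longrightarrow> smooth_on S (\<lambda>x. x)"
  by (simp add: smooth_on_linear bounded_linear_ident)

lemma smooth_on_add: 
  "open S \<Longrightarrow> smooth_on S f \<Longrightarrow> smooth_on S g \<Longrightarrow> smooth_on S (\<lambda>x. f x + g x)"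
  by (simp add: smooth_on_def times_differentiable_on_add)

lemma (in bounded_bilinear) smooth_on:
  "open S \<Longrightarrow> smooth_on S f \<Longrightarrow> smooth_on S g \<Longrightarrow> smooth_on S (\<lambda>x. prod (f x) (g x))"
  by (simp add: smooth_on_def times_differentiable_on)

lemmas smooth_on_scaleR = bounded_bilinear.smooth_on[OF bounded_bilinear_scaleR]
lemmas smooth_on_inner = bounded_bilinear.smooth_on[OF bounded_bilinear_inner]
lemmas smooth_on_mult = bounded_bilinear.smooth_on[OF bounded_bilinear_mult]

lemma smooth_on_diff:
  "open S \<Longrightarrow> smooth_on S f \<Longrightarrow> smooth_on S g \<Longrightarrow> smooth_on S (\<lambda>x. f x - g x)"
  using smooth_on_add[of S f "\<lambda>x. (-1) *\<^sub>R g x"] smooth_on_scaleR[of S "\<lambda>x. -1" g]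
  by (simp add: smooth_on_const)

lemma smooth_on_sum:
  "open S \<Longrightarrow> (\<And>i. i \<in> A \<Longrightarrow> smooth_on S (f i)) \<Longrightarrow> smooth_on S (\<lambda>x. \<Sum>i\<in>A. f i x)"
  by (simp add: smooth_on_def times_differentiable_on_sum)

lemma smooth_on_prod:
  fixes f :: "'i \<Rightarrow> 'a::real_normed_vector \<Rightarrow> real"
  assumes "open S" "\<And>i. i \<in> A \<Longrightarrow> smooth_on S (f i)"
  shows "smooth_on S (\<lambda>x. \<Prod>i\<in>A. f i x)"
  using assms(2)
  by (induction A rule: infinite_finite_induct)
    (auto intro: smooth_on_const smooth_on_mult assms(1))

lemma smooth_on_compose:
  fixes f :: "'a::real_normed_vector \<Rightarrow> 'b::euclidean_space"
  shows "open S \<Longrightarrow> smooth_on S f \<Longrightarrow> smooth_on T g \<Longrightarrow> f ` S \<subseteq> T \<Longrightarrow> smooth_on S (\<lambda>x. g (f x))"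
  by (simp add: smooth_on_def times_differentiable_on_compose)

lemma smooth_on_linear_compose:
  fixes f :: "'a::real_normed_vector \<Rightarrow> 'b::euclidean_space"
  shows "open S \<Longrightarrow> smooth_on S f \<Longrightarrow> bounded_linear L \<Longrightarrow> smooth_on S (\<lambda>x. L (f x))"
  by (rule smooth_on_compose[where T = UNIV]) (auto intro: smooth_on_linear)

lemma smooth_on_inverse:
  fixes f :: "'a::real_normed_vector \<Rightarrow> real"
  shows "open S \<Longrightarrow> smooth_on S f \<Longrightarrow> (\<And>x. x \<in> S \<Longrightarrow> f x \<noteq> 0) \<Longrightarrow> smooth_on S (\<lambda>x. inverse (f x))"
  by (simp add: smooth_on_def times_differentiable_on_inverse)

lemma smooth_on_divide:
  fixes f g :: "'a::real_normed_vector \<Rightarrow> real"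
  shows "open S \<Longrightarrow> smooth_on S f \<Longrightarrow> smooth_on S g \<Longrightarrow> (\<And>x. x \<in> S \<Longrightarrow> g x \<noteq> 0)
    \<Longrightarrow> smooth_on S (\<lambda>x. f x / g x)"
  unfolding divide_inverse by (intro smooth_on_mult smooth_on_inverse)

lemma smooth_on_has_derivative:
  "smooth_on S f \<Longrightarrow> x \<in> S \<Longrightarrow> (f has_derivative frechet_derivative f (at x)) (at x)"
  unfolding smooth_on_def using times_differentiable_on_SucE by blast

lemma smooth_on_frechet_derivative:
  "smooth_on S f \<Longrightarrow> smooth_on S (\<lambda>x. frechet_derivative f (at x) v)"
  unfolding smooth_on_def by (metis times_differentiable_on.simps(2))

lemma smooth_on_imp_continuous_on: "smooth_on S f \<Longrightarrow> continuous_on S f"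
  unfolding smooth_on_def by (metis times_differentiable_on.simps(1))

lemma smooth_on_euclidean:
  fixes f :: "'a::real_normed_vector \<Rightarrow> 'b::euclidean_space"
  assumes "open S" "\<And>b. b \<in> Basis \<Longrightarrow> smooth_on S (\<lambda>x. f x \<bullet> b)"
  shows "smooth_on S f"
proof -
  have "smooth_on S (\<lambda>x. \<Sum>b\<in>Basis. (f x \<bullet> b) *\<^sub>R b)"
    by (intro smooth_on_sum smooth_on_scaleR smooth_on_const assms)
  then show ?thesis by (simp add: euclidean_representation)
qed

lemma smooth_on_vec_nth:
  fixes f :: "'a::real_normed_vector \<Rightarrow> real ^ 'n"
  shows "open S \<Longrightarrow> smooth_on S f \<Longrightarrow> smooth_on S (\<lambda>x. f x $ i)"
  by (rule smooth_on_linear_compose[where L = "\<lambda>v. v $ i"]) (auto intro: bounded_linear_vec_nth)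

lemma smooth_on_vec_lambda:
  fixes f :: "'a::real_normed_vector \<Rightarrow> real ^ 'n"
  assumes "open S" "\<And>i. smooth_on S (\<lambda>x. f x $ i)"
  shows "smooth_on S f"
  by (rule smooth_on_euclidean) (auto simp: assms Basis_vec_def inner_axis)

lemma smooth_on_det:
  fixes A :: "'a::real_normed_vector \<Rightarrow> real ^ 'n ^ 'n"
  assumes "open S" "\<And>i j. smooth_on S (\<lambda>x. A x $ i $ j)"
  shows "smooth_on S (\<lambda>x. det (A x))"
  unfolding det_def
  by (intro smooth_on_sum smooth_on_mult smooth_on_prod smooth_on_const assms)

section \<open>Symmetry of second derivatives and the smooth inverse function theorem\<close>

lemma has_vector_derivative_along_line:
  assumes "(f has_derivative f') (at (a + s *\<^sub>R u))"
  shows "((\<lambda>s. f (a + s *\<^sub>R u)) has_vector_derivative f' u) (at s)"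
proof -
  have "((\<lambda>s. a + s *\<^sub>R u) has_derivative (\<lambda>h. h *\<^sub>R u)) (at s)"
    by (auto intro!: derivative_eq_intros)
  from has_derivative_compose[OF this assms]
  have "((\<lambda>s. f (a + s *\<^sub>R u)) has_derivative (\<lambda>h. f' (h *\<^sub>R u))) (at s)" .
  moreover have "f' (h *\<^sub>R u) = h *\<^sub>R f' u" for h
    using has_derivative_linear[OF assms] by (simp add: linear_scale)
  ultimately show ?thesis unfolding has_vector_derivative_def by simp
qed

text \<open>Mean value theorem twice, first along \<open>u\<close> for the increment of
  \<open>f\<close> in direction \<open>v\<close>, then along \<open>v\<close> for the derivative.
  The second difference is symmetric in \<open>u\<close> and \<open>v\<close>, so exchanging them
  compares the two mixed derivatives.\<close>

lemma second_difference_eq: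
  fixes f :: "'a::real_normed_vector \<Rightarrow> real"
  assumes "smooth_on S f" "h > 0"
    and S: "\<And>s t. 0 \<le> s \<Longrightarrow> s \<le> h \<Longrightarrow> 0 \<le> t \<Longrightarrow> t \<le> h \<Longrightarrow> x + s *\<^sub>R u + t *\<^sub>R v \<in> S"
  obtains s t where "0 < s" "s < h" "0 < t" "t < h"
    "f (x + h *\<^sub>R u + h *\<^sub>R v) - f (x + h *\<^sub>R u) - f (x + h *\<^sub>R v) + f x
      = h * h * frechet_derivative (\<lambda>y. frechet_derivative f (at y) u) (at (x + s *\<^sub>R u + t *\<^sub>R v)) v"
proof -
  define F where "F y = frechet_derivative f (at y) u" for y
  define \<phi> where "\<phi> s = f (x + h *\<^sub>R v + s *\<^sub>R u) - f (x + s *\<^sub>R u)" for s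
  have F: "smooth_on S F"
    unfolding F_def by (rule smooth_on_frechet_derivative) fact
  have "DERIV \<phi> s :> F (x + h *\<^sub>R v + s *\<^sub>R u) - F (x + s *\<^sub>R u)" if "0 \<le> s" "s \<le> h" for s
    unfolding \<phi>_def F_def has_real_derivative_iff_has_vector_derivative
    using S[of s h] S[of s 0] that \<open>h > 0\<close>
    by (intro has_vector_derivative_diff has_vector_derivative_along_line
        smooth_on_has_derivative[OF assms(1)]) (auto simp: ac_simps)
  from MVT2[OF \<open>h > 0\<close> this] obtain s where s: "0 < s" "s < h"
    and 1: "\<phi> h - \<phi> 0 = (h - 0) * (F (x + h *\<^sub>R v + s *\<^sub>R u) - F (x + s *\<^sub>R u))" by blast
  have "DERIV (\<lambda>t. F ((x + s *\<^sub>R u) + t *\<^sub>R v)) t :>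
      frechet_derivative F (at ((x + s *\<^sub>R u) + t *\<^sub>R v)) v" if "0 \<le> t" "t \<le> h" for t
    unfolding has_real_derivative_iff_has_vector_derivative
    using S[of s t] that s
    by (intro has_vector_derivative_along_line smooth_on_has_derivative[OF F]) auto
  from MVT2[OF \<open>h > 0\<close> this] obtain t where t: "0 < t" "t < h"
    and 2: "F ((x + s *\<^sub>R u) + h *\<^sub>R v) - F ((x + s *\<^sub>R u) + 0 *\<^sub>R v)
      = (h - 0) * frechet_derivative F (at ((x + s *\<^sub>R u) + t *\<^sub>R v)) v" by blast
  have "f (x + h *\<^sub>R u + h *\<^sub>R v) - f (x + h *\<^sub>R u) - f (x + h *\<^sub>R v) + f x = \<phi> h - \<phi> 0"
    by (simp add: \<phi>_def ac_simps)
  also have "\<dots> = h * (F ((x + s *\<^sub>R u) + h *\<^sub>R v) - F ((x + s *\<^sub>R u) + 0 *\<^sub>R v))"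
    using 1 by (simp add: ac_simps)
  also have "\<dots> = h * h * frechet_derivative F (at ((x + s *\<^sub>R u) + t *\<^sub>R v)) v"
    using 2 by simp
  finally show ?thesis using that[OF s t] unfolding F_def by blast
qed

lemma symmetric_second_derivative_real:
  fixes f :: "'a::real_normed_vector \<Rightarrow> real"
  assumes "open S" "smooth_on S f" "x \<in> S"
  shows "frechet_derivative (\<lambda>y. frechet_derivative f (at y) u) (at x) v
    = frechet_derivative (\<lambda>y. frechet_derivative f (at y) v) (at x) u" (is "?A x = ?B x")
proof (rule ccontr)
  assume ne: "?A x \<noteq> ?B x"
  \<comment> \<open>Half the gap: two equal numbers cannot lie within \<open>e\<close> of
    \<open>?A x\<close> and of \<open>?B x\<close> respectively.\<close>
  define e where "e = \<bar>?A x - ?B x\<bar> / 2"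
  have e: "e > 0" using ne by (simp add: e_def)
  have "continuous_on S ?A" "continuous_on S ?B"
    by (intro smooth_on_imp_continuous_on smooth_on_frechet_derivative assms)+
  then have "isCont ?A x" "isCont ?B x"
    using assms by (auto simp: continuous_on_eq_continuous_at)
  then have "(?A \<longlongrightarrow> ?A x) (nhds x)" "(?B \<longlongrightarrow> ?B x) (nhds x)"
    by (simp_all only: continuous_at tendsto_at_iff_tendsto_nhds[of ?A] tendsto_at_iff_tendsto_nhds[of ?B])
  from this[THEN tendstoD, OF e]
  have "\<forall>\<^sub>F y in nhds x. dist (?A y) (?A x) < e" "\<forall>\<^sub>F y in nhds x. dist (?B y) (?B x) < e" .
  moreover have "\<forall>\<^sub>F y in nhds x. y \<in> S"
    using assms by (simp add: eventually_nhds_in_open)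
  ultimately have "\<forall>\<^sub>F y in nhds x. y \<in> S \<and> dist (?A y) (?A x) < e \<and> dist (?B y) (?B x) < e"
    by eventually_elim simp
  then obtain \<delta> where \<delta>: "\<delta> > 0"
    "\<And>y. dist y x < \<delta> \<Longrightarrow> y \<in> S \<and> dist (?A y) (?A x) < e \<and> dist (?B y) (?B x) < e"
    unfolding eventually_nhds_metric by blast
  \<comment> \<open>Small enough for the whole parallelogram to stay in the
    \<open>\<delta>\<close>-ball; the summand 1 keeps the quotient defined when \<open>u\<close> and
    \<open>v\<close> vanish.\<close>
  define h where "h = \<delta> / (norm u + norm v + 1)"
  have pos: "norm u + norm v + 1 > 0" by (simp add: add_nonneg_pos)
  then have h: "h > 0" using \<delta>(1) by (simp add: h_def)
  have near: "dist (x + s *\<^sub>R u + t *\<^sub>R v) x < \<delta>"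
    if "0 \<le> s" "s \<le> h" "0 \<le> t" "t \<le> h" for s t
  proof -
    have "dist (x + s *\<^sub>R u + t *\<^sub>R v) x \<le> norm (s *\<^sub>R u) + norm (t *\<^sub>R v)"
      using norm_triangle_ineq[of "s *\<^sub>R u" "t *\<^sub>R v"] by (simp add: dist_norm)
    also have "\<dots> \<le> h * norm u + h * norm v"
      using that by (intro add_mono) (auto intro!: mult_right_mono)
    also have "\<dots> < h * (norm u + norm v + 1)"
      using h by (simp add: algebra_simps)
    also have "\<dots> = \<delta>" using pos by (simp add: h_def)
    finally show ?thesis .
  qed
  obtain s t where st: "0 < s" "s < h" "0 < t" "t < h" and 1:
    "f (x + h *\<^sub>R u + h *\<^sub>R v) - f (x + h *\<^sub>R u) - f (x + h *\<^sub>R v) + f x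
      = h * h * ?A (x + s *\<^sub>R u + t *\<^sub>R v)"
    by (rule second_difference_eq[OF assms(2) h, of x u v]) (use near \<delta> in auto)
  have near': "dist (x + s *\<^sub>R v + t *\<^sub>R u) x < \<delta>"
    if "0 \<le> s" "s \<le> h" "0 \<le> t" "t \<le> h" for s t
    using near[of t s] that by (simp add: ac_simps)
  obtain s' t' where st': "0 < s'" "s' < h" "0 < t'" "t' < h" and 2:
    "f (x + h *\<^sub>R v + h *\<^sub>R u) - f (x + h *\<^sub>R v) - f (x + h *\<^sub>R u) + f x
      = h * h * ?B (x + s' *\<^sub>R v + t' *\<^sub>R u)"
    by (rule second_difference_eq[OF assms(2) h, of x v u]) (use near' \<delta> in auto)
  have "f (x + h *\<^sub>R v + h *\<^sub>R u) = f (x + h *\<^sub>R u + h *\<^sub>R v)" by (simp add: ac_simps)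
  with 1 2 have "h * h * ?A (x + s *\<^sub>R u + t *\<^sub>R v) = h * h * ?B (x + s' *\<^sub>R v + t' *\<^sub>R u)"
    by linarith
  then have "?A (x + s *\<^sub>R u + t *\<^sub>R v) = ?B (x + s' *\<^sub>R v + t' *\<^sub>R u)"
    using h by simp
  moreover have "dist (?A (x + s *\<^sub>R u + t *\<^sub>R v)) (?A x) < e"
    using \<delta>(2)[OF near[of s t]] st by simp
  moreover have "dist (?B (x + s' *\<^sub>R v + t' *\<^sub>R u)) (?B x) < e"
    using \<delta>(2)[OF near'[of s' t']] st' by simp
  ultimately show False unfolding e_def dist_real_def by (simp add: abs_if field_simps split: if_splits)
qed

lemma frechet_derivative_inner_left:
  assumes "f differentiable (at x)"
  shows "frechet_derivative (\<lambda>y. f y \<bullet> b) (at x) v = frechet_derivative f (at x) v \<bullet> b"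
proof -
  have "((\<lambda>y. f y \<bullet> b) has_derivative (\<lambda>v. frechet_derivative f (at x) v \<bullet> b)) (at x)"
    using assms by (intro has_derivative_inner_left) (simp add: frechet_derivative_works)
  then show ?thesis by (metis frechet_derivative_at)
qed

lemma symmetric_second_derivative:
  fixes f :: "'a::real_normed_vector \<Rightarrow> 'b::euclidean_space"
  assumes "open S" "smooth_on S f" "x \<in> S"
  shows "frechet_derivative (\<lambda>y. frechet_derivative f (at y) u) (at x) v
    = frechet_derivative (\<lambda>y. frechet_derivative f (at y) v) (at x) u"
proof (rule euclidean_eqI)
  fix b :: 'b assume "b \<in> Basis"
  have 1: "frechet_derivative (\<lambda>y. frechet_derivative f (at y) u) (at x) v \<bullet> b
    = frechet_derivative (\<lambda>y. frechet_derivative (\<lambda>y. f y \<bullet> b) (at y) u) (at x) v" for u v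
  proof -
    have D: "(\<lambda>y. frechet_derivative f (at y) u) differentiable (at x)"
      using smooth_on_has_derivative[OF smooth_on_frechet_derivative[OF assms(2)] assms(3)]
      by (auto simp: differentiable_def)
    have eq: "frechet_derivative f (at y) u \<bullet> b = frechet_derivative (\<lambda>y. f y \<bullet> b) (at y) u"
      if "y \<in> S" for y
      using smooth_on_has_derivative[OF assms(2) that]
      by (intro frechet_derivative_inner_left[symmetric]) (auto simp: differentiable_def)
    have "((\<lambda>y. frechet_derivative f (at y) u \<bullet> b) has_derivative
        (\<lambda>v. frechet_derivative (\<lambda>y. frechet_derivative f (at y) u) (at x) v \<bullet> b)) (at x)"
      using D by (intro has_derivative_inner_left) (simp add: frechet_derivative_works)
    then have "((\<lambda>y. frechet_derivative (\<lambda>y. f y \<bullet> b) (at y) u) has_derivative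
        (\<lambda>v. frechet_derivative (\<lambda>y. frechet_derivative f (at y) u) (at x) v \<bullet> b)) (at x)"
      by (rule has_derivative_transform_within_open[OF _ assms(1,3)]) (rule eq)
    then show ?thesis using frechet_derivative_at by metis
  qed
  have "smooth_on S (\<lambda>y. f y \<bullet> b)"
    by (intro smooth_on_inner smooth_on_const assms)
  then show "frechet_derivative (\<lambda>y. frechet_derivative f (at y) u) (at x) v \<bullet> b
    = frechet_derivative (\<lambda>y. frechet_derivative f (at y) v) (at x) u \<bullet> b"
    unfolding 1 by (rule symmetric_second_derivative_real[OF assms(1) _ assms(3)])
qed

text \<open>The inverse function theorem gives a differentiable inverse \<open>g\<close> whose
  derivative at \<open>y\<close> is the inverse of that of \<open>f\<close> at \<open>g y\<close>.
  By Cramer's rule this is a smooth function of \<open>g y\<close>, so each order of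
  differentiability of \<open>g\<close> yields the next.\<close>

lemma smooth_inverse_function:
  fixes f :: "real ^ 'n \<Rightarrow> real ^ 'n"
  assumes "open U" "smooth_on U f" "x0 \<in> U" "inj (frechet_derivative f (at x0))"
  obtains U' V g where "open U'" "U' \<subseteq> U" "x0 \<in> U'" "open V" "homeomorphism U' V f g"
    "smooth_on V g"
proof -
  define f' where "f' x = Blinfun (frechet_derivative f (at x))" for x
  have f': "blinfun_apply (f' x) = frechet_derivative f (at x)" if "x \<in> U" for x
    unfolding f'_def
    using has_derivative_bounded_linear[OF smooth_on_has_derivative[OF assms(2) that]]
    by (rule bounded_linear_Blinfun_apply)
  have der: "(f has_derivative blinfun_apply (f' x)) (at x)" if "x \<in> U" for x
    using smooth_on_has_derivative[OF assms(2) that] f'[OF that] by simp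
  have cont: "continuous_on U f'"
  proof (rule continuous_on_blinfun_componentwise)
    show "continuous_on U (\<lambda>x. blinfun_apply (f' x) i)" for i
      using smooth_on_imp_continuous_on[OF smooth_on_frechet_derivative[OF assms(2), of i]]
      by (simp add: f' cong: continuous_on_cong)
  qed
  have "linear (frechet_derivative f (at x0))"
    using smooth_on_has_derivative[OF assms(2,3)] has_derivative_linear by blast
  then obtain k where k: "linear k" "k \<circ> frechet_derivative f (at x0) = id"
    using linear_injective_left_inverse assms(4) by blast
  have inv: "Blinfun k o\<^sub>L f' x0 = id_blinfun"
    by (rule blinfun_eqI)
      (use k f'[OF assms(3)] in \<open>simp add: bounded_linear_Blinfun_apply linear_conv_bounded_linear
          pointfree_idE\<close>)
  obtain U' V g g' where U': "open U'" "U' \<subseteq> U" "x0 \<in> U'" "open V" "homeomorphism U' V f g"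
    and g: "\<And>y. y \<in> V \<Longrightarrow> (g has_derivative (g' y)) (at y)"
    "\<And>y. y \<in> V \<Longrightarrow> g' y = Hilbert_Choice.inv (blinfun_apply (f'(g y)))"
    and bij: "\<And>y. y \<in> V \<Longrightarrow> bij (blinfun_apply (f'(g y)))"
    by (rule inverse_function_theorem[OF assms(1) der cont assms(3) inv]) blast+
  have gV: "g ` V = U'" using U'(5) by (simp add: homeomorphism_def)
  define A where "A x = matrix (frechet_derivative f (at x))" for x
  have A: "A x *v w = frechet_derivative f (at x) w" if "x \<in> U" for x w
    unfolding A_def using smooth_on_has_derivative[OF assms(2) that]
    by (intro matrix_works) (auto simp: linear_matrix_vector_mul_eq dest: has_derivative_linear)
  have det: "det (A x) \<noteq> 0" if "x \<in> U'" for x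
  proof -
    have "x \<in> g ` V" using that by (simp only: gV)
    then obtain y where y: "y \<in> V" "x = g y" by (elim imageE)
    have "x \<in> U" using that U' by auto
    then have "inj ((*v) (A x))"
      using bij[OF y(1)] f'[OF \<open>x \<in> U\<close>] A[OF \<open>x \<in> U\<close>] y(2)
      by (simp add: bij_def fun_eq_iff inj_def)
    then show ?thesis
      using matrix_left_invertible_injective[of "A x"] invertible_left_inverse[of "A x"]
        invertible_det_nz[of "A x"] by blast
  qed
  \<comment> \<open>Cramer's formula for the solution of \<open>A x *v w = v\<close>, in which
    column \<open>k\<close> is replaced by \<open>v\<close>; it is visibly smooth in
    \<open>x\<close>.\<close>
  define J where "J v x = (\<chi> k. det (\<chi> i j. if j = k then v $ i else A x $ i $ j) / det (A x))"
    for v x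
  have sA: "smooth_on U' (\<lambda>x. A x $ i $ j)" for i j
    unfolding A_def matrix_def
    using smooth_on_vec_nth[OF U'(1) smooth_on_frechet_derivative[OF
          smooth_on_subset[OF assms(2) U'(2)]]] by simp
  have sJ: "smooth_on U' (J v)" for v
  proof (rule smooth_on_vec_lambda[OF U'(1)])
    have "smooth_on U' (\<lambda>x. (if j = k then v $ i else A x $ i $ j))" for i j k
      by (cases "j = k") (auto intro: smooth_on_const sA U'(1))
    then show "smooth_on U' (\<lambda>x. J v x $ k)" for k
      unfolding J_def vec_lambda_beta
      by (intro smooth_on_divide U'(1) smooth_on_det det sA) simp_all
  qed
  have J: "g' y v = J v (g y)" if "y \<in> V" for y v
  proof -
    have x: "g y \<in> U'" "g y \<in> U" using that gV U'(2) by auto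
    have "A (g y) *v g' y v = v"
      using g(2)[OF that] bij[OF that] f'[OF x(2)] A[OF x(2)]
      by (simp add: bij_def surj_f_inv_f)
    then show ?thesis using cramer[OF det[OF x(1)]] unfolding J_def by blast
  qed
  have "times_differentiable_on k V g" for k
  proof (induction k)
    case 0
    then show ?case using U'(5) by (simp add: homeomorphism_def)
  next
    case (Suc k)
    have "times_differentiable_on k V (\<lambda>y. J v (g y))" for v
      by (rule times_differentiable_on_compose[OF U'(4) _ Suc.IH, of U'])
        (use gV sJ in \<open>auto simp: smooth_on_def\<close>)
    then have "times_differentiable_on k V (\<lambda>y. g' y v)" for v
      by (rule times_differentiable_on_cong[OF U'(4), rotated]) (simp add: J)
    with g(1) show ?case by (intro times_differentiable_on_SucI[OF U'(4)])
  qed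
  then show ?thesis using that U' by (simp add: smooth_on_def)
qed

subsection \<open>Ordinary differential equations\<close>

text \<open>Picard's theorem: the integral operator contracts by the factor \<open>a * L\<close>,
  and its fixed point solves the equation.\<close>

lemma ode_solution_exists:
  fixes G :: "'a::euclidean_space \<Rightarrow> 'a"
  assumes lip: "\<And>x y. norm (G x - G y) \<le> L * norm (x - y)" and "a > 0" "a * L < 1"
  obtains u where "u 0 = x0"
    "\<And>t. t \<in> {-a<..<a} \<Longrightarrow> (u has_vector_derivative G (u t)) (at t)"
proof -
  have L: "0 \<le> L" using order_trans[OF norm_ge_zero lip[of "SOME b. b \<in> Basis" 0]]
    by (simp add: zero_le_mult_iff some_in_eq norm_Basis)
  have contG: "continuous_on UNIV G"
    by (rule lipschitz_on_continuous_on[of L]) (use lip L in \<open>auto simp: lipschitz_on_def dist_norm\<close>)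
  \<comment> \<open>Clamping time to \<open>{-a..a}\<close> turns the iterates into bounded
    continuous functions on the whole line, which form a complete space.\<close>
  define c where "c t = max (-a) (min a t)" for t :: real
  define J where "J u t = integral {-a..t} (\<lambda>s. G (u s))" for u :: "real \<Rightarrow> 'a" and t
  \<comment> \<open>The integral from 0 to \<open>c t\<close>, as a difference of two integrals from
    \<open>-a\<close>; this treats both signs of \<open>t\<close> at once.\<close>
  define T where "T u t = x0 + J u (c t) - J u 0" for u t
  have c: "c t \<in> {-a..a}" for t using \<open>a > 0\<close> by (auto simp: c_def)
  have contc: "continuous_on A c" for A unfolding c_def by (intro continuous_intros)
  have J: "(J u has_vector_derivative G (u t)) (at t within {-a..a})"
    if "continuous_on UNIV u" "t \<in> {-a..a}" for u t
    unfolding J_def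
    by (rule integral_has_vector_derivative)
      (use that in \<open>auto intro: continuous_on_compose2[OF contG] continuous_on_subset\<close>)
  have contJ: "continuous_on {-a..a} (J u)" if "continuous_on UNIV u" for u
    unfolding continuous_on_eq_continuous_within
    using J[OF that] has_vector_derivative_continuous by blast
  have T: "T u \<in> bcontfun" if "continuous_on UNIV u" for u
  proof -
    have 1: "continuous_on UNIV (T u)"
      unfolding T_def
      by (intro continuous_intros continuous_on_compose2[OF contJ[OF that] contc]) (use c in auto)
    have "range (T u) \<subseteq> T u ` {-a..a}"
    proof (intro image_subsetI)
      fix t
      have "T u t = T u (c t)" using c[of t] by (auto simp: T_def c_def)
      then show "T u t \<in> T u ` {-a..a}" using c by blast
    qed
    then have "bounded (range (T u))"
      using compact_imp_bounded[OF compact_continuous_image[OF continuous_on_subset[OF 1]]]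
      by (metis bounded_subset compact_Icc subset_UNIV)
    with 1 show ?thesis by (simp add: bcontfun_def)
  qed
  define \<T> where "\<T> u = Bcontfun (T (apply_bcontfun u))" for u :: "real \<Rightarrow>\<^sub>C 'a"
  have cu: "continuous_on UNIV (apply_bcontfun u)" for u :: "real \<Rightarrow>\<^sub>C 'a"
    by (rule continuous_on_apply_bcontfun)
  have \<T>: "apply_bcontfun (\<T> u) = T (apply_bcontfun u)" for u
    unfolding \<T>_def by (rule Bcontfun_inverse[OF T[OF cu]])
  have "dist (\<T> u) (\<T> w) \<le> (a * L) * dist u w" for u w
  proof (rule dist_bound)
    fix t
    have "norm ((J u (c t) - J w (c t)) - (J u 0 - J w 0)) \<le> L * dist u w * norm (c t - 0)"
    proof (rule differentiable_bound[where S = "{-a..a}" and f' = "\<lambda>t h. h *\<^sub>R (G (u t) - G (w t))"])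
      show "((\<lambda>t. J u t - J w t) has_derivative (\<lambda>h. h *\<^sub>R (G (u t) - G (w t)))) (at t within {-a..a})"
        if "t \<in> {-a..a}" for t
        using has_vector_derivative_diff[OF J[OF cu that, of u] J[OF cu that, of w]]
        by (simp add: has_vector_derivative_def)
      show "onorm (\<lambda>h. h *\<^sub>R (G (u t) - G (w t))) \<le> L * dist u w" for t
      proof (rule onorm_le)
        fix h :: real
        have "norm (G (u t) - G (w t)) \<le> L * dist u w"
          using lip[of "u t" "w t"] mult_left_mono[OF dist_bounded[of u t w] L]
          by (simp add: dist_norm)
        from mult_right_mono[OF this, of "\<bar>h\<bar>"]
        show "norm (h *\<^sub>R (G (u t) - G (w t))) \<le> L * dist u w * norm h"
          by (simp add: mult.commute)
      qed
    qed (use c \<open>a > 0\<close> in auto)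
    also have "\<dots> \<le> L * dist u w * a"
      using c[of t] L by (intro mult_left_mono) auto
    finally show "dist (\<T> u t) (\<T> w t) \<le> (a * L) * dist u w"
      unfolding \<T> T_def dist_norm by (simp add: algebra_simps)
  qed
  then have "\<exists>!u. \<T> u = u"
    using L \<open>a > 0\<close> \<open>a * L < 1\<close> by (intro banach_fix_type) auto
  then obtain u where u: "\<T> u = u" by blast
  have eq: "u t = x0 + J u (c t) - J u 0" for t
    using \<T>[of u] unfolding u T_def by (rule fun_cong)
  show ?thesis
  proof
    show "u 0 = x0" using \<open>a > 0\<close> by (simp add: eq[of 0] c_def)
    fix t assume t: "t \<in> {-a<..<a}"
    have "(J u has_vector_derivative G (u t)) (at t)"
      using J[OF cu, of t u] t by (simp add: at_within_Icc_at)
    then have "((\<lambda>t. x0 + J u t - J u 0) has_vector_derivative G (u t)) (at t)"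
      by (auto intro!: derivative_eq_intros)
    then show "(u has_vector_derivative G (u t)) (at t)"
      by (rule has_vector_derivative_transform_within_open[where S = "{-a<..<a}"])
        (use t in \<open>auto simp: eq c_def\<close>)
  qed
qed

lemma smooth_on_bounded_lipschitz:
  fixes G :: "'a::euclidean_space \<Rightarrow> 'b::real_normed_vector"
  assumes "smooth_on V G" "K \<subseteq> V" "compact K" "convex K"
  obtains B where "0 < B" "\<And>x. x \<in> K \<Longrightarrow> norm (G x) \<le> B"
    "\<And>x y. x \<in> K \<Longrightarrow> y \<in> K \<Longrightarrow> norm (G x - G y) \<le> B * norm (x - y)"
proof -
  \<comment> \<open>A bound for the operator norm of the derivative that is continuous by
    inspection.\<close>
  define D where "D x = (\<Sum>b\<in>Basis. norm (frechet_derivative G (at x) b))" for x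
  have "continuous_on K D"
    unfolding D_def using smooth_on_imp_continuous_on[OF smooth_on_frechet_derivative[OF assms(1)]]
    by (intro continuous_on_sum continuous_on_norm) (auto intro: continuous_on_subset[OF _ assms(2)])
  moreover have "continuous_on K (\<lambda>x. norm (G x))"
    using smooth_on_imp_continuous_on[OF assms(1)]
    by (intro continuous_on_norm) (auto intro: continuous_on_subset[OF _ assms(2)])
  ultimately have "continuous_on K (\<lambda>x. D x + norm (G x))" by (rule continuous_on_add)
  then have "bounded ((\<lambda>x. D x + norm (G x)) ` K)"
    using assms(3) compact_continuous_image compact_imp_bounded by blast
  then obtain B where B: "B > 0" "\<And>x. x \<in> K \<Longrightarrow> norm (D x + norm (G x)) \<le> B"
    unfolding bounded_pos by auto
  have D: "0 \<le> D x" for x by (simp add: D_def sum_nonneg)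
  show ?thesis
  proof
    show "norm (G x) \<le> B" if "x \<in> K" for x
      using B(2)[OF that] D[of x] by simp
    show "norm (G x - G y) \<le> B * norm (x - y)" if "x \<in> K" "y \<in> K" for x y
    proof (rule differentiable_bound[OF assms(4) _ _ that])
      fix x assume x: "x \<in> K"
      then have d: "(G has_derivative frechet_derivative G (at x)) (at x)"
        using smooth_on_has_derivative[OF assms(1)] assms(2) by blast
      then show "(G has_derivative frechet_derivative G (at x)) (at x within K)"
        by (rule has_derivative_at_withinI)
      have "onorm (frechet_derivative G (at x)) \<le> D x"
        unfolding D_def by (rule onorm_componentwise[OF has_derivative_bounded_linear[OF d]])
      also have "\<dots> \<le> B" using B(2)[OF x] norm_ge_zero[of "G x"]
        unfolding real_norm_def by linarith
      finally show "onorm (frechet_derivative G (at x)) \<le> B" .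
    qed
  qed (fact B(1))
qed

text \<open>Composing \<open>G\<close> with the nearest-point map onto a closed ball makes it
  globally Lipschitz. Solutions that start in the half-size ball cannot leave the large one within
  time \<open>\<epsilon>\<close>, and there the nearest-point map is the identity. The same
  \<open>\<epsilon>\<close> serves all these starting points.\<close>

lemma local_ode_solution:
  fixes G :: "'a::euclidean_space \<Rightarrow> 'a"
  assumes "open V" "smooth_on V G" "u0 \<in> V"
  obtains \<epsilon> r where "\<epsilon> > 0" "r > 0"
    "\<And>u1. u1 \<in> ball u0 r \<Longrightarrow> \<exists>u. u 0 = u1 \<and>
      (\<forall>t\<in>{-\<epsilon><..<\<epsilon>}. u t \<in> V \<and> (u has_vector_derivative G (u t)) (at t))"
proof -
  obtain R where R: "R > 0" "cball u0 R \<subseteq> V"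
    using assms(1,3) open_contains_cball by blast
  obtain B where B: "0 < B" "\<And>x. x \<in> cball u0 R \<Longrightarrow> norm (G x) \<le> B"
    "\<And>x y. x \<in> cball u0 R \<Longrightarrow> y \<in> cball u0 R \<Longrightarrow> norm (G x - G y) \<le> B * norm (x - y)"
    using smooth_on_bounded_lipschitz[OF assms(2) R(2)] by auto
  define \<pi> where "\<pi> = closest_point (cball u0 R)"
  have \<pi>: "\<pi> x \<in> cball u0 R" for x
    unfolding \<pi>_def using R by (intro closest_point_in_set) auto
  have lip\<pi>: "norm (\<pi> x - \<pi> y) \<le> norm (x - y)" for x y
    unfolding \<pi>_def using R closest_point_lipschitz[of "cball u0 R" x y] by (auto simp: dist_norm)
  define H where "H x = G (\<pi> x)" for x
  have H: "norm (H x - H y) \<le> B * norm (x - y)" for x y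
    unfolding H_def using order_trans[OF B(3)[OF \<pi> \<pi>] mult_left_mono[OF lip\<pi>]] B(1) by auto
  \<comment> \<open>The bound 1/2 makes the Picard operator a contraction; the bound
    \<open>R / 2\<close> limits the distance travelled at speed at most \<open>B\<close>.\<close>
  define \<epsilon> where "\<epsilon> = min (R / 2) (1 / 2) / B"
  have \<epsilon>: "\<epsilon> > 0" "\<epsilon> * B < 1" "\<epsilon> * B \<le> R / 2"
    using R B(1) by (auto simp: \<epsilon>_def)
  show ?thesis
  proof (rule that[of \<epsilon> "R / 2"])
    fix u1 assume u1: "u1 \<in> ball u0 (R / 2)"
    obtain u where u: "u 0 = u1"
      "\<And>t. t \<in> {-\<epsilon><..<\<epsilon>} \<Longrightarrow> (u has_vector_derivative H (u t)) (at t)"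
      using ode_solution_exists[OF H \<epsilon>(1,2)] by blast
    have "u t \<in> cball u0 R" if t: "t \<in> {-\<epsilon><..<\<epsilon>}" for t
    proof -
      have "norm (u t - u 0) \<le> B * norm (t - 0)"
      proof (rule differentiable_bound[where S = "{-\<epsilon><..<\<epsilon>}" and f' = "\<lambda>t h. h *\<^sub>R H (u t)"])
        show "(u has_derivative (\<lambda>h. h *\<^sub>R H (u t))) (at t within {-\<epsilon><..<\<epsilon>})"
          if "t \<in> {-\<epsilon><..<\<epsilon>}" for t
          using u(2)[OF that] by (auto simp: has_vector_derivative_def intro: has_derivative_at_withinI)
        show "onorm (\<lambda>h. h *\<^sub>R H (u t)) \<le> B" for t
        proof (rule onorm_le)
          fix h :: real
          show "norm (h *\<^sub>R H (u t)) \<le> B * norm h"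
            using mult_right_mono[OF B(2)[OF \<pi>[of "u t"]], of "\<bar>h\<bar>"] by (simp add: H_def mult.commute)
        qed
      qed (use t \<epsilon> in auto)
      also have "\<dots> \<le> B * \<epsilon>" using t B(1) by (intro mult_left_mono) auto
      also have "\<dots> \<le> R / 2" using \<epsilon>(3) by (simp add: mult.commute)
      finally have "dist (u t) u1 \<le> R / 2" using u(1) by (simp add: dist_norm)
      then show ?thesis using u1 dist_triangle[of u0 "u t" u1]
        by (simp add: dist_commute)
    qed
    then show "\<exists>u. u 0 = u1 \<and> (\<forall>t\<in>{-\<epsilon><..<\<epsilon>}. u t \<in> V \<and> (u has_vector_derivative G (u t)) (at t))"
      using u R(2) by (intro exI[of _ u]) (auto simp: H_def \<pi>_def closest_point_self)
  qed (use \<epsilon> R in auto)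
qed

subsection \<open>Orthogonal projections and Gram determinants\<close>

definition orth_proj :: "'a::euclidean_space set \<Rightarrow> ('a \<Rightarrow> 'a) \<Rightarrow> bool" where
  "orth_proj S f \<longleftrightarrow> linear f \<and> (\<forall>x. f x \<in> S) \<and> (\<forall>x. \<forall>w\<in>S. (x - f x) \<bullet> w = 0)"

lemma orth_proj_linear: "orth_proj S f \<Longrightarrow> linear f"
  and orth_proj_in: "orth_proj S f \<Longrightarrow> f x \<in> S"
  and orth_proj_orth: "orth_proj S f \<Longrightarrow> w \<in> S \<Longrightarrow> (x - f x) \<bullet> w = 0"
  by (auto simp: orth_proj_def)

lemma orth_proj_inner: "orth_proj S f \<Longrightarrow> w \<in> S \<Longrightarrow> f x \<bullet> w = x \<bullet> w"
  using orth_proj_orth[of S f w x] by (simp add: inner_diff_left)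

lemma orth_proj_fix:
  assumes "orth_proj S f" "subspace S" "x \<in> S"
  shows "f x = x"
proof -
  have "x - f x \<in> S" using assms orth_proj_in subspace_diff by blast
  then have "(x - f x) \<bullet> (x - f x) = 0" using assms(1) orth_proj_orth by blast
  then show ?thesis by simp
qed

lemma orth_proj_symmetric:
  assumes "orth_proj S f"
  shows "f x \<bullet> y = x \<bullet> f y"
  by (metis assms inner_commute orth_proj_in orth_proj_inner)

lemma orth_proj_unique:
  assumes "orth_proj S f" "subspace S" "u \<in> S" "\<And>w. w \<in> S \<Longrightarrow> (x - u) \<bullet> w = 0"
  shows "f x = u"
proof -
  have d: "f x - u \<in> S" using assms orth_proj_in subspace_diff by blast
  then have "(f x - u) \<bullet> (f x - u) = 0"
    using assms(4)[OF d] orth_proj_orth[OF assms(1) d, of x] by (simp add: inner_diff_left)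
  then show ?thesis by simp
qed

lemma orth_proj_exists:
  fixes S :: "'a::euclidean_space set"
  assumes "subspace S"
  obtains f where "orth_proj S f"
proof -
  obtain B where B: "B \<subseteq> S" "pairwise orthogonal B" "\<And>x. x \<in> B \<Longrightarrow> norm x = 1"
    "independent B" "card B = dim S" "span B = S"
    using orthonormal_basis_subspace[OF assms] by blast
  have fin: "finite B" using B(4) independent_imp_finite by blast
  define f where "f x = (\<Sum>b\<in>B. (x \<bullet> b) *\<^sub>R b)" for x
  have "orth_proj S f"
    unfolding orth_proj_def
  proof (intro conjI allI ballI)
    show "linear f"
      unfolding f_def by (rule linearI)
        (simp_all add: inner_add_left scaleR_add_left sum.distrib scaleR_sum_right)
    show "f x \<in> S" for x
      unfolding f_def using B(1) assms by (auto intro!: subspace_sum subspace_scale)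
    fix x w assume "w \<in> S"
    then have "w \<in> span B" using B by simp
    then show "(x - f x) \<bullet> w = 0"
    proof (induction rule: span_induct_alt)
      case (step c b w)
      have "f x \<bullet> b = (\<Sum>a\<in>B. if a = b then x \<bullet> b else 0)"
        unfolding f_def inner_sum_left
        using step(1) B(2,3) by (intro sum.cong)
          (auto simp: pairwise_def orthogonal_def norm_eq_1)
      also have "\<dots> = x \<bullet> b" using step(1) fin by simp
      finally show ?case using step by (simp add: inner_diff_left inner_add_right)
    qed simp
  qed
  then show ?thesis using that by blast
qed

lemma orthonormal_basis_of_expand:
  assumes "orthonormal_basis_of S B" "orth_proj S f"
  shows "f x = (\<Sum>e\<in>B. (x \<bullet> e) *\<^sub>R e)"
proof -
  have B: "pairwise orthogonal B" "\<And>e. e \<in> B \<Longrightarrow> norm e = 1" "span B = S"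
    using assms(1) by (auto simp: orthonormal_basis_of_def)
  have fin: "finite B"
    using B(1,2) pairwise_orthogonal_imp_finite by blast
  have S: "subspace S" using B(3) subspace_span by metis
  show ?thesis
  proof (rule orth_proj_unique[OF assms(2) S])
    show "(\<Sum>e\<in>B. (x \<bullet> e) *\<^sub>R e) \<in> S"
      using B(3) by (auto intro!: span_sum span_scale intro: span_base)
    fix w assume "w \<in> S"
    then have "w \<in> span B" using B by simp
    then show "(x - (\<Sum>e\<in>B. (x \<bullet> e) *\<^sub>R e)) \<bullet> w = 0"
    proof (induction rule: span_induct_alt)
      case (step c b w)
      have "(\<Sum>e\<in>B. (x \<bullet> e) *\<^sub>R e) \<bullet> b = (\<Sum>a\<in>B. if a = b then x \<bullet> b else 0)"
        unfolding inner_sum_left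
        using step(1) B(1,2) by (intro sum.cong)
          (auto simp: pairwise_def orthogonal_def norm_eq_1)
      also have "\<dots> = x \<bullet> b" using step(1) fin by simp
      finally show ?case using step by (simp add: inner_diff_left inner_add_right)
    qed simp
  qed
qed

text \<open>Removes the chosen orthonormal basis from the mean curvature: a trace over S is a trace
  over the standard basis with the projection inserted in one slot, which can then be differentiated
  and compared between points.\<close>

lemma sum_orthonormal_basis:
  fixes \<beta> :: "'a::euclidean_space \<Rightarrow> 'a \<Rightarrow> 'b::real_vector"
  assumes "orthonormal_basis_of S B" "orth_proj S f"
    and "\<And>w. linear (\<lambda>v. \<beta> v w)" "\<And>v. linear (\<beta> v)"
  shows "(\<Sum>e\<in>B. \<beta> e e) = (\<Sum>b\<in>Basis. \<beta> (f b) b)"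
proof -
  have "(\<Sum>b\<in>Basis. \<beta> (f b) b) = (\<Sum>b\<in>Basis. \<Sum>e\<in>B. (b \<bullet> e) *\<^sub>R \<beta> e b)"
    by (simp add: orthonormal_basis_of_expand[OF assms(1,2)] linear_sum[OF assms(3)] linear_scale[OF assms(3)])
  also have "\<dots> = (\<Sum>e\<in>B. \<Sum>b\<in>Basis. (b \<bullet> e) *\<^sub>R \<beta> e b)"
    by (rule sum.swap)
  also have "\<dots> = (\<Sum>e\<in>B. \<beta> e e)"
  proof (rule sum.cong[OF refl])
    fix e
    have "(\<Sum>b\<in>Basis. (b \<bullet> e) *\<^sub>R \<beta> e b) = \<beta> e (\<Sum>b\<in>Basis. (e \<bullet> b) *\<^sub>R b)"
      using assms(4)[of e] by (simp add: linear_sum linear_scale inner_commute)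
    then show "(\<Sum>b\<in>Basis. (b \<bullet> e) *\<^sub>R \<beta> e b) = \<beta> e e"
      by (simp add: euclidean_representation)
  qed
  finally show ?thesis by simp
qed

section \<open>Derivatives of determinants and the Gram determinant\<close>

lemma det_has_derivative_at_identity:
  fixes X :: "real \<Rightarrow> real ^ 'n ^ 'n"
  assumes "\<And>i j. ((\<lambda>s. X s $ i $ j) has_real_derivative X' $ i $ j) (at t)" "X t = mat 1"
  shows "((\<lambda>s. det (X s)) has_real_derivative trace X') (at t)"
proof -
  let ?P = "{p. p permutes (UNIV :: 'n set)}"
  define d where "d p = (\<Sum>i\<in>UNIV. X' $ i $ p i * (\<Prod>j\<in>UNIV - {i}. (mat 1 :: real^'n^'n) $ j $ p j))" for p
  have D: "((\<lambda>s. \<Prod>i\<in>UNIV. X s $ i $ p i) has_real_derivative d p) (at t)" for p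
  proof -
    have "((\<lambda>s. \<Prod>i\<in>UNIV. X s $ i $ p i) has_derivative
      (\<lambda>y. \<Sum>i\<in>UNIV. X' $ i $ p i * y * (\<Prod>j\<in>UNIV - {i}. X t $ j $ p j))) (at t)"
      using assms(1) by (intro has_derivative_prod) (simp add: has_field_derivative_def)
    moreover have "(\<lambda>y. \<Sum>i\<in>UNIV. X' $ i $ p i * y * (\<Prod>j\<in>UNIV - {i}. X t $ j $ p j)) = (*) (d p)"
      by (rule ext) (simp add: d_def assms(2) sum_distrib_left sum_distrib_right mult_ac)
    ultimately show ?thesis by (simp add: has_field_derivative_def)
  qed
  have "((\<lambda>s. det (X s)) has_real_derivative (\<Sum>p\<in>?P. of_int (sign p) * d p)) (at t)"
    unfolding det_def by (intro DERIV_sum DERIV_cmult D)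
  moreover have "d p = 0" if "p permutes UNIV" "p \<noteq> id" for p
    unfolding d_def
  proof (intro sum.neutral ballI)
    fix i
    \<comment> \<open>A permutation other than the identity moves at least two indices. Whichever
      factor is differentiated, an off-diagonal entry of the identity matrix, that is 0,
      remains.\<close>
    have "\<exists>j. j \<noteq> i \<and> p j \<noteq> j"
    proof (rule ccontr)
      assume "\<not> ?thesis"
      then have *: "p j = j" if "j \<noteq> i" for j using that by blast
      then have "p i = i" using permutes_inj[OF that(1)] by (metis injD)
      with * have "p = id" by (metis eq_id_iff)
      with that show False by blast
    qed
    then obtain j where "j \<noteq> i" "p j \<noteq> j" by blast
    then have "(\<Prod>j\<in>UNIV - {i}. (mat 1 :: real^'n^'n) $ j $ p j) = 0"
      by (intro prod_zero bexI[of _ j]) (auto simp: mat_def)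
    then show "X' $ i $ p i * (\<Prod>j\<in>UNIV - {i}. (mat 1 :: real^'n^'n) $ j $ p j) = 0" by simp
  qed
  moreover have "d id = trace X'"
    by (simp add: d_def mat_def trace_def)
  moreover have "(\<Sum>p\<in>?P. of_int (sign p) * d p) = of_int (sign (id :: 'n \<Rightarrow> 'n)) * d id + (\<Sum>p\<in>?P - {id}. of_int (sign p) * d p)"
    by (rule sum.remove[of ?P id "\<lambda>p. of_int (sign p) * d p"]) (auto simp: permutes_id)
  ultimately show ?thesis by simp
qed

lemma matrix_inv_inverse:
  fixes A :: "real ^ 'n ^ 'n"
  assumes "invertible A"
  shows "A ** matrix_inv A = mat 1" "matrix_inv A ** A = mat 1"
  using someI_ex[OF assms[unfolded invertible_def]] by (auto simp: matrix_inv_def)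

text \<open>Jacobi's formula, reduced to the derivative at the identity by multiplying with the
  fixed inverse of \<open>G t\<close>.\<close>

lemma det_has_derivative:
  fixes G :: "real \<Rightarrow> real ^ 'n ^ 'n"
  assumes "\<And>i j. ((\<lambda>s. G s $ i $ j) has_real_derivative G' $ i $ j) (at t)" "invertible (G t)"
  shows "((\<lambda>s. det (G s)) has_real_derivative det (G t) * trace (matrix_inv (G t) ** G')) (at t)"
proof -
  have "((\<lambda>s. det (matrix_inv (G t) ** G s)) has_real_derivative trace (matrix_inv (G t) ** G')) (at t)"
  proof (rule det_has_derivative_at_identity)
    show "((\<lambda>s. (matrix_inv (G t) ** G s) $ i $ j) has_real_derivative (matrix_inv (G t) ** G') $ i $ j) (at t)"
      for i j
      unfolding matrix_matrix_mult_def vec_lambda_beta by (intro DERIV_sum DERIV_cmult assms)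
    show "matrix_inv (G t) ** G t = mat 1" using assms(2) by (simp add: matrix_inv_inverse)
  qed
  from DERIV_cmult[OF this, of "det (G t)"] show ?thesis
    using assms(2) by (simp add: flip: det_mul add: matrix_mul_assoc matrix_inv_inverse)
qed

lemma inner_transpose_vector_mult:
  fixes A :: "real ^ 'n ^ 'm"
  shows "x \<bullet> (transpose A *v y) = (A *v x) \<bullet> y"
  by (metis dot_lmul_matrix inner_commute transpose_transpose vector_transpose_matrix)

lemma isCont_det:
  fixes A :: "real \<Rightarrow> real ^ 'n ^ 'n"
  assumes "\<And>i j. isCont (\<lambda>s. A s $ i $ j) t"
  shows "isCont (\<lambda>s. det (A s)) t"
  unfolding det_def by (intro continuous_intros assms)

text \<open>Since the columns of \<open>E\<close> are the derivative of a moving frame, \<open>G t\<close> is its Gram matrix. The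
  hypothesis makes \<open>det (G t)\<close>, a polynomial in \<open>t\<close>, constant; its behaviour as \<open>t \<rightarrow> \<infinity>\<close>
  then shows that \<open>E\<close> has rank zero. With the substitution \<open>t = 1/s\<close> and with \<open>Q\<close> the orthogonal
  projection onto the orthogonal complement of the kernel of \<open>E\<close>, the limit becomes a value at
  \<open>s = 0\<close>: \<open>G (1/s) ((1 - Q) + s^2 Q)\<close> extends to an invertible matrix at \<open>s = 0\<close>, while
  \<open>1 - Q\<close> is invertible only if \<open>Q = 0\<close>.\<close>

lemma gram_trace_zero_imp_zero:
  fixes E R :: "real ^ 'n ^ 'n"
  assumes sym: "transpose R = R" "transpose (R ** E) = R ** E" and "\<epsilon> > 0"
  defines "G \<equiv> \<lambda>t. mat 1 + (2 * t) *\<^sub>R (R ** E) + t\<^sup>2 *\<^sub>R (transpose E ** E)"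
  assumes inv: "\<And>t. \<bar>t\<bar> < \<epsilon> \<Longrightarrow> invertible (G t)"
    and tr: "\<And>t. \<bar>t\<bar> < \<epsilon> \<Longrightarrow> trace (matrix_inv (G t) ** (transpose (R + t *\<^sub>R E) ** E)) = 0"
  shows "E = 0"
proof -
  define B C where "B = R ** E" and "C = transpose E ** E"
  have G: "G t = mat 1 + (2 * t) *\<^sub>R B + t\<^sup>2 *\<^sub>R C" for t
    by (simp add: G_def B_def C_def)
  have "DERIV (\<lambda>s. det (G s)) t :> 0" if "\<bar>t\<bar> < \<epsilon>" for t
  proof -
    have "((\<lambda>s. G s $ i $ j) has_real_derivative (2 *\<^sub>R (B + t *\<^sub>R C)) $ i $ j) (at t)" for i j
      unfolding G by (auto intro!: derivative_eq_intros simp: algebra_simps)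
    from det_has_derivative[OF this inv[OF that]]
    have D: "DERIV (\<lambda>s. det (G s)) t :> det (G t) * trace (matrix_inv (G t) ** (2 *\<^sub>R (B + t *\<^sub>R C)))" .
    have "transpose (R + t *\<^sub>R E) ** E = B + t *\<^sub>R C"
      unfolding B_def C_def using sym(1)
      by (simp add: vec_eq_iff matrix_matrix_mult_def transpose_def sum.distrib sum_distrib_left
          algebra_simps)
    then have "trace (matrix_inv (G t) ** (B + t *\<^sub>R C)) = 0" using tr[OF that] by simp
    moreover have "trace (A ** (2 *\<^sub>R Z)) = 2 * trace (A ** Z)" for A Z :: "real ^ 'n ^ 'n"
      by (simp add: trace_def matrix_matrix_mult_def sum_distrib_left mult.left_commute)
    ultimately have "trace (matrix_inv (G t) ** (2 *\<^sub>R (B + t *\<^sub>R C))) = 0" by simp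
    then show ?thesis using D by simp
  qed
  then have const: "det (G t) = 1" if "t \<in> {-\<epsilon><..<\<epsilon>}" for t
  proof -
    have "\<exists>c. \<forall>t\<in>{-\<epsilon><..<\<epsilon>}. det (G t) = c"
      using \<open>\<And>t. \<bar>t\<bar> < \<epsilon> \<Longrightarrow> DERIV (\<lambda>s. det (G s)) t :> 0\<close>
      by (intro has_field_derivative_zero_constant) (auto intro: has_field_derivative_at_within)
    then obtain c where c: "\<And>t. t \<in> {-\<epsilon><..<\<epsilon>} \<Longrightarrow> det (G t) = c" by blast
    have "det (G 0) = 1" by (simp add: G)
    then show ?thesis using c[of 0] c[OF that] \<open>\<epsilon> > 0\<close> by simp
  qed
  \<comment> \<open>The Leibniz formula with each entry of \<open>G t\<close> as a polynomial of
    degree at most 2. A polynomial that equals 1 on an interval is 1, so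
    \<open>det (G t) = 1\<close> also holds for the large \<open>t\<close> needed below.\<close>
  define p where "p = (\<Sum>\<sigma>\<in>{\<sigma>. \<sigma> permutes (UNIV :: 'n set)}. smult (of_int (sign \<sigma>))
    (\<Prod>i\<in>UNIV. [:(mat 1 :: real^'n^'n) $ i $ \<sigma> i, 2 * B $ i $ \<sigma> i, C $ i $ \<sigma> i:]))"
  have p: "poly p t = det (G t)" for t
    unfolding p_def det_def G by (simp add: poly_sum poly_prod algebra_simps power2_eq_square)
  have "p - 1 = 0"
  proof (rule ccontr)
    assume "p - 1 \<noteq> 0"
    then have "finite {t. poly (p - 1) t = 0}" by (rule poly_roots_finite)
    moreover have "{-\<epsilon><..<\<epsilon>} \<subseteq> {t. poly (p - 1) t = 0}" using p const by auto
    ultimately have "finite {-\<epsilon><..<\<epsilon>}" by (rule finite_subset[rotated])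
    then show False using \<open>\<epsilon> > 0\<close> infinite_Ioo[of "-\<epsilon>" \<epsilon>] by simp
  qed
  then have det1: "det (G t) = 1" for t using p[of t] by simp
  \<comment> \<open>The range of the transpose is the orthogonal complement of the kernel of
    \<open>E\<close>.\<close>
  have S: "subspace (range (\<lambda>x. transpose E *v x))"
    using linear_subspace_image[OF matrix_vector_mul_linear[of "transpose E"] subspace_UNIV] .
  then obtain q where q: "orth_proj (range (\<lambda>x. transpose E *v x)) q"
    using orth_proj_exists by blast
  define Q where "Q = matrix q"
  have Q: "Q *v x = q x" for x
    unfolding Q_def using q by (simp add: matrix_works linear_matrix_vector_mul_eq orth_proj_linear)
  have kerQ: "q w = 0" if "E *v w = 0" for w
  proof -
    obtain z where z: "q w = transpose E *v z" using orth_proj_in[OF q] by blast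
    have "q w \<bullet> q w = w \<bullet> q w" by (rule orth_proj_inner[OF q orth_proj_in[OF q]])
    also have "\<dots> = 0" unfolding z inner_transpose_vector_mult that by simp
    finally show ?thesis by simp
  qed
  have EQ: "E *v q x = E *v x" for x
  proof -
    have "(E *v (x - q x)) \<bullet> (E *v (x - q x)) = (x - q x) \<bullet> (transpose E *v (E *v (x - q x)))"
      by (simp only: inner_transpose_vector_mult)
    also have "\<dots> = 0" by (rule orth_proj_orth[OF q]) blast
    finally show ?thesis by (simp add: matrix_vector_mult_diff_distrib)
  qed
  have BQ: "B *v q x = B *v x" "C *v q x = C *v x" for x
    by (simp_all add: B_def C_def EQ flip: matrix_vector_mul_assoc)
  \<comment> \<open>\<open>D s\<close> cancels the growth of order 1/s^2 that
    \<open>G (1 / s)\<close> has off the kernel of \<open>E\<close>. As \<open>B\<close> and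
    \<open>C\<close> are unchanged by composition with \<open>Q\<close> on the right, all negative
    powers of \<open>s\<close> drop out of the product, leaving \<open>H s\<close>.\<close>
  define D H where "D s = (mat 1 - Q) + s\<^sup>2 *\<^sub>R Q" and "H s = (mat 1 - Q) + s\<^sup>2 *\<^sub>R Q + (2 * s) *\<^sub>R B + C"
    for s :: real
  have "G (1 / s) ** D s = H s" if "s \<noteq> 0" for s
  proof (subst matrix_eq, rule allI)
    fix x
    have [simp]: "q (q x) = q x" for x by (rule orth_proj_fix[OF q S orth_proj_in[OF q]])
    show "(G (1 / s) ** D s) *v x = H s *v x"
      using that
      by (simp add: scaleR_add_right G D_def H_def Q BQ matrix_vector_mult_add_rdistrib matrix_vector_mult_diff_rdistrib
          matrix_vector_right_distrib matrix_vector_mult_diff_distrib scaleR_matrix_vector_assoc[symmetric]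
          matrix_vector_mult_scaleR power2_eq_square flip: matrix_vector_mul_assoc)
  qed
  then have HD: "det (H s) = det (D s)" if "s \<noteq> 0" for s
    using that det1[of "1 / s"] det_mul[of "G (1 / s)" "D s"] by simp
  \<comment> \<open>Continuity carries the equality of the determinants to \<open>s = 0\<close>,
    where \<open>G (1 / s)\<close> has no meaning.\<close>
  have "isCont (\<lambda>s. det (H s) - det (D s)) 0"
    unfolding H_def D_def by (intro continuous_intros isCont_det; simp)
  then have "(\<lambda>s. det (H s) - det (D s)) \<midarrow>0\<rightarrow> det (H 0) - det (D 0)" by (simp add: isCont_def)
  moreover have "(\<lambda>s. det (H s) - det (D s)) \<midarrow>0\<rightarrow> 0"
    by (rule tendsto_eventually) (use HD in \<open>auto simp: eventually_at_filter\<close>)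
  ultimately have HD0: "det (H 0) = det (D 0)" using LIM_unique by fastforce
  have inj: "inj ((*v) A) \<longleftrightarrow> det A \<noteq> 0" for A :: "real ^ 'n ^ 'n"
    using matrix_left_invertible_injective[of A] invertible_left_inverse[of A]
      invertible_det_nz[of A] by blast
  have "x = 0" if "H 0 *v x = 0" for x
  proof -
    have "x - q x + transpose E *v (E *v x) = 0"
      using that by (simp add: H_def Q C_def matrix_vector_mult_add_rdistrib
          matrix_vector_mult_diff_rdistrib matrix_vector_mul_assoc)
    \<comment> \<open>Pairing with \<open>x\<close> gives a sum of two squares, of
      \<open>x - q x\<close> and of \<open>E *v x\<close>.\<close>
    then have "x \<bullet> (x - q x) + x \<bullet> (transpose E *v (E *v x)) = 0"
      by (metis inner_add_right inner_zero_right)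
    moreover have "x \<bullet> (x - q x) = (x - q x) \<bullet> (x - q x)"
      using orth_proj_orth[OF q orth_proj_in[OF q], of x x]
      by (simp add: inner_diff_left inner_diff_right inner_commute)
    ultimately have "(x - q x) \<bullet> (x - q x) + (E *v x) \<bullet> (E *v x) = 0" by (simp only: inner_transpose_vector_mult)
    then have "(x - q x) \<bullet> (x - q x) = 0" "(E *v x) \<bullet> (E *v x) = 0"
      using inner_ge_zero[of "x - q x"] inner_ge_zero[of "E *v x"] by linarith+
    then show ?thesis using kerQ[of x] by simp
  qed
  then have "inj ((*v) (H 0))"
    by (subst linear_injective_0) auto
  then have "det (mat 1 - Q) \<noteq> 0" using inj HD0 by (simp add: D_def)
  then have injQ: "inj ((*v) (mat 1 - Q))" using inj by blast
  have "E *v x = 0" for x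
  proof -
    \<comment> \<open>\<open>1 - Q\<close> annihilates every \<open>q x\<close>, and it is
      injective.\<close>
    have "(mat 1 - Q) *v q x = (mat 1 - Q) *v 0"
      using orth_proj_fix[OF q S orth_proj_in[OF q]]
      by (simp add: matrix_vector_mult_diff_rdistrib Q)
    then have "q x = 0" using injQ by (simp add: inj_def)
    then show ?thesis using EQ[of x] by simp
  qed
  then show ?thesis by (subst matrix_eq) simp
qed

subsection \<open>Submanifolds\<close>

lemma has_vector_derivative_compose:
  assumes "(\<gamma> has_vector_derivative v) (at t)" "(g has_derivative g') (at (\<gamma> t))"
  shows "((\<lambda>t. g (\<gamma> t)) has_vector_derivative g' v) (at t)"
proof -
  have "((\<lambda>t. g (\<gamma> t)) has_derivative (\<lambda>h. g' (h *\<^sub>R v))) (at t)"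
    using has_derivative_compose[OF assms(1)[unfolded has_vector_derivative_def] assms(2)] .
  moreover have "(\<lambda>h. g' (h *\<^sub>R v)) = (\<lambda>h. h *\<^sub>R g' v)"
    using has_derivative_linear[OF assms(2)] by (simp add: linear_scale)
  ultimately show ?thesis unfolding has_vector_derivative_def by simp
qed

lemma curve_stays_in_open:
  fixes \<gamma> :: "real \<Rightarrow> 'a::topological_space"
  assumes "continuous_on {-\<epsilon><..<\<epsilon>} \<gamma>" "\<epsilon> > 0" "open U" "\<gamma> 0 \<in> U"
  obtains \<delta> where "0 < \<delta>" "\<delta> \<le> \<epsilon>" "\<gamma> ` {-\<delta><..<\<delta>} \<subseteq> U"
proof -
  have "open ({-\<epsilon><..<\<epsilon>} \<inter> \<gamma> -` U)"
    by (rule continuous_open_preimage) (use assms in auto)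
  moreover have "0 \<in> {-\<epsilon><..<\<epsilon>} \<inter> \<gamma> -` U" using assms by auto
  ultimately obtain e where e: "e > 0" "ball 0 e \<subseteq> {-\<epsilon><..<\<epsilon>} \<inter> \<gamma> -` U"
    using openE by blast
  show ?thesis
  proof (rule that[of "min e \<epsilon>"])
    have "t \<in> ball 0 e" if "t \<in> {- min e \<epsilon><..<min e \<epsilon>}" for t :: real
      using that by (auto simp: dist_real_def)
    then show "\<gamma> ` {- min e \<epsilon><..<min e \<epsilon>} \<subseteq> U" using e(2) by blast
  qed (use e assms in auto)
qed

text \<open>A curve need only lie in M while it stays in \<open>U\<close>; shrinking its interval
  does the rest.\<close>

lemma tangent_spaceI:
  fixes \<gamma> :: "real \<Rightarrow> 'a::euclidean_space"
  assumes "smooth_on {-\<epsilon><..<\<epsilon>} \<gamma>" "\<epsilon> > 0" "open U" "\<gamma> 0 \<in> U"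
    and "\<And>t. t \<in> {-\<epsilon><..<\<epsilon>} \<Longrightarrow> \<gamma> t \<in> U \<Longrightarrow> \<gamma> t \<in> M"
    and "\<gamma> 0 = p" "(\<gamma> has_vector_derivative v) (at 0)"
  shows "v \<in> tangent_space M p"
proof -
  obtain \<delta> where \<delta>: "0 < \<delta>" "\<delta> \<le> \<epsilon>" "\<gamma> ` {-\<delta><..<\<delta>} \<subseteq> U"
    using curve_stays_in_open[OF smooth_on_imp_continuous_on[OF assms(1)] assms(2-4)] .
  have "\<gamma> ` {-\<delta><..<\<delta>} \<subseteq> M"
    using \<delta> assms(5) by fastforce
  moreover have "smooth_on {-\<delta><..<\<delta>} \<gamma>"
    by (rule smooth_on_subset[OF assms(1)]) (use \<delta> in auto)
  ultimately show ?thesis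
    unfolding tangent_space_def using \<delta>(1) assms(6,7) by blast
qed

lemma tangent_spaceE:
  assumes "v \<in> tangent_space M p" "open U" "p \<in> U"
  obtains \<epsilon> \<gamma> where "\<epsilon> > 0" "smooth_on {-\<epsilon><..<\<epsilon>} \<gamma>"
    "\<And>t. t \<in> {-\<epsilon><..<\<epsilon>} \<Longrightarrow> \<gamma> t \<in> M \<inter> U" "\<gamma> 0 = p" "(\<gamma> has_vector_derivative v) (at 0)"
proof -
  obtain \<epsilon> \<gamma> where \<gamma>: "\<epsilon> > 0" "smooth_on {-\<epsilon><..<\<epsilon>} \<gamma>" "\<gamma> ` {-\<epsilon><..<\<epsilon>} \<subseteq> M" "\<gamma> 0 = p"
    "(\<gamma> has_vector_derivative v) (at 0)"
    using assms(1) unfolding tangent_space_def by blast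
  obtain \<delta> where \<delta>: "0 < \<delta>" "\<delta> \<le> \<epsilon>" "\<gamma> ` {-\<delta><..<\<delta>} \<subseteq> U"
    using curve_stays_in_open[OF smooth_on_imp_continuous_on[OF \<gamma>(2)] \<gamma>(1) assms(2)] \<gamma>(4) assms(3)
    by blast
  show ?thesis
  proof (rule that[OF \<delta>(1) _ _ \<gamma>(4,5)])
    show "smooth_on {-\<delta><..<\<delta>} \<gamma>"
      by (rule smooth_on_subset[OF \<gamma>(2)]) (use \<delta> in auto)
    have "{-\<delta><..<\<delta>} \<subseteq> {-\<epsilon><..<\<epsilon>}" using \<delta> by auto
    then show "\<gamma> t \<in> M \<inter> U" if "t \<in> {-\<delta><..<\<delta>}" for t
      using that \<delta>(3) \<gamma>(3) by blast
  qed
qed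

text \<open>Both maps have the same values along a curve in M with velocity \<open>v\<close>.
  Identities that hold only on M are differentiated in tangent directions by this rule
  throughout.\<close>

lemma tangent_derivative_cong:
  assumes "v \<in> tangent_space M p" "open U" "p \<in> U"
    and "(f has_derivative f') (at p)" "(g has_derivative g') (at p)"
    and "\<And>q. q \<in> M \<Longrightarrow> q \<in> U \<Longrightarrow> f q = g q"
  shows "f' v = g' v"
proof -
  obtain \<epsilon> \<gamma> where \<gamma>: "\<epsilon> > 0" "smooth_on {-\<epsilon><..<\<epsilon>} \<gamma>"
    "\<And>t. t \<in> {-\<epsilon><..<\<epsilon>} \<Longrightarrow> \<gamma> t \<in> M \<inter> U" "\<gamma> 0 = p" "(\<gamma> has_vector_derivative v) (at 0)"
    using tangent_spaceE[OF assms(1-3)] by blast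
  have "((\<lambda>t. f (\<gamma> t)) has_vector_derivative f' v) (at 0)"
    "((\<lambda>t. g (\<gamma> t)) has_vector_derivative g' v) (at 0)"
    using \<gamma>(4,5) assms(4,5) by (auto intro: has_vector_derivative_compose)
  moreover have "((\<lambda>t. g (\<gamma> t)) has_vector_derivative f' v) (at 0)"
    by (rule has_vector_derivative_transform_within_open[OF calculation(1), of "{-\<epsilon><..<\<epsilon>}"])
      (use \<gamma>(1,3) assms(6) in auto)
  ultimately show ?thesis using vector_derivative_unique_at by blast
qed

lemma vector_derivative_in_subspace:
  fixes c :: "real \<Rightarrow> 'a::euclidean_space"
  assumes "subspace S" "(c has_vector_derivative v) (at 0)" "\<delta> > 0"
    "\<And>t. t \<in> {-\<delta><..<\<delta>} \<Longrightarrow> c t \<in> S"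
  shows "v \<in> S"
proof -
  obtain f where f: "orth_proj S f" using orth_proj_exists[OF assms(1)] by blast
  have "((\<lambda>t. f (c t)) has_vector_derivative f v) (at 0)"
    using has_vector_derivative_compose[OF assms(2) linear_imp_has_derivative[OF orth_proj_linear[OF f]]] .
  moreover have "((\<lambda>t. f (c t)) has_vector_derivative v) (at 0)"
    by (rule has_vector_derivative_transform_within_open[OF assms(2), of "{-\<delta><..<\<delta>}"])
      (use assms f in \<open>auto simp: orth_proj_fix\<close>)
  ultimately have "f v = v" using vector_derivative_unique_at by blast
  then show ?thesis using orth_proj_in[OF f, of v] by simp
qed

text \<open>Smoothness of \<open>P\<close> is known only with its second argument fixed, so
  \<open>f q\<close> is expanded in the basis.\<close>

lemma smooth_on_linear_apply:
  fixes P :: "'a::real_normed_vector \<Rightarrow> 'b::euclidean_space \<Rightarrow> 'c::real_normed_vector"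
  assumes "open U" "\<And>q. q \<in> U \<Longrightarrow> linear (P q)" "\<And>x. smooth_on U (\<lambda>q. P q x)" "smooth_on U f"
  shows "smooth_on U (\<lambda>q. P q (f q))"
proof -
  have "smooth_on U (\<lambda>q. \<Sum>b\<in>Basis. (f q \<bullet> b) *\<^sub>R P q b)"
    by (intro smooth_on_sum smooth_on_scaleR smooth_on_inner smooth_on_const assms)
  then show ?thesis
    by (rule smooth_on_cong[OF assms(1), rotated]) (rule linear_sum_Basis[OF assms(2), symmetric])
qed

text \<open>Gram-Schmidt: the projector is built up one basis vector at a time.\<close>

lemma smooth_orth_proj:
  fixes L :: "'a::euclidean_space \<Rightarrow> 'a \<Rightarrow> 'a"
  assumes "open U" "\<And>q. q \<in> U \<Longrightarrow> linear (L q)" "\<And>q. q \<in> U \<Longrightarrow> inj (L q)"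
    "\<And>x. smooth_on U (\<lambda>q. L q x)" and "independent B"
  shows "\<exists>P. (\<forall>x. smooth_on U (\<lambda>q. P q x)) \<and> (\<forall>q\<in>U. orth_proj (L q ` span B) (P q))"
  using independent_imp_finite[OF assms(5)] assms(5)
proof (induction B rule: finite_induct)
  case empty
  show ?case
    by (rule exI[of _ "\<lambda>q x. 0"])
      (use assms(1,2) in \<open>auto simp: orth_proj_def linear_0 smooth_on_const module_hom_zero\<close>)
next
  case (insert b B)
  have ind: "independent B" "b \<notin> span B"
    using insert.prems insert.hyps by (auto simp: independent_insert)
  then obtain P where P: "\<And>x. smooth_on U (\<lambda>q. P q x)"
    "\<And>q. q \<in> U \<Longrightarrow> orth_proj (L q ` span B) (P q)"
    using insert.IH by blast
  \<comment> \<open>The part of the new vector orthogonal to the span so far; \<open>P'\<close> adds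
    the projection onto its line. It never vanishes because \<open>L q\<close> is injective and
    \<open>b\<close> is independent of \<open>B\<close>.\<close>
  define w where "w q = L q b - P q (L q b)" for q
  define P' where "P' q x = P q x + ((w q \<bullet> x) / (w q \<bullet> w q)) *\<^sub>R w q" for q x
  have w0: "w q \<noteq> 0" if "q \<in> U" for q
  proof
    assume "w q = 0"
    then have "L q b \<in> L q ` span B"
      using orth_proj_in[OF P(2)[OF that], of "L q b"] by (simp add: w_def)
    then show False using assms(3)[OF that] ind(2) by (auto dest: injD)
  qed
  have sw: "smooth_on U w"
    unfolding w_def
    using smooth_on_linear_apply[OF assms(1) orth_proj_linear[OF P(2)] P(1) assms(4)]
    by (intro smooth_on_diff assms(1,4))
  have "smooth_on U (\<lambda>q. P' q x)" for x
    unfolding P'_def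
    by (intro smooth_on_add smooth_on_scaleR smooth_on_divide smooth_on_inner smooth_on_const assms P sw)
      (simp add: w0)
  moreover have "orth_proj (L q ` span (insert b B)) (P' q)" if q: "q \<in> U" for q
    unfolding orth_proj_def
  proof (intro conjI allI ballI)
    note Pq = P(2)[OF q]
    have linL: "linear (L q)" using assms(2)[OF q] .
    have sub: "subspace (L q ` span (insert b B))"
      by (rule linear_subspace_image[OF linL subspace_span])
    have BS: "L q ` span B \<subseteq> L q ` span (insert b B)"
      by (intro image_mono span_mono) auto
    have "L q b \<in> L q ` span (insert b B)" by (intro imageI span_base) auto
    then have w: "w q \<in> L q ` span (insert b B)"
      unfolding w_def using sub orth_proj_in[OF Pq] BS by (intro subspace_diff) auto
    show "linear (P' q)"
      unfolding P'_def using orth_proj_linear[OF Pq]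
      by (intro linearI) (simp_all add: linear_add linear_scale inner_add_right add_divide_distrib
          scaleR_add_left scaleR_add_right)
    show "P' q x \<in> L q ` span (insert b B)" for x
      unfolding P'_def using sub w orth_proj_in[OF Pq] BS
      by (intro subspace_add subspace_scale) auto
    fix x y assume "y \<in> L q ` span (insert b B)"
    then obtain z where z: "z \<in> span (insert b B)" "y = L q z" by blast
    then obtain k where k: "z - k *\<^sub>R b \<in> span B" using span_breakdown_eq by blast
    define s where "s = L q (z - k *\<^sub>R b)"
    have s: "s \<in> L q ` span B" using k by (simp add: s_def)
    have y: "y = s + k *\<^sub>R P q (L q b) + k *\<^sub>R w q"
      using z linL by (simp add: s_def w_def linear_diff linear_scale scaleR_diff_right)
    have wS: "w q \<bullet> s = 0" if "s \<in> L q ` span B" for s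
      unfolding w_def by (rule orth_proj_orth[OF Pq that])
    have S: "(x - P' q x) \<bullet> s = 0" if "s \<in> L q ` span B" for s
      using orth_proj_orth[OF Pq that, of x] wS[OF that]
      by (simp add: P'_def inner_diff_left inner_add_left)
    have "(x - P' q x) \<bullet> w q = 0"
      using wS[OF orth_proj_in[OF Pq], of x] w0[OF q]
      by (simp add: P'_def inner_diff_left inner_add_left inner_diff_right inner_add_right inner_commute)
    then show "(x - P' q x) \<bullet> y = 0"
      unfolding y inner_add_right inner_scaleR_right using S[OF s] S[OF orth_proj_in[OF Pq]] by simp
  qed
  ultimately show ?case by blast
qed

section \<open>Slice charts and tangent spaces\<close>

locale slice_chart =
  fixes m :: nat and M U V S :: "'a::euclidean_space set" and \<Phi> \<Psi> :: "'a \<Rightarrow> 'a"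
  assumes open_U: "open U" and open_V: "open V" and hom: "homeomorphism U V \<Phi> \<Psi>"
    and smooth_\<Phi>: "smooth_on U \<Phi>" and smooth_\<Psi>: "smooth_on V \<Psi>"
    and subspace_S: "subspace S" and dim_S: "dim S = m" and slice: "\<Phi> ` (M \<inter> U) = V \<inter> S"
begin

lemma \<Phi>_in: "x \<in> U \<Longrightarrow> \<Phi> x \<in> V" and \<Psi>_in: "u \<in> V \<Longrightarrow> \<Psi> u \<in> U"
  and \<Psi>_\<Phi>: "x \<in> U \<Longrightarrow> \<Psi> (\<Phi> x) = x" and \<Phi>_\<Psi>: "u \<in> V \<Longrightarrow> \<Phi> (\<Psi> u) = u"
  using hom by (auto simp: homeomorphism_def)

lemma in_M_iff: "x \<in> U \<Longrightarrow> x \<in> M \<longleftrightarrow> \<Phi> x \<in> S"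
proof
  assume x: "x \<in> U" "\<Phi> x \<in> S"
  then have "\<Phi> x \<in> \<Phi> ` (M \<inter> U)" using slice \<Phi>_in by blast
  then show "x \<in> M" using x \<Psi>_\<Phi> by (metis IntD1 IntD2 imageE)
qed (use slice in blast)

abbreviation "d\<Phi> x \<equiv> frechet_derivative \<Phi> (at x)"
abbreviation "d\<Psi> u \<equiv> frechet_derivative \<Psi> (at u)"

lemma \<Phi>_derivative: "x \<in> U \<Longrightarrow> (\<Phi> has_derivative d\<Phi> x) (at x)"
  and \<Psi>_derivative: "u \<in> V \<Longrightarrow> (\<Psi> has_derivative d\<Psi> u) (at u)"
  using smooth_\<Phi> smooth_\<Psi> smooth_on_has_derivative by blast+

lemma d\<Psi>_d\<Phi>: "x \<in> U \<Longrightarrow> d\<Psi> (\<Phi> x) (d\<Phi> x v) = v"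
proof -
  assume x: "x \<in> U"
  have "((\<lambda>y. \<Psi> (\<Phi> y)) has_derivative (\<lambda>v. d\<Psi> (\<Phi> x) (d\<Phi> x v))) (at x)"
    using has_derivative_compose[OF \<Phi>_derivative[OF x] \<Psi>_derivative[OF \<Phi>_in[OF x]]] .
  moreover have "((\<lambda>y. \<Psi> (\<Phi> y)) has_derivative (\<lambda>v. v)) (at x)"
    by (rule has_derivative_transform_within_open[OF has_derivative_ident open_U x]) (simp add: \<Psi>_\<Phi>)
  ultimately show ?thesis using has_derivative_unique by metis
qed

lemma d\<Phi>_d\<Psi>: "u \<in> V \<Longrightarrow> d\<Phi> (\<Psi> u) (d\<Psi> u v) = v"
proof -
  assume u: "u \<in> V"
  have "((\<lambda>y. \<Phi> (\<Psi> y)) has_derivative (\<lambda>v. d\<Phi> (\<Psi> u) (d\<Psi> u v))) (at u)"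
    using has_derivative_compose[OF \<Psi>_derivative[OF u] \<Phi>_derivative[OF \<Psi>_in[OF u]]] .
  moreover have "((\<lambda>y. \<Phi> (\<Psi> y)) has_derivative (\<lambda>v. v)) (at u)"
    by (rule has_derivative_transform_within_open[OF has_derivative_ident open_V u]) (simp add: \<Phi>_\<Psi>)
  ultimately show ?thesis using has_derivative_unique by metis
qed

lemma linear_d\<Psi>: "u \<in> V \<Longrightarrow> linear (d\<Psi> u)"
  using \<Psi>_derivative has_derivative_linear by blast

lemma inj_d\<Psi>: "u \<in> V \<Longrightarrow> inj (d\<Psi> u)"
  by (metis d\<Phi>_d\<Psi> injI)

text \<open>The chart carries curves in M to curves in the linear space S, whose velocities lie in
  S. Conversely, each vector of S is the velocity of a straight line in S, and this line is pulled
  back to M.\<close>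

lemma tangent_space_eq:
  assumes q: "q \<in> M" "q \<in> U"
  shows "tangent_space M q = d\<Psi> (\<Phi> q) ` S"
proof
  show "tangent_space M q \<subseteq> d\<Psi> (\<Phi> q) ` S"
  proof
    fix v assume v: "v \<in> tangent_space M q"
    obtain \<epsilon> \<gamma> where \<gamma>: "\<epsilon> > 0" "smooth_on {-\<epsilon><..<\<epsilon>} \<gamma>"
      "\<And>t. t \<in> {-\<epsilon><..<\<epsilon>} \<Longrightarrow> \<gamma> t \<in> M \<inter> U" "\<gamma> 0 = q" "(\<gamma> has_vector_derivative v) (at 0)"
      using tangent_spaceE[OF v open_U q(2)] by blast
    have "((\<lambda>t. \<Phi> (\<gamma> t)) has_vector_derivative d\<Phi> q v) (at 0)"
      using has_vector_derivative_compose[OF \<gamma>(5)] \<Phi>_derivative[OF q(2)] \<gamma>(4) by simp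
    then have "d\<Phi> q v \<in> S"
      by (rule vector_derivative_in_subspace[OF subspace_S _ \<gamma>(1)]) (use \<gamma>(3) in_M_iff in blast)
    then show "v \<in> d\<Psi> (\<Phi> q) ` S" using d\<Psi>_d\<Phi>[OF q(2), of v] by force
  qed
  show "d\<Psi> (\<Phi> q) ` S \<subseteq> tangent_space M q"
  proof (intro image_subsetI)
    fix s assume s: "s \<in> S"
    have cont: "continuous_on {-1<..<1} (\<lambda>t. \<Phi> q + t *\<^sub>R s)" by (intro continuous_intros)
    obtain \<delta> :: real where \<delta>: "0 < \<delta>" "(\<lambda>t. \<Phi> q + t *\<^sub>R s) ` {-\<delta><..<\<delta>} \<subseteq> V"
      by (rule curve_stays_in_open[OF cont _ open_V]) (use \<Phi>_in[OF q(2)] in auto)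
    show "d\<Psi> (\<Phi> q) s \<in> tangent_space M q"
    proof (rule tangent_spaceI[where \<gamma> = "\<lambda>t. \<Psi> (\<Phi> q + t *\<^sub>R s)", OF _ \<delta>(1) open_U])
      have "smooth_on {-\<delta><..<\<delta>} (\<lambda>t. \<Phi> q + t *\<^sub>R s)"
        by (intro smooth_on_add smooth_on_scaleR smooth_on_const smooth_on_id) auto
      then show "smooth_on {-\<delta><..<\<delta>} (\<lambda>t. \<Psi> (\<Phi> q + t *\<^sub>R s))"
        by (rule smooth_on_compose[OF _ _ smooth_\<Psi> \<delta>(2), rotated]) simp
      have "((\<lambda>t. \<Phi> q + t *\<^sub>R s) has_vector_derivative s) (at 0)"
        by (auto intro!: derivative_eq_intros)
      from has_vector_derivative_compose[OF this]
      show "((\<lambda>t. \<Psi> (\<Phi> q + t *\<^sub>R s)) has_vector_derivative d\<Psi> (\<Phi> q) s) (at 0)"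
        using \<Psi>_derivative[OF \<Phi>_in[OF q(2)]] by simp
      fix t assume t: "t \<in> {-\<delta><..<\<delta>}"
      have "\<Phi> q \<in> S" using q in_M_iff by blast
      then have "\<Phi> q + t *\<^sub>R s \<in> S" using s subspace_S by (intro subspace_add subspace_scale)
      then show "\<Psi> (\<Phi> q + t *\<^sub>R s) \<in> M"
        using t \<delta>(2) in_M_iff[OF \<Psi>_in] \<Phi>_\<Psi> by (simp add: image_subset_iff)
    qed (use q \<Psi>_\<Phi> in auto)
  qed
qed

lemma subspace_tangent_space: "q \<in> M \<Longrightarrow> q \<in> U \<Longrightarrow> subspace (tangent_space M q)"
  using linear_subspace_image[OF linear_d\<Psi>[OF \<Phi>_in] subspace_S] by (simp add: tangent_space_eq)

lemma dim_tangent_space: "q \<in> M \<Longrightarrow> q \<in> U \<Longrightarrow> dim (tangent_space M q) = m"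
  using dim_image_eq[OF linear_d\<Psi>[OF \<Phi>_in], of q S] inj_d\<Psi>[OF \<Phi>_in, of q]
  by (simp add: tangent_space_eq dim_S inj_on_subset[OF _ subset_UNIV])

end

lemma submanifold_slice_chart:
  assumes "submanifold m M" "p \<in> M"
  obtains U V S \<Phi> \<Psi> where "slice_chart m M U V S \<Phi> \<Psi>" "p \<in> U"
  using assms unfolding submanifold_def slice_chart_def by metis

text \<open>\<open>P\<close> lives on an ambient neighbourhood, so that ordinary derivatives apply.
  At points off M only linearity and smoothness are asked for; derivatives along M depend only on
  the values on M.\<close>

definition tangent_projector :: "'a::euclidean_space set \<Rightarrow> 'a set \<Rightarrow> ('a \<Rightarrow> 'a \<Rightarrow> 'a) \<Rightarrow> bool" where
  "tangent_projector M U P \<longleftrightarrow> open U \<and> (\<forall>q\<in>U. linear (P q)) \<and> (\<forall>x. smooth_on U (\<lambda>q. P q x)) \<and>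
    (\<forall>q\<in>M \<inter> U. subspace (tangent_space M q) \<and> orth_proj (tangent_space M q) (P q))"

lemma (in slice_chart) tangent_projector_exists:
  obtains P where "tangent_projector M U P"
proof -
  obtain B where B: "independent B" "span B = S"
    using basis_exists[of S] span_subspace subspace_S by metis
  have "\<exists>P. (\<forall>x. smooth_on U (\<lambda>q. P q x)) \<and> (\<forall>q\<in>U. orth_proj (d\<Psi> (\<Phi> q) ` span B) (P q))"
  proof (rule smooth_orth_proj[OF open_U _ _ _ B(1)])
    show "smooth_on U (\<lambda>q. d\<Psi> (\<Phi> q) x)" for x
      using \<Phi>_in by (intro smooth_on_compose[OF open_U smooth_\<Phi> smooth_on_frechet_derivative[OF smooth_\<Psi>]])
        auto
  qed (use linear_d\<Psi> inj_d\<Psi> \<Phi>_in in auto)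
  then obtain P where P: "\<And>x. smooth_on U (\<lambda>q. P q x)"
    "\<And>q. q \<in> U \<Longrightarrow> orth_proj (d\<Psi> (\<Phi> q) ` S) (P q)"
    unfolding B(2) by blast
  have "tangent_projector M U P"
    unfolding tangent_projector_def
    using open_U P orth_proj_linear[OF P(2)] subspace_tangent_space tangent_space_eq by simp
  then show ?thesis by (rule that)
qed

section \<open>Derivative of the tangent projection, second fundamental form and mean
  curvature\<close>

locale projected =
  fixes M U :: "'a::euclidean_space set" and P :: "'a \<Rightarrow> 'a \<Rightarrow> 'a"
  assumes proj: "tangent_projector M U P"
begin

lemma open_dom: "open U" and linear_P: "q \<in> U \<Longrightarrow> linear (P q)"
  and smooth_P: "smooth_on U (\<lambda>q. P q x)"
  and subspace_tangent: "q \<in> M \<Longrightarrow> q \<in> U \<Longrightarrow> subspace (tangent_space M q)"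
  and orth_P: "q \<in> M \<Longrightarrow> q \<in> U \<Longrightarrow> orth_proj (tangent_space M q) (P q)"
  using proj by (auto simp: tangent_projector_def)

text \<open>\<open>v\<close> is the direction of differentiation and \<open>x\<close> the fixed
  vector being projected. With \<open>x = d\<close> this is the derivative of the tangential part of
  \<open>d\<close>; with \<open>x\<close> and \<open>v\<close> tangent it is the second fundamental
  form.\<close>

definition DP :: "'a \<Rightarrow> 'a \<Rightarrow> 'a \<Rightarrow> 'a" where
  "DP q v x = frechet_derivative (\<lambda>q. P q x) (at q) v"

lemma P_derivative: "q \<in> U \<Longrightarrow> ((\<lambda>q. P q x) has_derivative (\<lambda>v. DP q v x)) (at q)"
  unfolding DP_def using smooth_on_has_derivative[OF smooth_P] by blast

lemma linear_DP_left: "q \<in> U \<Longrightarrow> linear (\<lambda>v. DP q v x)"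
  using P_derivative has_derivative_linear by blast

lemma linear_DP_right: assumes q: "q \<in> U" shows "linear (DP q v)"
proof (rule linearI)
  fix x y :: 'a and c :: real
  have "((\<lambda>q. P q (x + y)) has_derivative (\<lambda>v. DP q v x + DP q v y)) (at q)"
    by (rule has_derivative_transform_within_open[OF has_derivative_add[OF P_derivative[OF q, of x]
        P_derivative[OF q, of y]] open_dom q]) (simp add: linear_add[OF linear_P])
  then show "DP q v (x + y) = DP q v x + DP q v y"
    using has_derivative_unique[OF _ P_derivative[OF q]] by metis
  have "((\<lambda>q. P q (c *\<^sub>R x)) has_derivative (\<lambda>v. c *\<^sub>R DP q v x)) (at q)"
    by (rule has_derivative_transform_within_open[OF has_derivative_scaleR_right[OF P_derivative[OF q, of x]]
        open_dom q]) (simp add: linear_scale[OF linear_P])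
  then show "DP q v (c *\<^sub>R x) = c *\<^sub>R DP q v x"
    using has_derivative_unique[OF _ P_derivative[OF q]] by metis
qed

lemma tangent_part_eq:
  assumes "q \<in> M" "q \<in> U"
  shows "tangent_part M q x = P q x"
  unfolding tangent_part_def
proof (rule the_equality)
  show "P q x \<in> tangent_space M q \<and> (\<forall>w\<in>tangent_space M q. orthogonal (x - P q x) w)"
    using orth_proj_in[OF orth_P[OF assms]] orth_proj_orth[OF orth_P[OF assms]]
    by (auto simp: orthogonal_def)
  show "u = P q x"
    if "u \<in> tangent_space M q \<and> (\<forall>w\<in>tangent_space M q. orthogonal (x - u) w)" for u
    using orth_proj_unique[OF orth_P[OF assms] subspace_tangent[OF assms], of u x] that
    by (auto simp: orthogonal_def)
qed

text \<open>Orthogonal projections are symmetric at each point of M, and symmetry survives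
  differentiation along M.\<close>

lemma DP_symmetric:
  assumes "q \<in> M" "q \<in> U" "v \<in> tangent_space M q"
  shows "DP q v x \<bullet> y = x \<bullet> DP q v y"
  by (rule tangent_derivative_cong[OF assms(3) open_dom assms(2)
        has_derivative_inner_left[OF P_derivative[OF assms(2)]]
        has_derivative_inner_right[OF P_derivative[OF assms(2)]]])
    (use orth_P orth_proj_symmetric in blast)

text \<open>The product rule applied to \<open>W x = P x (W x)\<close>, an identity that holds only
  on M.\<close>

lemma DP_tangent_field:
  assumes q: "q \<in> M" "q \<in> U" and v: "v \<in> tangent_space M q" and "tangent_field_near M q W"
  shows "DP q v (W q) = frechet_derivative W (at q) v - P q (frechet_derivative W (at q) v)"
proof -
  obtain U' where U': "open U'" "q \<in> U'" "smooth_on U' W" "\<And>x. x \<in> M \<inter> U' \<Longrightarrow> W x \<in> tangent_space M x"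
    using assms(4) by (auto simp: tangent_field_near_def)
  define DW where "DW = frechet_derivative W (at q)"
  have W: "(W has_derivative DW) (at q)"
    unfolding DW_def using smooth_on_has_derivative[OF U'(3,2)] .
  have "DW v = (\<Sum>b\<in>Basis. (W q \<bullet> b) *\<^sub>R DP q v b + (DW v \<bullet> b) *\<^sub>R P q b)"
  proof (rule tangent_derivative_cong[OF v, of "U \<inter> U'" W DW])
    show "((\<lambda>x. \<Sum>b\<in>Basis. (W x \<bullet> b) *\<^sub>R P x b) has_derivative
      (\<lambda>v. \<Sum>b\<in>Basis. (W q \<bullet> b) *\<^sub>R DP q v b + (DW v \<bullet> b) *\<^sub>R P q b)) (at q)"
      by (intro has_derivative_sum has_derivative_scaleR P_derivative q has_derivative_inner_left W)
    fix x assume x: "x \<in> M" "x \<in> U \<inter> U'"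
    then have "W x = P x (W x)"
      using orth_proj_fix[OF orth_P subspace_tangent] U'(4) by auto
    also have "\<dots> = (\<Sum>b\<in>Basis. (W x \<bullet> b) *\<^sub>R P x b)"
      using x by (intro linear_sum_Basis linear_P) auto
    finally show "W x = (\<Sum>b\<in>Basis. (W x \<bullet> b) *\<^sub>R P x b)" .
  qed (use open_dom U' q W in auto)
  also have "\<dots> = DP q v (W q) + P q (DW v)"
    unfolding sum.distrib using linear_sum_Basis[OF linear_DP_right[OF q(2)]] linear_sum_Basis[OF linear_P[OF q(2)]]
    by metis
  finally show ?thesis unfolding DW_def by (metis add_diff_cancel_right')
qed

lemma tangent_field_exists:
  assumes "q \<in> M" "q \<in> U" "w \<in> tangent_space M q"
  shows "tangent_field_near M q (\<lambda>x. P x w) \<and> P q w = w"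
  unfolding tangent_field_near_def
  using open_dom assms smooth_P orth_proj_in[OF orth_P] orth_proj_fix[OF orth_P subspace_tangent]
  by auto

text \<open>The normal part of the derivative is the same for all tangent fields with value
  \<open>w\<close> at \<open>q\<close>, so the choice of the field is harmless; projecting the
  constant vector \<open>w\<close> shows that such a field exists.\<close>

lemma second_fundamental_form_eq:
  assumes q: "q \<in> M" "q \<in> U" and "v \<in> tangent_space M q" "w \<in> tangent_space M q"
  shows "second_fundamental_form M q v w = DP q v w"
proof -
  have "\<exists>W. tangent_field_near M q W \<and> W q = w"
    using tangent_field_exists[OF q assms(4)] by (intro exI[of _ "\<lambda>x. P x w"])
  define W where "W = (SOME W. tangent_field_near M q W \<and> W q = w)"
  have W: "tangent_field_near M q W" "W q = w"
    unfolding W_def using someI_ex[OF \<open>\<exists>W. tangent_field_near M q W \<and> W q = w\<close>] by auto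
  show ?thesis
    unfolding second_fundamental_form_def normal_part_def tangent_part_eq[OF q] W_def[symmetric]
    using DP_tangent_field[OF q assms(3) W(1)] W(2) by simp
qed

lemma mean_curvature_zero_iff:
  assumes q: "q \<in> M" "q \<in> U"
  shows "mean_curvature_vector M q = 0 \<longleftrightarrow> (\<Sum>b\<in>Basis. DP q (P q b) b) = 0"
proof -
  have "\<exists>B. orthonormal_basis_of (tangent_space M q) B"
    using orthonormal_basis_subspace[OF subspace_tangent[OF q]]
    unfolding orthonormal_basis_of_def by metis
  from someI_ex[OF this] obtain B where B: "orthonormal_basis_of (tangent_space M q) B"
    "B = (SOME B. orthonormal_basis_of (tangent_space M q) B)" by blast
  have "e \<in> tangent_space M q" if "e \<in> B" for e
    using B(1) that by (auto simp: orthonormal_basis_of_def intro: span_base)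
  then have "(\<Sum>e\<in>B. second_fundamental_form M q e e) = (\<Sum>e\<in>B. DP q e e)"
    by (intro sum.cong) (auto simp: second_fundamental_form_eq[OF q])
  also have "\<dots> = (\<Sum>b\<in>Basis. DP q (P q b) b)"
    by (rule sum_orthonormal_basis[OF B(1) orth_P[OF q] linear_DP_left[OF q(2)] linear_DP_right[OF q(2)]])
  finally have H: "mean_curvature_vector M q =
    (1 / real (dim (tangent_space M q))) *\<^sub>R (\<Sum>b\<in>Basis. DP q (P q b) b)"
    unfolding mean_curvature_vector_def B(2) by simp
  show ?thesis
  proof (cases "dim (tangent_space M q) = 0")
    \<comment> \<open>In dimension 0 the factor 1/0 is 0, so the mean curvature vanishes by
      convention; the sum vanishes too, since \<open>P q\<close> is 0.\<close>
    case True
    then have "P q b = 0" for b using orth_proj_in[OF orth_P[OF q], of b] by auto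
    then show ?thesis using H linear_0[OF linear_DP_left[OF q(2)]] by simp
  qed (simp add: H)
qed

end

text \<open>On coordinate fields of a chart the second fundamental form is the normal part of a
  second derivative of the parametrisation, which is symmetric.\<close>

lemma (in slice_chart) second_fundamental_form_symmetric:
  assumes "projected M U' P" and q: "q \<in> M" "q \<in> U" "q \<in> U'"
    and vw: "v \<in> tangent_space M q" "w \<in> tangent_space M q"
  shows "projected.DP P q v w = projected.DP P q w v"
proof -
  interpret projected M U' P by fact
  obtain r s where rs: "r \<in> S" "s \<in> S" "v = d\<Psi> (\<Phi> q) r" "w = d\<Psi> (\<Phi> q) s"
    using vw tangent_space_eq[OF q(1,2)] by auto
  have V: "\<Phi> q \<in> V" using \<Phi>_in q by blast
  \<comment> \<open>The constant vector \<open>s\<close> of the chart extends \<open>w\<close> to a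
    coordinate field tangent to M.\<close>
  have field: "DP q v (d\<Psi> (\<Phi> q) s) = y - P q y"
    if "s \<in> S" "v = d\<Psi> (\<Phi> q) r" "v \<in> tangent_space M q"
      "y = frechet_derivative (\<lambda>u. d\<Psi> u s) (at (\<Phi> q)) r" for v r s y
  proof -
    have near: "tangent_field_near M q (\<lambda>x. d\<Psi> (\<Phi> x) s)"
      unfolding tangent_field_near_def
    proof (intro exI[of _ U] conjI ballI)
      show "smooth_on U (\<lambda>x. d\<Psi> (\<Phi> x) s)"
        using \<Phi>_in by (intro smooth_on_compose[OF open_U smooth_\<Phi> smooth_on_frechet_derivative[OF smooth_\<Psi>]])
          auto
    qed (use open_U q that(1) tangent_space_eq in auto)
    have "((\<lambda>x. d\<Psi> (\<Phi> x) s) has_derivative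
      (\<lambda>v. frechet_derivative (\<lambda>u. d\<Psi> u s) (at (\<Phi> q)) (d\<Phi> q v))) (at q)"
      by (rule has_derivative_compose[OF \<Phi>_derivative[OF q(2)]
            smooth_on_has_derivative[OF smooth_on_frechet_derivative[OF smooth_\<Psi>] V]])
    then have "frechet_derivative (\<lambda>x. d\<Psi> (\<Phi> x) s) (at q) v
      = frechet_derivative (\<lambda>u. d\<Psi> u s) (at (\<Phi> q)) (d\<Phi> q v)"
      by (metis frechet_derivative_at)
    also have "d\<Phi> q v = r" using d\<Phi>_d\<Psi>[OF V, of r] \<Psi>_\<Phi>[OF q(2)] that(2) by simp
    finally show ?thesis using DP_tangent_field[OF q(1,3) that(3) near] that(4) by simp
  qed
  show ?thesis
    using field[OF rs(2,3) vw(1) refl] field[OF rs(1,4) vw(2) refl] rs(3,4)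
      symmetric_second_derivative[OF open_V smooth_\<Psi> V, of s r] by simp
qed

text \<open>\<open>f\<close> may be meaningful only on M, hence the ambient representative
  \<open>g\<close> near each point. Vanishing tangential derivatives make \<open>f\<close> locally
  constant, and connectedness gives one constant.\<close>

lemma constant_on_submanifold:
  fixes f :: "'a::euclidean_space \<Rightarrow> 'b::real_normed_vector"
  assumes "submanifold m M" "connected M"
    and "\<And>p. p \<in> M \<Longrightarrow> \<exists>U g. open U \<and> p \<in> U \<and> (\<forall>q\<in>M \<inter> U. f q = g q \<and>
      (\<exists>g'. (g has_derivative g') (at q) \<and> (\<forall>v\<in>tangent_space M q. g' v = 0)))"
  shows "\<exists>c. \<forall>q\<in>M. f q = c"
proof -
  have "\<forall>\<^sub>F q in at p within M. f p = f q" if p: "p \<in> M" for p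
  proof -
    obtain U V S \<Phi> \<Psi> where ch: "slice_chart m M U V S \<Phi> \<Psi>" "p \<in> U"
      using submanifold_slice_chart[OF assms(1) p] by blast
    interpret slice_chart m M U V S \<Phi> \<Psi> by fact
    obtain U' g where g: "open U'" "p \<in> U'" "\<And>q. q \<in> M \<inter> U' \<Longrightarrow> f q = g q"
      "\<And>q. q \<in> M \<inter> U' \<Longrightarrow> \<exists>g'. (g has_derivative g') (at q) \<and> (\<forall>v\<in>tangent_space M q. g' v = 0)"
      using assms(3)[OF p] by blast
    have "open (V \<inter> \<Psi> -` U')"
      using smooth_on_imp_continuous_on[OF smooth_\<Psi>] open_V g(1) by (rule continuous_open_preimage)
    moreover have "\<Phi> p \<in> V \<inter> \<Psi> -` U'" using ch(2) g(2) \<Phi>_in \<Psi>_\<Phi> by auto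
    ultimately obtain e where e: "e > 0" "ball (\<Phi> p) e \<subseteq> V \<inter> \<Psi> -` U'" using openE by blast
    have W: "open (U \<inter> \<Phi> -` ball (\<Phi> p) e)"
      using smooth_on_imp_continuous_on[OF smooth_\<Phi>] open_U open_ball by (rule continuous_open_preimage)
    have S: "x \<in> S \<and> x \<in> V \<and> \<Psi> x \<in> U' \<and> \<Psi> x \<in> M" if "x \<in> S \<inter> ball (\<Phi> p) e" for x
      using that e(2) in_M_iff[OF \<Psi>_in] \<Phi>_\<Psi> by fastforce
    have "f p = f q" if q: "q \<in> M" "q \<in> U \<inter> \<Phi> -` ball (\<Phi> p) e" for q
    proof -
      \<comment> \<open>The segment lies in the subspace and in the ball, so its image under the
        parametrisation joins \<open>p\<close> to \<open>q\<close> inside M.\<close>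
      define c where "c t = \<Phi> p + t *\<^sub>R (\<Phi> q - \<Phi> p)" for t
      have pq: "\<Phi> p \<in> S" "\<Phi> q \<in> S" using p q ch(2) in_M_iff by auto
      have c: "c t \<in> S \<inter> ball (\<Phi> p) e" if "t \<in> {0..1}" for t
      proof
        show "c t \<in> S" unfolding c_def
          using pq subspace_S by (intro subspace_add subspace_scale subspace_diff)
        have "dist (\<Phi> p) (c t) = t * dist (\<Phi> p) (\<Phi> q)"
          using that by (simp add: c_def dist_norm norm_minus_commute)
        also have "\<dots> \<le> 1 * dist (\<Phi> p) (\<Phi> q)" using that by (intro mult_right_mono) auto
        also have "\<dots> < e" using q by auto
        finally show "c t \<in> ball (\<Phi> p) e" by simp
      qed
      have "((\<lambda>t. g (\<Psi> (c t))) has_derivative (\<lambda>h. 0)) (at t within {0..1})" if t: "t \<in> {0..1}" for t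
      proof -
        have ct: "c t \<in> S" "c t \<in> V" "\<Psi> (c t) \<in> U'" "\<Psi> (c t) \<in> M" using S[OF c[OF t]] by auto
        obtain g' where g': "(g has_derivative g') (at (\<Psi> (c t)))"
          "\<And>v. v \<in> tangent_space M (\<Psi> (c t)) \<Longrightarrow> g' v = 0"
          using g(4) ct by blast
        have "(c has_vector_derivative (\<Phi> q - \<Phi> p)) (at t)"
          unfolding c_def by (auto intro!: derivative_eq_intros)
        from has_vector_derivative_compose[OF has_vector_derivative_compose[OF this \<Psi>_derivative[OF ct(2)]] g'(1)]
        have "((\<lambda>t. g (\<Psi> (c t))) has_vector_derivative g' (d\<Psi> (c t) (\<Phi> q - \<Phi> p))) (at t)" .
        moreover have "d\<Psi> (c t) (\<Phi> q - \<Phi> p) \<in> tangent_space M (\<Psi> (c t))"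
          using tangent_space_eq[OF ct(4) \<Psi>_in[OF ct(2)]] \<Phi>_\<Psi>[OF ct(2)] pq subspace_S
          by (auto intro: subspace_diff)
        ultimately show ?thesis using g'(2)
          by (auto simp: has_vector_derivative_def intro: has_derivative_at_withinI)
      qed
      then have "g (\<Psi> (c 0)) = g (\<Psi> (c 1))"
        by (intro has_derivative_zero_unique[of "{0..1}"]) auto
      moreover have "\<Psi> (c 0) = p" "\<Psi> (c 1) = q" using ch(2) q \<Psi>_\<Phi> by (auto simp: c_def)
      moreover have "q \<in> U'" using S[of "\<Phi> q"] pq q \<Psi>_\<Phi> by auto
      ultimately show ?thesis using g(2,3) p q(1) by auto
    qed
    then show ?thesis
      using W ch(2) e(1) unfolding eventually_at_topological
      by (intro exI[of _ "U \<inter> \<Phi> -` ball (\<Phi> p) e"]) auto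
  qed
  then have "f p = f q" if "p \<in> M" "q \<in> M" for p q
    using connected_local_const[OF assms(2) that] by blast
  then show ?thesis by blast
qed

subsection \<open>Minimal ruled helices\<close>

text \<open>Integral curves exist with a common time for all starting points near \<open>p\<close>.
  Ruledness makes each a straight line, so its velocity is constant, and this velocity is the field
  itself.\<close>

lemma ruled_lines:
  assumes "submanifold m M" "ruled M d" "c > 0"
    and c: "\<And>q. q \<in> M \<Longrightarrow> norm (tangent_part M q d) = c" and p: "p \<in> M"
  obtains W \<epsilon> where "open W" "p \<in> W" "\<epsilon> > 0"
    "\<And>q t. q \<in> M \<Longrightarrow> q \<in> W \<Longrightarrow> \<bar>t\<bar> < \<epsilon> \<Longrightarrow> q + t *\<^sub>R tangent_part M q d \<in> M \<and>
      tangent_part M (q + t *\<^sub>R tangent_part M q d) d = tangent_part M q d"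
proof -
  obtain U V S \<Phi> \<Psi> where ch: "slice_chart m M U V S \<Phi> \<Psi>" "p \<in> U"
    using submanifold_slice_chart[OF assms(1) p] by blast
  interpret slice_chart m M U V S \<Phi> \<Psi> by fact
  obtain P where P: "tangent_projector M U P" using tangent_projector_exists .
  interpret projected M U P by (rule projected.intro[OF P])
  obtain f where f: "orth_proj S f" using orth_proj_exists[OF subspace_S] by blast
  \<comment> \<open>The unit field in chart coordinates. Composing with the projection onto S
    changes nothing at points of S, where the transported field already has values in S, but it
    keeps solutions starting in S inside S.\<close>
  define G where "G u = f ((1 / c) *\<^sub>R d\<Phi> (\<Psi> u) (P (\<Psi> u) d))" for u
  have "smooth_on V (\<lambda>u. d\<Phi> (\<Psi> u) (P (\<Psi> u) d))"
  proof (rule smooth_on_linear_apply[OF open_V, where P = "\<lambda>u. d\<Phi> (\<Psi> u)" and f = "\<lambda>u. P (\<Psi> u) d"])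
    show "linear (d\<Phi> (\<Psi> u))" if "u \<in> V" for u
      using \<Phi>_derivative[OF \<Psi>_in[OF that]] has_derivative_linear by blast
    show "smooth_on V (\<lambda>u. d\<Phi> (\<Psi> u) x)" for x
      using \<Psi>_in by (intro smooth_on_compose[OF open_V smooth_\<Psi> smooth_on_frechet_derivative[OF smooth_\<Phi>]])
        auto
    show "smooth_on V (\<lambda>u. P (\<Psi> u) d)"
      using \<Psi>_in by (intro smooth_on_compose[OF open_V smooth_\<Psi> smooth_P]) auto
  qed
  then have "smooth_on V (\<lambda>u. (1 / c) *\<^sub>R d\<Phi> (\<Psi> u) (P (\<Psi> u) d))"
    by (intro smooth_on_scaleR smooth_on_const open_V)
  then have smooth_G: "smooth_on V G"
    unfolding G_def
    using smooth_on_linear_compose[OF open_V] orth_proj_linear[OF f] linear_conv_bounded_linear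
    by blast
  obtain \<epsilon> r where er: "\<epsilon> > 0" "r > 0"
    "\<And>u1. u1 \<in> ball (\<Phi> p) r \<Longrightarrow> \<exists>u. u 0 = u1 \<and>
      (\<forall>t\<in>{-\<epsilon><..<\<epsilon>}. u t \<in> V \<and> (u has_vector_derivative G (u t)) (at t))"
    using local_ode_solution[OF open_V smooth_G \<Phi>_in[OF ch(2)]] by blast
  define W where "W = U \<inter> \<Phi> -` ball (\<Phi> p) r"
  have "open W" unfolding W_def
    using smooth_on_imp_continuous_on[OF smooth_\<Phi>] open_U open_ball by (rule continuous_open_preimage)
  moreover have "p \<in> W" using ch(2) er(2) by (simp add: W_def)
  \<comment> \<open>The integral curves have unit speed, whereas \<open>t\<close> multiplies a
    vector of length \<open>c\<close>; time \<open>t\<close> below is curve time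
    \<open>t * c\<close>.\<close>
  moreover have "\<epsilon> / c > 0" using er \<open>c > 0\<close> by simp
  moreover have "q + t *\<^sub>R tangent_part M q d \<in> M \<and>
      tangent_part M (q + t *\<^sub>R tangent_part M q d) d = tangent_part M q d"
    if q: "q \<in> M" "q \<in> W" and t: "\<bar>t\<bar> < \<epsilon> / c" for q t
  proof -
    have qU: "q \<in> U" "\<Phi> q \<in> ball (\<Phi> p) r" using q by (auto simp: W_def)
    have qS: "\<Phi> q \<in> S" using q(1) qU in_M_iff by blast
    obtain u where u: "u 0 = \<Phi> q" "\<And>t. t \<in> {-\<epsilon><..<\<epsilon>} \<Longrightarrow> u t \<in> V"
      "\<And>t. t \<in> {-\<epsilon><..<\<epsilon>} \<Longrightarrow> (u has_vector_derivative G (u t)) (at t)"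
      using er(3)[OF qU(2)] by blast
    have GS: "f (G x) = G x" for x
      unfolding G_def by (rule orth_proj_fix[OF f subspace_S orth_proj_in[OF f]])
    \<comment> \<open>The component of \<open>u t\<close> normal to S has derivative 0 and starts at
      0.\<close>
    have uS: "u t \<in> S" if t: "t \<in> {-\<epsilon><..<\<epsilon>}" for t
    proof -
      have "((\<lambda>t. u t - f (u t)) has_derivative (\<lambda>h. 0)) (at t within {-\<epsilon><..<\<epsilon>})"
        if "t \<in> {-\<epsilon><..<\<epsilon>}" for t
      proof -
        have "((\<lambda>t. u t - f (u t)) has_vector_derivative G (u t) - f (G (u t))) (at t)"
          by (intro has_vector_derivative_diff u that
              has_vector_derivative_compose[OF u(3)[OF that] linear_imp_has_derivative[OF orth_proj_linear[OF f]]])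
        then show ?thesis
          by (simp add: GS has_vector_derivative_def has_derivative_at_withinI)
      qed
      then have "u t - f (u t) = u 0 - f (u 0)"
        by (intro has_derivative_zero_unique[of "{-\<epsilon><..<\<epsilon>}"]) (use t er in auto)
      also have "\<dots> = 0" using orth_proj_fix[OF f subspace_S qS] u(1) by simp
      finally have "u t = f (u t)" by simp
      then show ?thesis using orth_proj_in[OF f] by metis
    qed
    define \<gamma> where "\<gamma> t = \<Psi> (u t)" for t
    have \<gamma>M: "\<gamma> t \<in> M" "\<gamma> t \<in> U" if "t \<in> {-\<epsilon><..<\<epsilon>}" for t
      using in_M_iff[OF \<Psi>_in[OF u(2)[OF that]]] uS[OF that] \<Phi>_\<Psi>[OF u(2)[OF that]]
        \<Psi>_in[OF u(2)[OF that]] by (auto simp: \<gamma>_def)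
    have \<gamma>': "(\<gamma> has_vector_derivative helix_field M d (\<gamma> t)) (at t)" if t: "t \<in> {-\<epsilon><..<\<epsilon>}" for t
    proof -
      have V: "u t \<in> V" using u(2) t by blast
      have "P (\<gamma> t) d \<in> tangent_space M (\<gamma> t)" using orth_proj_in[OF orth_P[OF \<gamma>M[OF t]]] .
      then obtain s where s: "s \<in> S" "P (\<gamma> t) d = d\<Psi> (u t) s"
        using tangent_space_eq[OF \<gamma>M[OF t]] \<Phi>_\<Psi>[OF V] by (auto simp: \<gamma>_def)
      have "(1 / c) *\<^sub>R s \<in> S" using s subspace_S subspace_scale by blast
      then have "G (u t) = (1 / c) *\<^sub>R s"
        using s(2) d\<Phi>_d\<Psi>[OF V] orth_proj_fix[OF f subspace_S] by (simp add: G_def \<gamma>_def)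
      then have "d\<Psi> (u t) (G (u t)) = (1 / c) *\<^sub>R P (\<gamma> t) d"
        using s linear_d\<Psi>[OF V] by (simp add: linear_scale)
      also have "\<dots> = helix_field M d (\<gamma> t)"
        using c[OF \<gamma>M(1)[OF t]] by (simp add: helix_field_def sgn_div_norm tangent_part_eq \<gamma>M[OF t] inverse_eq_divide)
      finally show ?thesis
        using has_vector_derivative_compose[OF u(3)[OF t] \<Psi>_derivative[OF V]]
        by (simp add: \<gamma>_def[abs_def])
    qed
    have "\<exists>a b. \<forall>t\<in>{-\<epsilon><..<\<epsilon>}. \<gamma> t = a + t *\<^sub>R b"
      using \<gamma>M(1) \<gamma>' by (intro assms(2)[unfolded ruled_def, rule_format]) auto
    then obtain a b where ab: "\<And>t. t \<in> {-\<epsilon><..<\<epsilon>} \<Longrightarrow> \<gamma> t = a + t *\<^sub>R b" by blast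
    have "\<gamma> 0 = q" using u(1) \<Psi>_\<Phi> qU by (simp add: \<gamma>_def)
    then have a: "a = q" using ab[of 0] er by simp
    have b: "helix_field M d (\<gamma> t) = b" if t: "t \<in> {-\<epsilon><..<\<epsilon>}" for t
    proof -
      have "((\<lambda>t. a + t *\<^sub>R b) has_vector_derivative b) (at t)"
        by (auto intro!: derivative_eq_intros)
      then have "(\<gamma> has_vector_derivative b) (at t)"
        by (rule has_vector_derivative_transform_within_open[of _ _ _ "{-\<epsilon><..<\<epsilon>}"])
          (use t ab in auto)
      then show ?thesis using \<gamma>'[OF t] vector_derivative_unique_at by blast
    qed
    have X: "tangent_part M x d = c *\<^sub>R helix_field M d x" if "x \<in> M" for x
      using c[OF that] \<open>c > 0\<close> by (simp add: helix_field_def sgn_div_norm)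
    have tc: "t * c \<in> {-\<epsilon><..<\<epsilon>}" using t \<open>c > 0\<close> by (simp add: abs_less_iff field_simps)
    have b0: "helix_field M d q = b" using b[of 0] er(1) \<open>\<gamma> 0 = q\<close> by simp
    have "\<gamma> (t * c) = q + t *\<^sub>R tangent_part M q d"
      using ab[OF tc] a X[OF q(1)] b0 by simp
    then show ?thesis
      using \<gamma>M(1)[OF tc] X[OF \<gamma>M(1)[OF tc]] b[OF tc] X[OF q(1)] b0 by simp
  qed
  ultimately show ?thesis by (rule that)
qed

lemma trace_eq_sum_Basis:
  fixes A :: "real ^ 'n ^ 'n"
  shows "trace A = (\<Sum>b\<in>Basis. (A *v b) \<bullet> b)"
proof -
  have Basis: "(Basis :: (real ^ 'n) set) = (\<lambda>i. axis i 1) ` UNIV" by (auto simp: Basis_vec_def)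
  have "(\<Sum>b\<in>Basis. (A *v b) \<bullet> b) = (\<Sum>i\<in>UNIV. (A *v axis i 1) \<bullet> axis i 1)"
    unfolding Basis by (subst sum.reindex) (auto simp: inj_on_def axis_eq_axis)
  also have "\<dots> = trace A"
    by (simp add: trace_def inner_axis matrix_vector_mult_basis column_def)
  finally show ?thesis by simp
qed

lemma symmetric_matrixI:
  fixes A :: "real ^ 'n ^ 'n"
  assumes "\<And>x y. (A *v x) \<bullet> y = x \<bullet> (A *v y)"
  shows "transpose A = A"
proof (subst matrix_eq, rule allI)
  fix y
  have "x \<bullet> (transpose A *v y) = x \<bullet> (A *v y)" for x
    by (simp only: inner_transpose_vector_mult assms)
  then show "transpose A *v y = A *v y" by (metis vector_eq_rdot inner_commute)
qed

text \<open>Along a ruling the tangent spaces are \<open>(1 + t E) (T\<^sub>p M)\<close>, where \<open>E\<close> is the derivative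
  of the tangential part of \<open>d\<close> at \<open>p\<close>. By minimality that tangential part is divergence free at every
  point of the ruling, and this is the trace condition of \<open>gram_trace_zero_imp_zero\<close>.\<close>

lemma minimal_ruled_parallel:
  fixes M :: "(real ^ 'n) set" and d :: "real ^ 'n"
  assumes sub: "submanifold m M" and "minimal M" "ruled M d" "c > 0"
    and c: "\<And>q. q \<in> M \<Longrightarrow> norm (tangent_part M q d) = c"
    and "projected M U P" and p: "p \<in> M" "p \<in> U" and "v \<in> tangent_space M p"
  shows "projected.DP P p v d = 0"
proof -
  interpret projected M U P by fact
  obtain U0 V S \<Phi> \<Psi> where ch: "slice_chart m M U0 V S \<Phi> \<Psi>" "p \<in> U0"
    using submanifold_slice_chart[OF sub p(1)] by blast
  have dimT: "dim (tangent_space M q) = m" if "q \<in> M" for q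
    using submanifold_slice_chart[OF sub that] slice_chart.dim_tangent_space that by metis
  obtain W \<epsilon>1 where W: "open W" "p \<in> W" "\<epsilon>1 > 0"
    "\<And>q t. q \<in> M \<Longrightarrow> q \<in> W \<Longrightarrow> \<bar>t\<bar> < \<epsilon>1 \<Longrightarrow> q + t *\<^sub>R tangent_part M q d \<in> M \<and>
      tangent_part M (q + t *\<^sub>R tangent_part M q d) d = tangent_part M q d"
    using ruled_lines[OF sub assms(3,4) c p(1)] by blast
  note Pp = orth_P[OF p]
  \<comment> \<open>Both are square matrices on the whole ambient space, extended by 0 on the normal
    space, so that determinants and traces apply.\<close>
  define R E where "R = matrix (P p)" and "E = matrix (\<lambda>x. DP p (P p x) d)"
  have R: "R *v x = P p x" for x
    unfolding R_def using linear_P[OF p(2)] by (simp add: matrix_works linear_matrix_vector_mul_eq)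
  have E: "E *v x = DP p (P p x) d" for x
    unfolding E_def using linear_compose[OF linear_P[OF p(2)] linear_DP_left[OF p(2)]]
    by (subst matrix_works) (simp_all add: linear_matrix_vector_mul_eq comp_def)
  have PP [simp]: "P p (P p x) = P p x" for x
    by (rule orth_proj_fix[OF Pp subspace_tangent[OF p] orth_proj_in[OF Pp]])
  have symR: "transpose R = R"
    by (rule symmetric_matrixI) (simp add: R orth_proj_symmetric[OF Pp])
  \<comment> \<open>The bilinear form of \<open>R ** E\<close> is the inner product of
    \<open>d\<close> with the second fundamental form of the projected vectors.\<close>
  have symRE: "transpose (R ** E) = R ** E"
  proof (rule symmetric_matrixI)
    have "P p (DP p (P p x) d) \<bullet> y = d \<bullet> DP p (P p x) (P p y)" for x y
      using orth_proj_symmetric[OF Pp] DP_symmetric[OF p orth_proj_in[OF Pp]] by simp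
    then show "(R ** E *v x) \<bullet> y = x \<bullet> (R ** E *v y)" for x y
      using slice_chart.second_fundamental_form_symmetric[OF ch(1) assms(6) p(1) ch(2) p(2)
          orth_proj_in[OF Pp] orth_proj_in[OF Pp], of x y]
      by (simp add: R E inner_commute flip: matrix_vector_mul_assoc)
  qed
  \<comment> \<open>With \<open>A = R + t *\<^sub>R E\<close>, this is the Gram matrix of
    \<open>A\<close> plus the projection onto the normal space. The added term makes it invertible
    near \<open>t = 0\<close>.\<close>
  define G where "G t = mat 1 + (2 * t) *\<^sub>R (R ** E) + t\<^sup>2 *\<^sub>R (transpose E ** E)" for t
  have "isCont (\<lambda>t. det (G t)) 0"
    unfolding G_def by (intro isCont_det continuous_intros; simp)
  moreover have "det (G 0) = 1" by (simp add: G_def)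
  ultimately have "((\<lambda>t. det (G t)) \<longlongrightarrow> 1) (nhds 0)"
    using tendsto_at_iff_tendsto_nhds[of "\<lambda>t. det (G t)" 0] by (simp add: isCont_def)
  then have "\<forall>\<^sub>F t in nhds 0. det (G t) \<noteq> 0"
    by (rule tendsto_imp_eventually_ne) simp
  then obtain \<epsilon>2 where \<epsilon>2: "\<epsilon>2 > 0" "\<And>t. \<bar>t\<bar> < \<epsilon>2 \<Longrightarrow> det (G t) \<noteq> 0"
    unfolding eventually_nhds_metric by (auto simp: dist_real_def)
  have "continuous_on {-1<..<1} (\<lambda>t. p + t *\<^sub>R P p d)" by (intro continuous_intros)
  then obtain \<epsilon>3 where \<epsilon>3: "\<epsilon>3 > 0" "(\<lambda>t. p + t *\<^sub>R P p d) ` {-\<epsilon>3<..<\<epsilon>3} \<subseteq> U"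
    by (rule curve_stays_in_open[OF _ _ open_dom]) (use p in auto)
  define \<epsilon> where "\<epsilon> = min \<epsilon>1 (min \<epsilon>2 \<epsilon>3)"
  have \<epsilon>: "\<epsilon> > 0" using W(3) \<epsilon>2(1) \<epsilon>3(1) by (simp add: \<epsilon>_def)
  have inv: "invertible (G t)" if "\<bar>t\<bar> < \<epsilon>" for t
    using \<epsilon>2(2)[of t] that by (simp add: \<epsilon>_def invertible_det_nz)
  have tr: "trace (matrix_inv (G t) ** (transpose (R + t *\<^sub>R E) ** E)) = 0" if t: "\<bar>t\<bar> < \<epsilon>" for t
  proof -
    define A where "A = R + t *\<^sub>R E"
    have A: "A *v x = P p x + t *\<^sub>R DP p (P p x) d" for x
      by (simp add: A_def matrix_vector_mult_add_rdistrib R E flip: scaleR_matrix_vector_assoc)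
    have AR: "A ** R = A" by (subst matrix_eq) (simp add: A R flip: matrix_vector_mul_assoc)
    have ER: "E ** R = E" by (subst matrix_eq) (simp add: E R flip: matrix_vector_mul_assoc)
    have RR: "R ** R = R" by (subst matrix_eq) (simp add: R flip: matrix_vector_mul_assoc)
    have RAt: "R ** transpose A = transpose A"
      using AR symR by (metis matrix_transpose_mul)
    have EtR: "transpose E ** R = R ** E" using symRE symR by (simp add: matrix_transpose_mul)
    have tA: "transpose A = R + t *\<^sub>R transpose E"
      using symR by (simp add: A_def vec_eq_iff transpose_def)
    have AA: "transpose A ** A = G t - mat 1 + R"
    proof (subst matrix_eq, rule allI)
      fix x
      have 1: "transpose E *v (R *v x) = R *v (E *v x)" for x
        using EtR by (metis matrix_vector_mul_assoc)
      have 3: "2 * z = 2 *\<^sub>R z" for z :: "real ^ 'n"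
        by (simp add: vec_eq_iff)
      have 2: "R *v (R *v x) = R *v x" for x using RR by (metis matrix_vector_mul_assoc)
      show "transpose A ** A *v x = (G t - mat 1 + R) *v x"
        unfolding tA unfolding A_def G_def
        by (simp del: transpose_matrix_vector add: 1 2 3 matrix_vector_mult_add_rdistrib
            matrix_vector_mult_diff_rdistrib matrix_vector_right_distrib
            scaleR_matrix_vector_assoc[symmetric] matrix_vector_mult_scaleR power2_eq_square
            scaleR_add_right ac_simps flip: matrix_vector_mul_assoc)
    qed
    have AAR: "transpose A ** A = R ** G t"
    proof -
      have "R ** (transpose A ** A) = R ** G t"
        unfolding AA
        by (subst matrix_eq) (simp add: R matrix_vector_mult_add_rdistrib matrix_vector_mult_diff_rdistrib
            linear_add[OF linear_P[OF p(2)]] linear_diff[OF linear_P[OF p(2)]]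
            flip: matrix_vector_mul_assoc)
      then show ?thesis using RAt by (simp add: matrix_mul_assoc)
    qed
    define pt where "pt = p + t *\<^sub>R P p d"
    have Tp: "tangent_part M q d = P q d" if "q \<in> M" "q \<in> U" for q
      using tangent_part_eq[OF that] .
    have t': "\<bar>t\<bar> < \<epsilon>1" "t \<in> {-\<epsilon>3<..<\<epsilon>3}" using t by (auto simp: \<epsilon>_def)
    have pt: "pt \<in> M" "pt \<in> U"
      using W(4)[OF p(1) W(2) t'(1)] subsetD[OF \<epsilon>3(2) imageI[OF t'(2)]] Tp[OF p]
      by (simp_all add: pt_def)
    have h: "((\<lambda>q. q + t *\<^sub>R P q d) has_derivative (\<lambda>v. v + t *\<^sub>R DP p v d)) (at p)"
      by (intro has_derivative_add has_derivative_ident has_derivative_scaleR_right P_derivative p)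
    have smooth_h: "smooth_on U (\<lambda>q. q + t *\<^sub>R P q d)"
      by (intro smooth_on_add smooth_on_id smooth_on_scaleR smooth_on_const smooth_P open_dom)
    \<comment> \<open>A curve in M is moved a time \<open>t\<close> along the rulings; the result is
      again a curve in M.\<close>
    have At: "A *v x \<in> tangent_space M pt" for x
    proof -
      have v: "P p x \<in> tangent_space M p" using orth_proj_in[OF Pp] .
      have UW: "open (U \<inter> W)" "p \<in> U \<inter> W" using open_dom W p by auto
      obtain \<delta> \<gamma> where \<gamma>: "\<delta> > 0" "smooth_on {-\<delta><..<\<delta>} \<gamma>"
        "\<And>s. s \<in> {-\<delta><..<\<delta>} \<Longrightarrow> \<gamma> s \<in> M \<inter> (U \<inter> W)" "\<gamma> 0 = p"
        "(\<gamma> has_vector_derivative P p x) (at 0)"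
        using tangent_spaceE[OF v UW] by blast
      show ?thesis
      proof (rule tangent_spaceI[OF _ \<gamma>(1) open_UNIV])
        show "smooth_on {-\<delta><..<\<delta>} (\<lambda>s. \<gamma> s + t *\<^sub>R P (\<gamma> s) d)"
          by (rule smooth_on_compose[OF _ \<gamma>(2) smooth_h]) (use \<gamma>(3) in auto)
        show "\<gamma> s + t *\<^sub>R P (\<gamma> s) d \<in> M" if "s \<in> {-\<delta><..<\<delta>}" for s
          using \<gamma>(3)[OF that] W(4)[of "\<gamma> s" t] t'(1) Tp[of "\<gamma> s"] by auto
        show "((\<lambda>s. \<gamma> s + t *\<^sub>R P (\<gamma> s) d) has_vector_derivative A *v x) (at 0)"
          unfolding A using has_vector_derivative_compose[OF \<gamma>(5)] h \<gamma>(4) by simp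
      qed (use \<gamma>(4) in \<open>auto simp: pt_def\<close>)
    qed
    \<comment> \<open>The tangential part of \<open>d\<close> is constant along rulings;
      differentiating this identity in the starting point gives the claim.\<close>
    have DPt: "DP pt (A *v x) d = E *v x" for x
    proof -
      define U' where "U' = U \<inter> W \<inter> (U \<inter> (\<lambda>q. q + t *\<^sub>R P q d) -` U)"
      have U': "open U'" "p \<in> U'"
        unfolding U'_def using open_dom W p pt(2)
          continuous_open_preimage[OF smooth_on_imp_continuous_on[OF smooth_h] open_dom open_dom]
        by (auto simp: pt_def)
      have "DP pt (P p x + t *\<^sub>R DP p (P p x) d) d = DP p (P p x) d"
      proof (rule tangent_derivative_cong[OF orth_proj_in[OF Pp] U'])
        show "((\<lambda>q. P (q + t *\<^sub>R P q d) d) has_derivative (\<lambda>v. DP pt (v + t *\<^sub>R DP p v d) d)) (at p)"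
          unfolding pt_def by (rule has_derivative_compose[OF h P_derivative[OF pt(2), unfolded pt_def]])
        show "((\<lambda>q. P q d) has_derivative (\<lambda>v. DP p v d)) (at p)" by (rule P_derivative[OF p(2)])
        show "P (q + t *\<^sub>R P q d) d = P q d" if "q \<in> M" "q \<in> U'" for q
          using W(4)[of q t] that t'(1) Tp unfolding U'_def by force
      qed
      then show ?thesis by (simp add: A E)
    qed
    have linA: "linear ((*v) A)" by simp
    \<comment> \<open>On the tangent space at \<open>p\<close> the invertible \<open>G t\<close>
      coincides with the Gram matrix of \<open>A\<close>. Injectivity and equal dimensions then
      identify the range of \<open>A\<close> with the tangent space at \<open>pt\<close>.\<close>
    have "inj_on ((*v) A) (tangent_space M p)"
    proof (subst linear_injective_on_subspace_0[OF linA subspace_tangent[OF p]], intro ballI impI)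
      fix v assume v: "v \<in> tangent_space M p" "A *v v = 0"
      have "G t *v v = (transpose A ** A + mat 1 - R) *v v" by (simp add: AA)
      also have "\<dots> = transpose A *v (A *v v) + v - R *v v"
        by (simp add: matrix_vector_mult_add_rdistrib matrix_vector_mult_diff_rdistrib
            matrix_vector_mul_assoc)
      also have "\<dots> = 0"
        using v orth_proj_fix[OF Pp subspace_tangent[OF p] v(1)] by (simp add: R)
      finally have "matrix_inv (G t) *v (G t *v v) = 0" by simp
      then show "v = 0"
        using matrix_inv_inverse(2)[OF inv[OF t]] by (simp add: matrix_vector_mul_assoc)
    qed
    then have dim: "dim ((*v) A ` tangent_space M p) = m"
      using dim_image_eq[OF linA] subspace_tangent[OF p] dimT[OF p(1)] by (simp add: span_eq_iff[THEN iffD2])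
    have range: "range ((*v) A) = tangent_space M pt"
    proof (rule subspace_dim_equal)
      show "subspace (range ((*v) A))" using linear_subspace_image[OF linA subspace_UNIV] .
      show "subspace (tangent_space M pt)" using subspace_tangent[OF pt] .
      show "range ((*v) A) \<subseteq> tangent_space M pt" using At by auto
      have "dim ((*v) A ` tangent_space M p) \<le> dim (range ((*v) A))"
        by (intro dim_subset image_mono) auto
      then show "dim (tangent_space M pt) \<le> dim (range ((*v) A))" using dim dimT[OF pt(1)] by simp
    qed
    \<comment> \<open>The least squares formula for the projection onto the range of
      \<open>A\<close>. The Gram matrix of \<open>A\<close> is singular on the normal space, but it
      equals \<open>R ** G t\<close>, so the inverse of \<open>G t\<close> takes the place of its
      inverse.\<close>
    have Ppt: "P pt x = A *v (matrix_inv (G t) *v (transpose A *v x))" for x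
    proof (rule orth_proj_unique[OF orth_P[OF pt] subspace_tangent[OF pt]])
      show "A *v (matrix_inv (G t) *v (transpose A *v x)) \<in> tangent_space M pt" using At .
      fix w assume "w \<in> tangent_space M pt"
      then obtain y where y: "w = A *v y" using range by blast
      have "transpose A ** A ** matrix_inv (G t) ** transpose A = transpose A"
        unfolding AAR using matrix_inv_inverse(1)[OF inv[OF t]] RAt
        by (simp add: matrix_mul_assoc[symmetric])
      then have "transpose A *v (A *v (matrix_inv (G t) *v (transpose A *v x))) = transpose A *v x"
        by (simp only: matrix_vector_mul_assoc matrix_mul_assoc)
      then show "(x - A *v (matrix_inv (G t) *v (transpose A *v x))) \<bullet> w = 0"
        unfolding y
        by (simp add: inner_commute[of _ "A *v y"] matrix_vector_mult_diff_distrib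
            del: transpose_matrix_vector flip: inner_transpose_vector_mult)
    qed
    \<comment> \<open>Minimality at \<open>pt\<close> paired with \<open>d\<close>. Symmetry of
      \<open>DP\<close> makes this the divergence of the tangential part of \<open>d\<close>; the
      formulas for \<open>P pt\<close> and \<open>DP pt\<close> then express it through matrices at
      \<open>p\<close>.\<close>
    have "0 = (\<Sum>b\<in>Basis. DP pt (P pt b) b) \<bullet> d"
      using mean_curvature_zero_iff[OF pt] assms(2) pt(1) by (simp add: minimal_def)
    also have "\<dots> = (\<Sum>b\<in>Basis. DP pt (P pt b) d \<bullet> b)"
      unfolding inner_sum_left
      using DP_symmetric[OF pt orth_proj_in[OF orth_P[OF pt]]] by (simp add: inner_commute)
    also have "\<dots> = (\<Sum>b\<in>Basis. ((E ** (matrix_inv (G t) ** transpose A)) *v b) \<bullet> b)"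
      by (simp add: Ppt DPt del: transpose_matrix_vector flip: matrix_vector_mul_assoc)
    also have "\<dots> = trace (E ** (matrix_inv (G t) ** transpose A))"
      by (rule trace_eq_sum_Basis[symmetric])
    also have "\<dots> = trace (matrix_inv (G t) ** (transpose A ** E))"
      by (subst trace_mul_sym) (simp add: matrix_mul_assoc)
    finally show ?thesis by (simp add: A_def)
  qed
  have "E = 0"
    by (rule gram_trace_zero_imp_zero[OF symR symRE \<epsilon>]) (use inv tr in \<open>simp_all add: G_def\<close>)
  then have "DP p (P p v) d = 0" using E[of v] by simp
  then show ?thesis using orth_proj_fix[OF Pp subspace_tangent[OF p] assms(9)] by simp
qed

text \<open>Once the tangential part of \<open>d\<close> is a constant \<open>x\<close>, the linear
  function given by \<open>d - x\<close> has no tangential derivative. It is therefore constant on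
  M, and fullness forces \<open>d = x\<close>.\<close>

lemma minimal_ruled_helix_tangent:
  fixes M :: "(real ^ 'n) set" and d :: "real ^ 'n"
  assumes sub: "submanifold m M" and conn: "connected M" and "full M" "minimal M" "helix M d \<theta>" "ruled M d"
    and p: "p \<in> M"
  shows "tangent_part M p d = d"
proof -
  define c where "c = norm d * cos \<theta>"
  have \<theta>: "0 \<le> \<theta>" "\<theta> \<le> pi / 2" and norm: "\<And>q. q \<in> M \<Longrightarrow> norm (tangent_part M q d) = c"
    using assms(5) by (auto simp: helix_def c_def)
  have local: "\<exists>U P. projected M U P \<and> q \<in> U" if "q \<in> M" for q
  proof -
    obtain U V S \<Phi> \<Psi> where ch: "slice_chart m M U V S \<Phi> \<Psi>" "q \<in> U"
      using submanifold_slice_chart[OF sub \<open>q \<in> M\<close>] by blast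
    then show ?thesis
      using slice_chart.tangent_projector_exists[OF ch(1)] unfolding projected_def by blast
  qed
  have "\<exists>x. \<forall>q\<in>M. tangent_part M q d = x"
  proof (cases "c = 0")
    \<comment> \<open>Here \<open>helix_field\<close> is 0 and ruledness says nothing, but the
      tangential part is the constant 0.\<close>
    case True
    then show ?thesis using norm by auto
  next
    case False
    then have "c > 0" using norm[OF p] by (metis norm_ge_zero order_le_less)
    show ?thesis
    proof (rule constant_on_submanifold[OF sub conn])
      fix q assume "q \<in> M"
      from local[OF this] obtain U P where P: "projected M U P" "q \<in> U" by (elim exE conjE)
      interpret projected M U P by fact
      show "\<exists>U g. open U \<and> q \<in> U \<and> (\<forall>q\<in>M \<inter> U. tangent_part M q d = g q \<and>
        (\<exists>g'. (g has_derivative g') (at q) \<and> (\<forall>v\<in>tangent_space M q. g' v = 0)))"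
        using open_dom P tangent_part_eq P_derivative
          minimal_ruled_parallel[OF sub assms(4,6) \<open>c > 0\<close> norm P(1)]
        by (intro exI[of _ U] exI[of _ "\<lambda>x. P x d"] conjI ballI exI[of _ "\<lambda>v. DP q v d" for q]) auto
    qed
  qed
  then obtain x where x: "\<And>q. q \<in> M \<Longrightarrow> tangent_part M q d = x" by blast
  have orth: "(d - x) \<bullet> v = 0" if "q \<in> M" "v \<in> tangent_space M q" for q v
  proof -
    from local[OF that(1)] obtain U P where P: "projected M U P" "q \<in> U" by (elim exE conjE)
    interpret projected M U P by fact
    show ?thesis
      using orth_proj_orth[OF orth_P[OF that(1) P(2)] that(2), of d] tangent_part_eq[OF that(1) P(2)]
        x[OF that(1)] by simp
  qed
  have "\<exists>b. \<forall>q\<in>M. (d - x) \<bullet> q = b"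
  proof (rule constant_on_submanifold[OF sub conn])
    have "((\<lambda>q. (d - x) \<bullet> q) has_derivative (\<lambda>v. (d - x) \<bullet> v)) (at q)" for q
      by (intro has_derivative_inner_right has_derivative_ident)
    then show "\<exists>U g. open U \<and> q \<in> U \<and> (\<forall>q\<in>M \<inter> U. (d - x) \<bullet> q = g q \<and>
        (\<exists>g'. (g has_derivative g') (at q) \<and> (\<forall>v\<in>tangent_space M q. g' v = 0)))" for q
      using orth by (intro exI[of _ UNIV] exI[of _ "\<lambda>q. (d - x) \<bullet> q"]) blast
  qed
  then have "d - x = 0" using assms(3) unfolding full_def by blast
  then show ?thesis using x[OF p] by simp
qed

subsection \<open>Cylinders\<close>

text \<open>M is a graph over its tangent space at \<open>p\<close>: the projection restricted to M
  has the identity as its derivative there, and the inverse function theorem applies after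
  completing it to a map of the full space.\<close>

lemma graph_chart:
  fixes M :: "(real ^ 'n) set"
  assumes "submanifold m M" "p \<in> M" "orth_proj (tangent_space M p) R"
  obtains \<phi> \<delta> U where "\<delta> > 0" "smooth_on (ball (R p) \<delta>) \<phi>" "open U" "p \<in> U"
    "\<And>y. y \<in> tangent_space M p \<Longrightarrow> y \<in> ball (R p) \<delta> \<Longrightarrow> \<phi> y \<in> M \<inter> U \<and> R (\<phi> y) = y"
    "\<And>x. x \<in> M \<inter> U \<Longrightarrow> R x \<in> ball (R p) \<delta> \<and> \<phi> (R x) = x"
proof -
  obtain U0 V S \<Phi> \<Psi> where ch: "slice_chart m M U0 V S \<Phi> \<Psi>" "p \<in> U0"
    using submanifold_slice_chart[OF assms(1,2)] by blast
  interpret slice_chart m M U0 V S \<Phi> \<Psi> by fact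
  note R = assms(3) and T = subspace_tangent_space[OF assms(2) ch(2)]
  note linR = orth_proj_linear[OF R]
  then have bR: "bounded_linear R" by (simp add: linear_conv_bounded_linear)
  define u0 L where "u0 = \<Phi> p" and "L = d\<Psi> u0"
  have u0: "u0 \<in> V" "\<Psi> u0 = p" "u0 \<in> S"
    using \<Phi>_in \<Psi>_\<Phi> ch(2) in_M_iff assms(2) by (auto simp: u0_def)
  have L: "linear L" "inj L" "tangent_space M p = L ` S"
    using linear_d\<Psi>[OF u0(1)] inj_d\<Psi>[OF u0(1)] tangent_space_eq[OF assms(2) ch(2)]
    by (simp_all add: L_def u0_def)
  have bL: "bounded_linear L" using L(1) by (simp add: linear_conv_bounded_linear)
  \<comment> \<open>\<open>R\<close> composed with \<open>\<Psi>\<close> loses the normal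
    directions. The added normal part of the linearisation restores them, making the derivative at
    \<open>u0\<close> equal to \<open>L\<close>; it vanishes on S because \<open>L\<close> maps S to
    tangent vectors.\<close>
  define f where "f u = R (\<Psi> u) + (L (u - u0) - R (L (u - u0)))" for u
  have sL: "smooth_on V (\<lambda>u. L (u - u0))"
    by (intro smooth_on_linear_compose[OF open_V _ bL] smooth_on_diff smooth_on_id smooth_on_const open_V)
  have smooth_f: "smooth_on V f"
    unfolding f_def
    by (intro smooth_on_add smooth_on_diff open_V sL smooth_on_linear_compose[OF open_V sL bR]
        smooth_on_linear_compose[OF open_V smooth_\<Psi> bR])
  have "(f has_derivative (\<lambda>w. R (L w) + (L (w - 0) - R (L (w - 0))))) (at u0)"
    unfolding f_def L_def
    by (intro has_derivative_add has_derivative_diff bounded_linear.has_derivative[OF bR]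
        bounded_linear.has_derivative[OF bL[unfolded L_def]] \<Psi>_derivative u0 has_derivative_ident
        has_derivative_const)
  then have "frechet_derivative f (at u0) = L"
    using frechet_derivative_at by force
  then have "inj (frechet_derivative f (at u0))" using L by simp
  from smooth_inverse_function[OF open_V smooth_f u0(1) this]
  obtain U' V' g where g: "open U'" "U' \<subseteq> V" "u0 \<in> U'" "open V'" "homeomorphism U' V' f g"
    "smooth_on V' g" by blast
  have gf: "g (f u) = u" "f u \<in> V'" if "u \<in> U'" for u using g(5) that by (auto simp: homeomorphism_def)
  have fg: "f (g y) = y" "g y \<in> U'" if "y \<in> V'" for y using g(5) that by (auto simp: homeomorphism_def)
  have fS: "f u = R (\<Psi> u)" if "u \<in> S" for u
    using orth_proj_fix[OF R T, of "L (u - u0)"] that u0(3) L(3) subspace_S by (simp add: f_def subspace_diff)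
  have Sf: "u \<in> S" if "f u \<in> tangent_space M p" for u
  proof -
    have "f u - R (\<Psi> u) + R (L (u - u0)) \<in> tangent_space M p"
      using that orth_proj_in[OF R] T by (intro subspace_add subspace_diff)
    then have "L (u - u0) \<in> L ` S" by (simp add: f_def L(3))
    then have "u - u0 \<in> S" using L(2) by (simp add: inj_image_mem_iff)
    then have "u - u0 + u0 \<in> S" using u0(3) subspace_S subspace_add by blast
    then show ?thesis by simp
  qed
  define \<phi> where "\<phi> y = \<Psi> (g y)" for y
  have smooth_\<phi>: "smooth_on V' \<phi>"
    unfolding \<phi>_def using fg(2) g(2) by (intro smooth_on_compose[OF g(4,6) smooth_\<Psi>]) auto
  \<comment> \<open>Restricts M to chart points where \<open>g\<close> inverts \<open>f\<close>, so
    that a point can be recovered from its projection.\<close>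
  define U1 where "U1 = U0 \<inter> \<Phi> -` U'"
  have U1: "open U1" "p \<in> U1"
    unfolding U1_def using continuous_open_preimage[OF smooth_on_imp_continuous_on[OF smooth_\<Phi>] open_U g(1)]
      ch(2) g(3) by (auto simp: u0_def)
  have Rp: "R p \<in> V'" "\<phi> (R p) = p"
    using gf[OF g(3)] fS[OF u0(3)] u0(2) by (auto simp: \<phi>_def)
  have "open (V' \<inter> \<phi> -` U1)"
    by (rule continuous_open_preimage[OF smooth_on_imp_continuous_on[OF smooth_\<phi>] g(4) U1(1)])
  then obtain \<delta> where \<delta>: "\<delta> > 0" "ball (R p) \<delta> \<subseteq> V' \<inter> \<phi> -` U1"
    using openE[of "V' \<inter> \<phi> -` U1" "R p"] Rp U1(2) by auto
  show ?thesis
  proof (rule that[OF \<delta>(1)])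
    show "smooth_on (ball (R p) \<delta>) \<phi>" using smooth_on_subset[OF smooth_\<phi>] \<delta>(2) by blast
    have "open (R -` ball (R p) \<delta>)"
      by (intro open_vimage open_ball linear_continuous_on bR)
    then show "open (U1 \<inter> R -` ball (R p) \<delta>)" "p \<in> U1 \<inter> R -` ball (R p) \<delta>"
      using U1 \<delta>(1) by auto
    show "\<phi> y \<in> M \<inter> (U1 \<inter> R -` ball (R p) \<delta>) \<and> R (\<phi> y) = y"
      if y: "y \<in> tangent_space M p" "y \<in> ball (R p) \<delta>" for y
    proof -
      have V': "y \<in> V'" "\<phi> y \<in> U1" using y(2) \<delta>(2) by auto
      have "g y \<in> S" using Sf[of "g y"] fg(1)[OF V'(1)] y(1) by simp
      moreover have "g y \<in> V" using fg(2)[OF V'(1)] g(2) by blast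
      ultimately have "\<phi> y \<in> M" "R (\<phi> y) = y"
        using in_M_iff[OF \<Psi>_in] \<Phi>_\<Psi> fS fg(1)[OF V'(1)] by (auto simp: \<phi>_def)
      then show ?thesis using V' y(2) by simp
    qed
    show "R x \<in> ball (R p) \<delta> \<and> \<phi> (R x) = x" if x: "x \<in> M \<inter> (U1 \<inter> R -` ball (R p) \<delta>)" for x
    proof -
      have "\<Phi> x \<in> U'" "\<Phi> x \<in> S" "\<Psi> (\<Phi> x) = x" using x in_M_iff \<Psi>_\<Phi> by (auto simp: U1_def)
      then have "\<phi> (R x) = x" using gf fS by (metis \<phi>_def)
      then show ?thesis using x by auto
    qed
  qed
qed

text \<open>The shear subtracting \<open>\<psi> (r x) - r x\<close> flattens the graph onto S. It
  preserves \<open>r\<close>, so adding the same vector inverts it.\<close>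

lemma graph_submanifold:
  fixes S D :: "'a::euclidean_space set"
  assumes S: "subspace S" and r: "orth_proj S r" and D: "open D" "smooth_on D \<psi>"
    and graph: "\<And>z. z \<in> S \<Longrightarrow> z \<in> D \<Longrightarrow> r (\<psi> z) = z"
  shows "submanifold (dim S) (\<psi> ` (S \<inter> D))"
proof -
  define U where "U = r -` D"
  define \<Phi> \<Psi> where "\<Phi> x = x - \<psi> (r x) + r x" and "\<Psi> x = x + \<psi> (r x) - r x" for x
  have br: "bounded_linear r" using orth_proj_linear[OF r] by (simp add: linear_conv_bounded_linear)
  note lin = linear_add[OF orth_proj_linear[OF r]] linear_diff[OF orth_proj_linear[OF r]]
  have rr [simp]: "r (r x) = r x" for x by (rule orth_proj_fix[OF r S orth_proj_in[OF r]])
  have U: "open U" unfolding U_def by (intro open_vimage D linear_continuous_on br)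
  have sr: "smooth_on U r" by (rule smooth_on_linear[OF U br])
  have "smooth_on U (\<lambda>x. \<psi> (r x))"
    by (rule smooth_on_compose[OF U sr D(2)]) (auto simp: U_def)
  note smooth_intros = smooth_on_add smooth_on_diff sr smooth_on_id U this
  have smooth: "smooth_on U \<Phi>" "smooth_on U \<Psi>"
    unfolding \<Phi>_def \<Psi>_def by (intro smooth_intros)+
  have r\<psi>: "r (\<psi> (r x)) = r x" if "x \<in> U" for x
    using graph[OF orth_proj_in[OF r]] that by (simp add: U_def)
  have r\<Phi>: "r (\<Phi> x) = r x" "r (\<Psi> x) = r x" if "x \<in> U" for x
    using r\<psi>[OF that] by (simp_all add: \<Phi>_def \<Psi>_def lin)
  have hom: "homeomorphism U U \<Phi> \<Psi>"
  proof (rule homeomorphismI)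
    show "\<Phi> ` U \<subseteq> U" "\<Psi> ` U \<subseteq> U" using r\<Phi> by (auto simp: U_def)
    show "\<Psi> (\<Phi> x) = x" "\<Phi> (\<Psi> x) = x" if "x \<in> U" for x
      using r\<Phi>[OF that] by (simp_all add: \<Phi>_def[of "\<Psi> x"] \<Psi>_def[of "\<Phi> x"]) (simp_all add: \<Phi>_def \<Psi>_def)
  qed (use smooth smooth_on_imp_continuous_on in auto)
  have "\<psi> z \<in> U" "\<Phi> (\<psi> z) = z" if "z \<in> S" "z \<in> D" for z
    using graph[OF that] that by (simp_all add: \<Phi>_def U_def)
  moreover have "z \<in> D" if "z \<in> U" "z \<in> S" for z
    using that orth_proj_fix[OF r S] by (simp add: U_def)
  moreover have "z \<in> U" if "z \<in> D" "z \<in> S" for z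
    using that orth_proj_fix[OF r S] by (simp add: U_def)
  ultimately have slice: "\<Phi> ` (\<psi> ` (S \<inter> D) \<inter> U) = U \<inter> S"
    by (force simp: image_iff)
  have "\<psi> ` (S \<inter> D) \<subseteq> U" using \<open>\<And>z. z \<in> S \<Longrightarrow> z \<in> D \<Longrightarrow> \<psi> z \<in> U\<close> by blast
  then show ?thesis unfolding submanifold_def using U hom smooth S slice by blast
qed

lemma orth_proj_perp:
  assumes T: "subspace T" and R: "orth_proj T R" and d: "d \<in> T" "d \<noteq> 0"
  shows "orth_proj (T \<inter> {v. d \<bullet> v = 0}) (\<lambda>x. R x - ((x \<bullet> d) / (d \<bullet> d)) *\<^sub>R d)"
  unfolding orth_proj_def
proof (intro conjI allI ballI)
  show "linear (\<lambda>x. R x - ((x \<bullet> d) / (d \<bullet> d)) *\<^sub>R d)"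
    using orth_proj_linear[OF R]
    by (intro linearI) (simp_all add: linear_add linear_scale inner_add_left add_divide_distrib
        scaleR_add_left scaleR_diff_right)
  show "R x - ((x \<bullet> d) / (d \<bullet> d)) *\<^sub>R d \<in> T \<inter> {v. d \<bullet> v = 0}" for x
    using orth_proj_in[OF R] orth_proj_inner[OF R d(1), of x] T d
    by (auto simp: inner_diff_right inner_commute intro: subspace_diff subspace_scale)
  fix x w assume "w \<in> T \<inter> {v. d \<bullet> v = 0}"
  then show "(x - (R x - ((x \<bullet> d) / (d \<bullet> d)) *\<^sub>R d)) \<bullet> w = 0"
    using orth_proj_inner[OF R, of w x] by (simp add: inner_diff_left)
qed

lemma dim_perp:
  fixes d :: "'a::euclidean_space"
  assumes "subspace T" "d \<in> T" "d \<noteq> 0"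
  shows "dim (T \<inter> {v. d \<bullet> v = 0}) = dim T - 1"
proof -
  have "{y \<in> T. \<forall>x\<in>span {d}. orthogonal x y} = T \<inter> {v. d \<bullet> v = 0}"
    by (auto simp: span_singleton orthogonal_def)
  moreover have "span {d} \<subseteq> T" using assms by (simp add: span_minimal)
  ultimately have "dim (T \<inter> {v. d \<bullet> v = 0}) + dim (span {d}) = dim T"
    using dim_subspace_orthogonal_to_vectors[of "span {d}" T] assms(1) by simp
  moreover have "dim (span {d}) = 1" using assms(3) by (simp add: dim_insert)
  ultimately show ?thesis by simp
qed

text \<open>The graph function \<open>\<phi>\<close> of \<open>M\<close> over \<open>T\<^sub>p M\<close> satisfies \<open>\<phi> (y + t d) = \<phi> y + t d\<close>, because
  \<open>d\<close> is tangent to the graph; \<open>N\<close> is the graph of \<open>\<phi>\<close> over the part of \<open>T\<^sub>p M\<close> orthogonal to \<open>d\<close>.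
  Its mean curvature is that of \<open>M\<close>, since the second fundamental form of \<open>M\<close> vanishes in the
  direction of \<open>d\<close>.\<close>

lemma tangent_direction_imp_cylinder:
  fixes M :: "(real ^ 'n) set" and d :: "real ^ 'n"
  assumes sub: "submanifold m M" and "minimal M" "d \<noteq> 0"
    and d: "\<And>q. q \<in> M \<Longrightarrow> d \<in> tangent_space M q" and p: "p \<in> M"
  shows "\<exists>N U. submanifold (m - 1) N \<and> minimal N \<and> N \<subseteq> {x. d \<bullet> x = 0} \<and>
    open U \<and> p \<in> U \<and> openin (top_of_set (cylinder N d)) (M \<inter> U)"
proof -
  define T where "T = tangent_space M p"
  have T: "subspace T" "dim T = m"
    using submanifold_slice_chart[OF sub p] slice_chart.subspace_tangent_space
      slice_chart.dim_tangent_space p unfolding T_def by metis+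
  have dT: "d \<in> T" using d[OF p] by (simp add: T_def)
  obtain R where R: "orth_proj T R" using orth_proj_exists[OF T(1)] by blast
  obtain \<phi> \<delta> U where \<delta>: "\<delta> > 0" "smooth_on (ball (R p) \<delta>) \<phi>" and U: "open U" "p \<in> U"
    and \<phi>: "\<And>y. y \<in> T \<Longrightarrow> y \<in> ball (R p) \<delta> \<Longrightarrow> \<phi> y \<in> M \<inter> U \<and> R (\<phi> y) = y"
    and \<phi>R: "\<And>x. x \<in> M \<inter> U \<Longrightarrow> R x \<in> ball (R p) \<delta> \<and> \<phi> (R x) = x"
    using graph_chart[OF sub p R[unfolded T_def]] unfolding T_def by metis
  have bR: "bounded_linear R" using orth_proj_linear[OF R] by (simp add: linear_conv_bounded_linear)
  have Rd: "R d = d" by (rule orth_proj_fix[OF R T(1) dT])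
  have Rid: "R x \<bullet> d = x \<bullet> d" for x by (rule orth_proj_inner[OF R dT])
  have dd: "d \<bullet> d \<noteq> 0" using \<open>d \<noteq> 0\<close> by simp
  define B where "B = ball (R p) \<delta>"
  \<comment> \<open>On M the composition of \<open>\<phi>\<close> with \<open>R\<close> is the
    identity; differentiate it in the tangent direction \<open>d\<close>, which \<open>R\<close>
    fixes.\<close>
  have D\<phi>: "frechet_derivative \<phi> (at y) d = d" if y: "y \<in> T" "y \<in> B" for y
  proof -
    have q: "\<phi> y \<in> M" "\<phi> y \<in> U" "R (\<phi> y) = y" using \<phi> y by (auto simp: B_def)
    have "(\<phi> has_derivative frechet_derivative \<phi> (at y)) (at (R (\<phi> y)))"
      using smooth_on_has_derivative[OF \<delta>(2)] y q(3) by (simp add: B_def)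
    from has_derivative_compose[OF bounded_linear_imp_has_derivative[OF bR] this]
    have "((\<lambda>x. \<phi> (R x)) has_derivative (\<lambda>v. frechet_derivative \<phi> (at y) (R v))) (at (\<phi> y))" .
    from tangent_derivative_cong[OF d[OF q(1)] U(1) q(2) has_derivative_ident this] \<phi>R
    show ?thesis by (simp add: Rd)
  qed
  \<comment> \<open>The admissible parameters form an interval, since the ball is convex, and the
    difference of the two sides has derivative 0 there.\<close>
  have translate: "\<phi> (y + t *\<^sub>R d) = \<phi> y + t *\<^sub>R d"
    if y: "y \<in> T" "y \<in> B" "y + t *\<^sub>R d \<in> B" for y t
  proof -
    define J where "J = (\<lambda>s. s *\<^sub>R d) -` ball (R p - y) \<delta>"
    have J: "s \<in> J \<longleftrightarrow> y + s *\<^sub>R d \<in> B" for s by (simp add: J_def B_def dist_norm algebra_simps)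
    have convJ: "convex J" unfolding J_def
      by (intro convex_linear_vimage convex_ball) (simp add: linear_scaleR_left)
    have "((\<lambda>s. \<phi> (y + s *\<^sub>R d) - s *\<^sub>R d) has_derivative (\<lambda>h. 0)) (at s within J)" if s: "s \<in> J" for s
    proof -
      have ys: "y + s *\<^sub>R d \<in> T" "y + s *\<^sub>R d \<in> B"
        using y(1) dT T(1) s J by (auto intro: subspace_add subspace_scale)
      have "((\<lambda>s. \<phi> (y + s *\<^sub>R d)) has_vector_derivative frechet_derivative \<phi> (at (y + s *\<^sub>R d)) d) (at s)"
        by (rule has_vector_derivative_along_line, rule smooth_on_has_derivative[OF \<delta>(2)])
          (use ys in \<open>simp add: B_def\<close>)
      then have "((\<lambda>s. \<phi> (y + s *\<^sub>R d)) has_vector_derivative d) (at s)"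
        by (simp add: D\<phi>[OF ys])
      then have "((\<lambda>s. \<phi> (y + s *\<^sub>R d) - s *\<^sub>R d) has_vector_derivative d - d) (at s)"
        by (intro has_vector_derivative_diff) (auto intro!: derivative_eq_intros)
      then show ?thesis by (auto simp: has_vector_derivative_def intro: has_derivative_at_withinI)
    qed
    then have "\<phi> (y + t *\<^sub>R d) - t *\<^sub>R d = \<phi> (y + 0 *\<^sub>R d) - 0 *\<^sub>R d"
      by (intro has_derivative_zero_unique[OF convJ]) (use y J in auto)
    then show ?thesis by (simp add: diff_eq_eq)
  qed
  \<comment> \<open>\<open>\<kappa>\<close> is the coordinate of \<open>p\<close> along
    \<open>d\<close>. M is cut at this height and the slice is moved down to the hyperplane through
    0, so the same hyperplane serves every \<open>p\<close>.\<close>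
  define \<kappa> S D where "\<kappa> = (R p \<bullet> d) / (d \<bullet> d)" and "S = T \<inter> {v. d \<bullet> v = 0}"
    and "D = ball (R p - \<kappa> *\<^sub>R d) \<delta>"
  define \<psi> where "\<psi> z = \<phi> (z + \<kappa> *\<^sub>R d) - \<kappa> *\<^sub>R d" for z
  define \<pi> where "\<pi> x = x - ((x \<bullet> d) / (d \<bullet> d)) *\<^sub>R d" for x
  define N where "N = \<psi> ` (S \<inter> D)"
  have DB: "z \<in> D \<longleftrightarrow> z + \<kappa> *\<^sub>R d \<in> B" for z by (simp add: D_def B_def dist_norm algebra_simps)
  have ST: "z + t *\<^sub>R d \<in> T" if "z \<in> S" for z t
    using that dT T(1) by (auto simp: S_def intro: subspace_add subspace_scale)
  have subS: "subspace S"
    unfolding S_def by (intro subspace_inter T) (rule subspace_hyperplane)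
  have R\<psi>: "R (\<psi> z) = z" "\<psi> z + \<kappa> *\<^sub>R d \<in> M \<inter> U" if "z \<in> S" "z \<in> D" for z
    using \<phi>[OF ST[OF that(1)]] that(2) Rd
    by (simp_all add: \<psi>_def DB B_def linear_diff[OF orth_proj_linear[OF R]]
        linear_scale[OF orth_proj_linear[OF R]] del: mem_ball)
  have \<psi>d: "\<psi> z \<bullet> d = 0" if "z \<in> S" "z \<in> D" for z
    using Rid[of "\<psi> z"] R\<psi>[OF that] that(1) by (simp add: S_def inner_commute)
  have N_perp: "x \<bullet> d = 0" "x + \<kappa> *\<^sub>R d \<in> M" "x + \<kappa> *\<^sub>R d \<in> U" if "x \<in> N" for x
    using that \<psi>d R\<psi> by (auto simp: N_def)
  have \<pi>N: "\<pi> q \<in> N" if q: "q \<in> M" "q \<in> U" for q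
  proof -
    define y where "y = R q"
    have y: "y \<in> T" "y \<in> B" "\<phi> y = q" "y \<bullet> d = q \<bullet> d"
      using \<phi>R[of q] q orth_proj_in[OF R] Rid by (auto simp: y_def B_def)
    have perp: "\<pi> v \<in> T \<and> d \<bullet> \<pi> v = 0" if "v \<in> T" for v
      using that dT T(1) dd by (auto simp: \<pi>_def inner_diff_right inner_commute intro: subspace_diff subspace_scale)
    then have \<pi>S: "\<pi> y \<in> S" using y(1) by (simp add: S_def)
    \<comment> \<open>The centre of \<open>D\<close> is \<open>\<pi> (R p)\<close>, so a projection
      that does not increase length maps \<open>B\<close> into \<open>D\<close>.\<close>
    have "norm (\<pi> v) \<le> norm v" for v
    proof -
      have "v \<bullet> v = \<pi> v \<bullet> \<pi> v + (((v \<bullet> d) / (d \<bullet> d)) *\<^sub>R d) \<bullet> (((v \<bullet> d) / (d \<bullet> d)) *\<^sub>R d)"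
        using dd by (simp add: \<pi>_def inner_diff_left inner_diff_right inner_commute field_simps)
      then have "\<pi> v \<bullet> \<pi> v \<le> v \<bullet> v" using inner_ge_zero[of "((v \<bullet> d) / (d \<bullet> d)) *\<^sub>R d"] by linarith
      then show ?thesis by (simp add: norm_eq_sqrt_inner)
    qed
    moreover have "\<pi> (R p) - \<pi> y = \<pi> (R p - y)"
      by (simp add: \<pi>_def inner_diff_left diff_divide_distrib algebra_simps)
    ultimately have "dist (\<pi> (R p)) (\<pi> y) \<le> dist (R p) y" by (simp add: dist_norm)
    also have "\<dots> < \<delta>" using y(2) by (simp add: B_def)
    finally have \<pi>D: "\<pi> y \<in> D" by (simp add: D_def \<kappa>_def \<pi>_def)
    have eq: "\<pi> y + \<kappa> *\<^sub>R d = y + (\<kappa> - (y \<bullet> d) / (d \<bullet> d)) *\<^sub>R d"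
      by (simp add: \<pi>_def algebra_simps)
    then have "\<phi> (\<pi> y + \<kappa> *\<^sub>R d) = q + (\<kappa> - (y \<bullet> d) / (d \<bullet> d)) *\<^sub>R d"
      using translate[OF y(1,2)] \<pi>D y(3) by (simp add: DB)
    then have "\<psi> (\<pi> y) = \<pi> q" by (simp add: \<psi>_def \<pi>_def y(4) algebra_simps)
    then show ?thesis using \<pi>S \<pi>D unfolding N_def by (metis IntI imageI)
  qed
  have subN: "submanifold (m - 1) N"
  proof -
    have "orth_proj S (\<lambda>x. R x - ((x \<bullet> d) / (d \<bullet> d)) *\<^sub>R d)"
      unfolding S_def by (rule orth_proj_perp[OF T(1) R dT \<open>d \<noteq> 0\<close>])
    moreover have "smooth_on D \<psi>"
      unfolding \<psi>_def D_def
      by (intro smooth_on_diff smooth_on_const smooth_on_compose[OF _ _ \<delta>(2)] smooth_on_add smooth_on_id)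
        (auto simp: dist_norm algebra_simps)
    ultimately have "submanifold (dim S) N"
      unfolding N_def
      by (intro graph_submanifold[OF subS]) (use R\<psi>(1) \<psi>d in \<open>auto simp: D_def\<close>)
    \<comment> \<open>Since the nonzero \<open>d\<close> lies in \<open>T\<close>, the natural
      number subtraction is genuine.\<close>
    then show ?thesis using dim_perp[OF T(1) dT \<open>d \<noteq> 0\<close>] T(2) by (simp add: S_def)
  qed
  \<comment> \<open>Curves in N become curves in M by the shift along \<open>d\<close>; curves in M
    become curves in N by projecting out \<open>d\<close>.\<close>
  have tangentN: "tangent_space N x = tangent_space M (x + \<kappa> *\<^sub>R d) \<inter> {v. d \<bullet> v = 0}"
    if x: "x \<in> N" for x
  proof (intro equalityI subsetI)
    fix v assume v: "v \<in> tangent_space N x"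
    have "d \<bullet> v = 0"
      by (rule tangent_derivative_cong[OF v open_UNIV _ has_derivative_inner_right[OF has_derivative_ident]
            has_derivative_const])
        (use N_perp(1) in \<open>auto simp: inner_commute\<close>)
    moreover obtain \<epsilon> \<gamma> where \<gamma>: "\<epsilon> > 0" "smooth_on {-\<epsilon><..<\<epsilon>} \<gamma>"
      "\<And>t. t \<in> {-\<epsilon><..<\<epsilon>} \<Longrightarrow> \<gamma> t \<in> N \<inter> UNIV" "\<gamma> 0 = x" "(\<gamma> has_vector_derivative v) (at 0)"
      using tangent_spaceE[OF v open_UNIV] by blast
    have "v \<in> tangent_space M (x + \<kappa> *\<^sub>R d)"
    proof (rule tangent_spaceI[OF _ \<gamma>(1) open_UNIV])
      show "smooth_on {-\<epsilon><..<\<epsilon>} (\<lambda>t. \<gamma> t + \<kappa> *\<^sub>R d)"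
        by (intro smooth_on_add smooth_on_const \<gamma>(2)) auto
      show "((\<lambda>t. \<gamma> t + \<kappa> *\<^sub>R d) has_vector_derivative v) (at 0)"
        using has_vector_derivative_add[OF \<gamma>(5) has_vector_derivative_const] by simp
    qed (use \<gamma>(3,4) N_perp(2) in auto)
    ultimately show "v \<in> tangent_space M (x + \<kappa> *\<^sub>R d) \<inter> {v. d \<bullet> v = 0}" by simp
  next
    fix v assume v: "v \<in> tangent_space M (x + \<kappa> *\<^sub>R d) \<inter> {v. d \<bullet> v = 0}"
    then have v': "v \<in> tangent_space M (x + \<kappa> *\<^sub>R d)" "d \<bullet> v = 0" by auto
    obtain \<epsilon> \<gamma> where \<gamma>: "\<epsilon> > 0" "smooth_on {-\<epsilon><..<\<epsilon>} \<gamma>"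
      "\<And>t. t \<in> {-\<epsilon><..<\<epsilon>} \<Longrightarrow> \<gamma> t \<in> M \<inter> U" "\<gamma> 0 = x + \<kappa> *\<^sub>R d"
      "(\<gamma> has_vector_derivative v) (at 0)"
      using tangent_spaceE[OF v'(1) U(1) N_perp(3)[OF x]] by blast
    have "linear \<pi>"
      unfolding \<pi>_def by (intro linearI) (simp_all add: inner_add_left add_divide_distrib
          scaleR_add_left scaleR_diff_right)
    then have b\<pi>: "bounded_linear \<pi>" by (simp add: linear_conv_bounded_linear)
    show "v \<in> tangent_space N x"
    proof (rule tangent_spaceI[OF _ \<gamma>(1) open_UNIV])
      show "smooth_on {-\<epsilon><..<\<epsilon>} (\<lambda>t. \<pi> (\<gamma> t))"
        by (rule smooth_on_linear_compose[OF _ \<gamma>(2) b\<pi>]) simp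
      show "((\<lambda>t. \<pi> (\<gamma> t)) has_vector_derivative v) (at 0)"
        using has_vector_derivative_compose[OF \<gamma>(5) bounded_linear_imp_has_derivative[OF b\<pi>]] v'(2)
        by (simp add: \<pi>_def inner_commute)
      show "\<pi> (\<gamma> 0) = x"
        using N_perp(1)[OF x] dd by (simp add: \<gamma>(4) \<pi>_def inner_add_left)
    qed (use \<gamma>(3) \<pi>N in auto)
  qed
  have "mean_curvature_vector N x = 0" if x: "x \<in> N" for x
  proof -
    define q where "q = x + \<kappa> *\<^sub>R d"
    have qM: "q \<in> M" using N_perp(2)[OF x] by (simp add: q_def)
    obtain U0 V0 S0 \<Phi> \<Psi> where ch: "slice_chart m M U0 V0 S0 \<Phi> \<Psi>" "q \<in> U0"
      using submanifold_slice_chart[OF sub qM] by blast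
    obtain P where P: "tangent_projector M U0 P"
      using slice_chart.tangent_projector_exists[OF ch(1)] by blast
    interpret M: projected M U0 P by (rule projected.intro[OF P])
    define U1 where "U1 = (\<lambda>y. y + \<kappa> *\<^sub>R d) -` U0"
    \<comment> \<open>The tangent projection of M at the shifted point with the direction
      \<open>d\<close> removed. The removed term is independent of \<open>y\<close>, so
      \<open>P\<close> and \<open>Q\<close> have the same derivative.\<close>
    define Q where "Q y b = P (y + \<kappa> *\<^sub>R d) b - ((b \<bullet> d) / (d \<bullet> d)) *\<^sub>R d" for y b
    have U1: "open U1" unfolding U1_def by (intro open_vimage M.open_dom continuous_intros)
    have xU1: "x \<in> U1" using ch(2) by (simp add: U1_def q_def)
    have "tangent_projector N U1 Q"
      unfolding tangent_projector_def
    proof (intro conjI ballI allI)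
      show "linear (Q y)" if "y \<in> U1" for y
        using M.linear_P[of "y + \<kappa> *\<^sub>R d"] that unfolding Q_def U1_def
        by (intro linearI) (simp_all add: linear_add linear_scale inner_add_left add_divide_distrib
            scaleR_add_left scaleR_diff_right)
      show "smooth_on U1 (\<lambda>y. Q y b)" for b
        unfolding Q_def
        by (intro smooth_on_diff smooth_on_const smooth_on_compose[OF U1 _ M.smooth_P] smooth_on_add
            smooth_on_id U1) (auto simp: U1_def)
      fix y assume y: "y \<in> N \<inter> U1"
      then have yM: "y + \<kappa> *\<^sub>R d \<in> M" "y + \<kappa> *\<^sub>R d \<in> U0" using N_perp(2) by (auto simp: U1_def)
      have "orth_proj (tangent_space M (y + \<kappa> *\<^sub>R d) \<inter> {v. d \<bullet> v = 0}) (Q y)"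
        unfolding Q_def
        by (rule orth_proj_perp[OF M.subspace_tangent[OF yM] M.orth_P[OF yM] d[OF yM(1)] \<open>d \<noteq> 0\<close>])
      then show "orth_proj (tangent_space N y) (Q y)" using tangentN y by simp
      have "subspace (tangent_space M (y + \<kappa> *\<^sub>R d) \<inter> {v. d \<bullet> v = 0})"
        by (intro subspace_inter M.subspace_tangent yM) (rule subspace_hyperplane)
      then show "subspace (tangent_space N y)" using tangentN y by simp
    qed (fact U1)
    then interpret N: projected N U1 Q by (rule projected.intro)
    have DQ: "N.DP x v b = M.DP q v b" for v b
    proof -
      have "((\<lambda>y. y + \<kappa> *\<^sub>R d) has_derivative (\<lambda>v. v)) (at x)"
        by (auto intro!: derivative_eq_intros)
      from has_derivative_compose[OF this M.P_derivative[OF ch(2), unfolded q_def]]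
      have "((\<lambda>y. P (y + \<kappa> *\<^sub>R d) b) has_derivative (\<lambda>v. M.DP q v b)) (at x)"
        by (simp add: q_def)
      from has_derivative_diff[OF this has_derivative_const]
      have "((\<lambda>y. Q y b) has_derivative (\<lambda>v. M.DP q v b)) (at x)" by (simp add: Q_def)
      then show ?thesis using has_derivative_unique[OF N.P_derivative[OF xU1]] by metis
    qed
    \<comment> \<open>\<open>P\<close> fixes \<open>d\<close> at every point of M, so the derivative
      vanishes.\<close>
    have DPd: "M.DP q d d = 0"
      by (rule tangent_derivative_cong[OF d[OF qM] M.open_dom ch(2) M.P_derivative[OF ch(2)]
            has_derivative_const])
        (use orth_proj_fix[OF M.orth_P M.subspace_tangent] d in blast)
    \<comment> \<open>The traces for N and M differ by the value of the second fundamental form on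
      the unit vector along \<open>d\<close>, which is 0.\<close>
    have "(\<Sum>b\<in>Basis. M.DP q (Q x b) b)
      = (\<Sum>b\<in>Basis. M.DP q (P q b) b) - (\<Sum>b\<in>Basis. ((b \<bullet> d) / (d \<bullet> d)) *\<^sub>R M.DP q d b)"
      by (simp add: Q_def q_def[symmetric] linear_diff[OF M.linear_DP_left[OF ch(2)]]
          linear_scale[OF M.linear_DP_left[OF ch(2)]] sum_subtractf)
    also have "(\<Sum>b\<in>Basis. M.DP q (P q b) b) = 0"
      using M.mean_curvature_zero_iff[OF qM ch(2)] assms(2) qM by (simp add: minimal_def)
    also have "(\<Sum>b\<in>Basis. ((b \<bullet> d) / (d \<bullet> d)) *\<^sub>R M.DP q d b)
      = (1 / (d \<bullet> d)) *\<^sub>R M.DP q d (\<Sum>b\<in>Basis. (d \<bullet> b) *\<^sub>R b)"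
      using M.linear_DP_right[OF ch(2), of d]
      by (simp add: linear_sum linear_scale scaleR_sum_right inner_commute)
    also have "\<dots> = 0" by (simp add: euclidean_representation DPd)
    finally show ?thesis using N.mean_curvature_zero_iff[OF x xU1] by (simp add: DQ)
  qed
  then have "minimal N" by (simp add: minimal_def)
  moreover have "M \<inter> U = cylinder N d \<inter> R -` B"
  proof (intro equalityI subsetI)
    fix q assume q: "q \<in> M \<inter> U"
    have "q = \<pi> q + ((q \<bullet> d) / (d \<bullet> d)) *\<^sub>R d" by (simp add: \<pi>_def)
    then have "q \<in> cylinder N d" using \<pi>N q unfolding cylinder_def by blast
    then show "q \<in> cylinder N d \<inter> R -` B" using \<phi>R[OF q] by (simp add: B_def)
  next
    fix q assume "q \<in> cylinder N d \<inter> R -` B"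
    then obtain z t where z: "z \<in> S" "z \<in> D" "q = \<psi> z + t *\<^sub>R d" "R q \<in> B"
      by (auto simp: cylinder_def N_def)
    have "R q = z + t *\<^sub>R d"
      using R\<psi>(1)[OF z(1,2)] Rd by (simp add: z(3) linear_add[OF orth_proj_linear[OF R]]
          linear_scale[OF orth_proj_linear[OF R]])
    then have B: "z + \<kappa> *\<^sub>R d \<in> B" "z + t *\<^sub>R d \<in> B" using z DB by auto
    have eq: "z + \<kappa> *\<^sub>R d + (t - \<kappa>) *\<^sub>R d = z + t *\<^sub>R d" by (simp add: algebra_simps)
    have "\<phi> (z + t *\<^sub>R d) = \<phi> (z + \<kappa> *\<^sub>R d) + (t - \<kappa>) *\<^sub>R d"
      using translate[OF ST[OF z(1)] B(1), of "t - \<kappa>"] B(2) unfolding eq by blast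
    also have "\<dots> = q" by (simp add: z(3) \<psi>_def algebra_simps)
    finally show "q \<in> M \<inter> U" using \<phi>[OF ST[OF z(1)]] B(2) by (auto simp: B_def)
  qed
  moreover have "open (R -` B)" unfolding B_def by (intro open_vimage open_ball linear_continuous_on bR)
  ultimately show ?thesis
    using subN U N_perp(1) unfolding openin_open
    by (intro exI[of _ N] exI[of _ U]) (auto simp: inner_commute)
qed

theorem theorem1p1:
  fixes M :: "(real ^ 'n) set" and d :: "real ^ 'n" and m :: nat and \<theta> :: real
  assumes "submanifold m M" and "connected M"
    and "d \<noteq> 0"
    and "full M" and "minimal M"
    and "helix M d \<theta>" and "ruled M d"
  shows "(\<forall>p\<in>M. d \<in> tangent_space M p) \<and>
         \<theta> = 0 \<and>
         (\<exists>c. \<forall>p\<in>M. \<exists>N U.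
            submanifold (m - 1) N \<and> minimal N \<and> N \<subseteq> {x. d \<bullet> x = c} \<and>
            open U \<and> p \<in> U \<and> openin (top_of_set (cylinder N d)) (M \<inter> U))"
proof -
  have tan: "tangent_part M p d = d" if "p \<in> M" for p
    by (rule minimal_ruled_helix_tangent[OF assms(1,2,4-7) that])
  have d: "d \<in> tangent_space M p" if p: "p \<in> M" for p
  proof -
    obtain U V S \<Phi> \<Psi> where ch: "slice_chart m M U V S \<Phi> \<Psi>" "p \<in> U"
      using submanifold_slice_chart[OF assms(1) p] by blast
    obtain P where P: "tangent_projector M U P"
      using slice_chart.tangent_projector_exists[OF ch(1)] by blast
    interpret projected M U P by (rule projected.intro[OF P])
    show ?thesis
      using orth_proj_in[OF orth_P[OF p ch(2)], of d] tangent_part_eq[OF p ch(2)] tan[OF p] by simp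
  qed
  have "M \<noteq> {}" using assms(3,4) by (auto simp: full_def)
  then obtain p where "p \<in> M" by blast
  then have "norm d = norm d * cos \<theta>" using assms(6) tan by (auto simp: helix_def)
  then have "cos \<theta> = 1" using assms(3) by simp
  moreover have "0 \<le> \<theta>" "\<theta> \<le> pi / 2" using assms(6) by (auto simp: helix_def)
  ultimately have "\<theta> = 0" using cos_inj_pi[of \<theta> 0] pi_ge_zero by simp
  \<comment> \<open>The constant is 0, because each slice N was moved along \<open>d\<close> to the
    hyperplane through the origin; the cylinder does not notice the shift.\<close>
  then show ?thesis
    using d tangent_direction_imp_cylinder[OF assms(1,5,3) d] by blast
qed

end
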